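(* Let $(X,\|\cdot\|)$ be a finite dimensional normed space and $m\in\{1,\ldots,\dim X-1\}$. If $m=1$ or $m=2$ or $m=\dim X-1$, then every $W\in\mathbf G_m(X)$ admits a density contractor with respect to $\mathcal H^m_{\|\cdot\|}$.
   Context: $\mathbf G_m(X)$ is the set of $m$-dimensional linear subspaces of $X$. $\mathcal H^m_{\|\cdot\|}$ is the $m$-dimensional Hausdorff measure on $X$ associated with the metric $\|x-y\|$, computed with weights $\alpha(m)2^{-m}(\mathrm{diam}\,E)^m$, where $\alpha(m)$ is the Lebesgue measure of the Euclidean unit ball of $\mathbf R^m$. $\mathrm{Hom}_m(X,X)$ is the (metric) space of linear maps $\pi:X\to X$ with $\mathrm{rank}\,\pi\le m$, and $\mathrm{Hom}(X,W)$ is the set of linear maps $\pi:X\to X$ with $\mathrm{im}\,\pi\subset W$. A density contractor on $W\in\mathbf G_m(X)$ with respect to $\mathcal H^m_{\|\cdot\|}$ is a Borel probability measure $\mu$ on $\mathrm{Hom}_m(X,X)$ such that (1) $\mu(\mathrm{Hom}_m(X,X)\setminus\mathrm{Hom}(X,W))=0$; (2) for every $V\in\mathbf G_m(X)$ and every Borel $A\subset V$, $\int_{\mathrm{Hom}_m(X,X)}\mathcal H^m_{\|\cdot\|}(\pi(A))\,d\mu(\pi)\le\mathcal H^m_{\|\cdot\|}(A)$, with equality when $V=W$. *)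

theory Defs
  imports "HOL-Analysis.Analysis" "HOL-Probability.Probability"
begin

text \<open>
  The \<open>m\<close>-dimensional Hausdorff (outer) measure of the metric of the type, normalised by the
  volume \<^term>\<open>unit_ball_vol (real m)\<close> of the Euclidean unit ball of \<open>m\<close>-space.
  Covering sets are required to be bounded because \<^const>\<open>diameter\<close> is unspecified on
  unbounded sets. The empty set is singled out only on account of \<open>0 ^ 0 = 1\<close>.
\<close>

definition hausdorff_weight :: "nat \<Rightarrow> 'a::metric_space set \<Rightarrow> ennreal" where
  "hausdorff_weight m E =
     (if E = {} then 0 else ennreal (unit_ball_vol (real m) / 2 ^ m * diameter E ^ m))"

definition hausdorff_premeasure :: "nat \<Rightarrow> real \<Rightarrow> 'a::metric_space set \<Rightarrow> ennreal" where
  "hausdorff_premeasure m \<delta> A =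
     (INF E \<in> {E :: nat \<Rightarrow> 'a set. A \<subseteq> (\<Union>i. E i) \<and> (\<forall>i. bounded (E i) \<and> diameter (E i) \<le> \<delta>)}.
        \<Sum>i. hausdorff_weight m (E i))"

definition hausdorff_measure :: "nat \<Rightarrow> 'a::metric_space set \<Rightarrow> ennreal" where
  "hausdorff_measure m A = (SUP \<delta> \<in> {0<..}. hausdorff_premeasure m \<delta> A)"

definition grassmannian :: "nat \<Rightarrow> 'a::real_vector set set" where
  "grassmannian m = {V. subspace V \<and> dim V = m}"

text \<open>
  On a finite-dimensional space every linear map is bounded, so \<^typ>\<open>'a \<Rightarrow>\<^sub>L 'a\<close> is the space
  of all linear endomorphisms; its metric is that of the operator norm.
\<close>

definition Hom_rank :: "nat \<Rightarrow> ('a::real_normed_vector \<Rightarrow>\<^sub>L 'a) set" where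
  "Hom_rank m = {\<pi>. dim (range (blinfun_apply \<pi>)) \<le> m}"

definition Hom_into :: "'a::real_normed_vector set \<Rightarrow> ('a \<Rightarrow>\<^sub>L 'a) set" where
  "Hom_into W = {\<pi>. range (blinfun_apply \<pi>) \<subseteq> W}"

text \<open>
  The integrand below is a Borel function of \<open>\<pi>\<close>: for \<open>A\<close> inside an \<open>m\<close>-dimensional \<open>V\<close> it is
  the Hausdorff measure of \<open>A\<close> times a factor depending continuously on the restriction of \<open>\<pi>\<close>
  to \<open>V\<close>. The Borel subsets of \<open>V\<close> are the Borel sets of the whole space contained in \<open>V\<close>.
\<close>

definition density_contractor ::
    "nat \<Rightarrow> 'a::real_normed_vector set \<Rightarrow> ('a \<Rightarrow>\<^sub>L 'a) measure \<Rightarrow> bool" where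
  "density_contractor m W \<mu> \<longleftrightarrow>
     prob_space \<mu> \<and>
     space \<mu> = Hom_rank m \<and>
     sets \<mu> = sets (restrict_space borel (Hom_rank m)) \<and>
     emeasure \<mu> (Hom_rank m - Hom_into W) = 0 \<and>
     (\<forall>V \<in> grassmannian m. \<forall>A \<in> sets borel. A \<subseteq> V \<longrightarrow>
        (\<integral>\<^sup>+ \<pi>. hausdorff_measure m (blinfun_apply \<pi> ` A) \<partial>\<mu>) \<le> hausdorff_measure m A \<and>
        (V = W \<longrightarrow>
          (\<integral>\<^sup>+ \<pi>. hausdorff_measure m (blinfun_apply \<pi> ` A) \<partial>\<mu>) = hausdorff_measure m A))"

end

theory Submission
  imports Defs
begin

text \<open>
  In each of the three cases a random linear map into \<open>W\<close> is found by convexity.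

  \<^emph>\<open>From Hausdorff measure to volumes of balls.\<close> Let \<open>\<phi>\<close> be a linear bijection from a Euclidean space
  onto an \<open>m\<close>-dimensional subspace. In the coordinates given by \<open>\<phi>\<close> the Hausdorff measure of that
  subspace is Lebesgue measure, normalised so that the unit ball of the norm has the measure of the
  Euclidean unit ball (\<open>hausdorff_measure_image\<close>). The lower bound is the isodiametric inequality,
  a consequence of the Brunn-Minkowski inequality; the upper bound compares a cube with a small
  ball inside it. So a linear map that carries the unit ball of \<open>V\<close> onto a body in \<open>W\<close> does not
  increase Hausdorff measure if and only if this body has at most the volume of the unit ball
  of \<open>W\<close>.

  \<^emph>\<open>Lines and hyperplanes\<close> admit a single contracting projection, and the contractor is a Dirac
  measure. On a line a supporting functional of the unit ball, extended without increasing its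
  norm, gives a projection of norm one. For hyperplanes write those transversal to a vector \<open>u\<close> as
  graphs over \<open>W\<close> with slope \<open>a\<close>, and let \<open>G a\<close> be the volume of their unit ball, measured in \<open>W\<close>.
  Busemann's theorem says that \<open>1 / G\<close> is convex (\<open>busemann_inequality\<close>). A supporting affine
  function of \<open>1 / G\<close> at slope \<open>0\<close> is given by a vector of \<open>W\<close>, and this vector is the correction to
  \<open>u\<close> that makes the projection along it contract all hyperplanes (\<open>busemann_projection\<close>).

  \<^emph>\<open>Planes\<close> need a genuine average. For \<open>x\<close> uniformly distributed in the unit ball of \<open>W\<close> let \<open>F x\<close>
  be a functional of norm one on the whole space that attains its norm at \<open>x\<close>. The contractor is
  the law of the map with the components \<open>F x\<close> and \<open>F y\<close> in a basis of \<open>W\<close>, for independent \<open>x\<close> and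
  \<open>y\<close>, up to a scalar. On a plane \<open>V\<close> it multiplies area by a multiple of \<open>\<bar>f \<and> g\<bar>\<close>, where \<open>f\<close> and
  \<open>g\<close> are the restrictions of the functionals to \<open>V\<close>. If \<open>K\<close> is the unit ball of \<open>V\<close>, it remains to
  see that the energy \<open>E p p\<close>, the mean of \<open>\<bar>f \<and> g\<bar>\<close> over independent \<open>f\<close> and \<open>g\<close> with law \<open>p\<close>, is
  at most \<open>c = 2 / \<bar>K\<bar>\<close> for every law \<open>p\<close> on the polar of \<open>K\<close>, with equality for the law \<open>q\<close> of the
  functional supporting \<open>K\<close> at a random point of \<open>K\<close>. Slicing \<open>K\<close> by the level lines of a functional
  shows \<open>E p q \<le> c\<close> and \<open>E q q = c\<close> (\<open>slope_integral_ball\<close>). The kernel \<open>\<bar>f \<and> g\<bar>\<close> has only one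
  positive direction, so it satisfies a reversed Cauchy-Schwarz inequality
  \<open>E p p - 2 * t * E p q + t\<^sup>2 * E q q \<le> 0\<close> for a suitable \<open>t \<ge> 0\<close> (\<open>wedge_energy_reverse\<close>).
  Together they give \<open>E p p \<le> (2 * t - t\<^sup>2) * c \<le> c\<close>.
\<close>

section \<open>The Brunn-Minkowski inequality\<close>

lemma linear_vimage_borel:
  fixes R :: "'e::euclidean_space \<Rightarrow> 'b::real_normed_vector"
  assumes "linear R" "X \<in> sets borel"
  shows "R -` X \<in> sets borel"
proof -
  have "R \<in> borel_measurable borel"
    using linear_continuous_on[of R UNIV] assms(1) by (intro borel_measurable_continuous_onI) (simp add: linear_conv_bounded_linear)
  then show ?thesis using measurable_sets[of R borel borel X] assms(2) by simp
qed

lemma affine_image_eq_vimage: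
  fixes t :: "'a::real_vector"
  assumes "c \<noteq> 0"
  shows "(\<lambda>x. t + c *\<^sub>R x) ` A = (\<lambda>x. (1 / c) *\<^sub>R (x - t)) -` A"
proof -
  have "x \<in> (\<lambda>x. t + c *\<^sub>R x) ` A" if "(1 / c) *\<^sub>R (x - t) \<in> A" for x
    using that assms by (intro image_eqI[of _ _ "(1 / c) *\<^sub>R (x - t)"]) auto
  then show ?thesis using assms by auto
qed

lemma affine_image_borel:
  fixes t :: "'a::euclidean_space"
  assumes "c \<noteq> 0" "A \<in> sets borel"
  shows "(\<lambda>x. t + c *\<^sub>R x) ` A \<in> sets borel"
proof -
  have "(\<lambda>x. (1 / c) *\<^sub>R (x - t)) \<in> borel \<rightarrow>\<^sub>M (borel :: 'a measure)" by measurable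
  from measurable_sets[OF this assms(2)] show ?thesis
    unfolding affine_image_eq_vimage[OF assms(1)] by simp
qed

lemma emeasure_affine_image:
  fixes t :: "'a::euclidean_space"
  assumes c: "c \<noteq> 0" and A: "A \<in> sets borel"
  shows "emeasure lborel ((\<lambda>x. t + c *\<^sub>R x) ` A) = ennreal (\<bar>c\<bar> ^ DIM('a)) * emeasure lborel A"
proof -
  let ?T = "\<lambda>x. t + c *\<^sub>R x"
  have inj: "?T x \<in> ?T ` A \<longleftrightarrow> x \<in> A" for x using c by auto
  have "emeasure lborel (?T ` A) = emeasure (density (distr lborel borel ?T) (\<lambda>_. \<bar>c\<bar>^DIM('a))) (?T ` A)"
    using lborel_affine[OF c, of t] by simp
  also have "\<dots> = ennreal (\<bar>c\<bar>^DIM('a)) * emeasure (distr lborel borel ?T) (?T ` A)"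
    using affine_image_borel[OF c A, of t] by (simp add: emeasure_density_const)
  also have "emeasure (distr lborel borel ?T) (?T ` A) = emeasure lborel A"
    using affine_image_borel[OF c A, of t] inj
    by (subst emeasure_distr) (auto simp: vimage_def)
  finally show ?thesis .
qed

text \<open>
  Translate \<open>A\<close> by the least point of \<open>B\<close> and \<open>B\<close> by the greatest point of \<open>A\<close>: both translates lie
  in the sum set, and they share only one point.
\<close>

lemma brunn_minkowski_real_compact:
  fixes A B C :: "real set"
  assumes A: "compact A" "A \<noteq> {}" and B: "compact B" "B \<noteq> {}" and C: "C \<in> sets borel"
    and sum: "\<And>x y. x \<in> A \<Longrightarrow> y \<in> B \<Longrightarrow> x + y \<in> C"
  shows "emeasure lborel A + emeasure lborel B \<le> emeasure lborel C"
proof -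
  define a where "a = Sup A"
  define b where "b = Inf B"
  have a: "a \<in> A" "\<And>x. x \<in> A \<Longrightarrow> x \<le> a" unfolding a_def
    using A compact_imp_bounded[OF A(1)] compact_imp_closed[OF A(1)]
    by (auto intro: closed_contains_Sup cSup_upper dest: bounded_imp_bdd_above)
  have b: "b \<in> B" "\<And>x. x \<in> B \<Longrightarrow> b \<le> x" unfolding b_def
    using B compact_imp_bounded[OF B(1)] compact_imp_closed[OF B(1)]
    by (auto intro: closed_contains_Inf cInf_lower dest: bounded_imp_bdd_below)
  let ?A = "(\<lambda>x. b + 1 *\<^sub>R x) ` A" and ?B = "(\<lambda>x. a + 1 *\<^sub>R x) ` B"
  have AB: "A \<in> sets borel" "B \<in> sets borel"
    using A B by (auto intro: borel_closed compact_imp_closed)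
  have m: "?A \<in> sets lborel" "?B \<in> sets lborel"
    using affine_image_borel[of 1 A b] affine_image_borel[of 1 B a] AB by auto
  have "emeasure lborel A + emeasure lborel B = emeasure lborel ?A + emeasure lborel ?B"
    using AB by (simp only: emeasure_affine_image) simp
  also have "emeasure lborel ?B = emeasure lborel (?B - {a + b})"
    by (intro emeasure_Diff_null_set[symmetric] m) (auto simp: null_sets_def)
  also have "emeasure lborel ?A + \<dots> = emeasure lborel (?A \<union> (?B - {a + b}))"
    using m a(2) b(2) by (intro plus_emeasure) (auto, metis add.commute add_le_cancel_left add_mono_thms_linordered_semiring(1) order_antisym)
  also have "\<dots> \<le> emeasure lborel C"
    using a b C by (intro emeasure_mono) (auto simp: add.commute[of b] intro: sum)
  finally show ?thesis .
qed

text \<open>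
  Compact sets fill up the sets from inside. Each of them is enlarged by a point of the set, because
  a set of measure zero is approximated by the empty set, for which the inequality fails.
\<close>

lemma brunn_minkowski_real:
  fixes A B C :: "real set"
  assumes A: "A \<in> sets borel" "A \<noteq> {}" and B: "B \<in> sets borel" "B \<noteq> {}" and C: "C \<in> sets borel"
    and sum: "\<And>x y. x \<in> A \<Longrightarrow> y \<in> B \<Longrightarrow> x + y \<in> C"
  shows "emeasure lborel A + emeasure lborel B \<le> emeasure lborel C"
proof -
  obtain a b where ab: "a \<in> A" "b \<in> B" using A B by auto
  have inner: "\<exists>T. compact T \<and> T \<subseteq> S \<and> T \<noteq> {} \<and> emeasure lborel (S \<inter> cball 0 n) \<le> emeasure lborel T + ennreal e"
    if S: "S \<in> sets borel" and s: "s \<in> S" and e: "e > 0" for S :: "real set" and s n e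
  proof -
    have "S \<inter> cball 0 n \<in> sets lebesgue" using S by auto
    then obtain T where T: "closed T" "T \<subseteq> S \<inter> cball 0 n"
      "(S \<inter> cball 0 n) - T \<in> lmeasurable" "emeasure lebesgue ((S \<inter> cball 0 n) - T) < ennreal e"
      using sets_lebesgue_inner_closed[of "S \<inter> cball 0 n" e] e by metis
    have cT: "compact T" using T bounded_subset[OF bounded_cball, of T 0 n] by (auto simp: compact_eq_bounded_closed)
    have Tb: "T \<in> sets borel" using T by auto
    have "emeasure lborel (S \<inter> cball 0 n) \<le> emeasure lborel (insert s T \<union> ((S \<inter> cball 0 n) - T))"
      using S Tb by (intro emeasure_mono) auto
    also have "\<dots> \<le> emeasure lborel (insert s T) + emeasure lborel ((S \<inter> cball 0 n) - T)"
      using S Tb by (intro emeasure_subadditive) auto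
    also have "emeasure lborel ((S \<inter> cball 0 n) - T) \<le> ennreal e"
    proof -
      have "(S \<inter> cball 0 n) - T \<in> sets lborel" using S Tb by auto
      then have "emeasure lebesgue ((S \<inter> cball 0 n) - T) = emeasure lborel ((S \<inter> cball 0 n) - T)" by simp
      with T(4) show ?thesis by (simp add: less_imp_le)
    qed
    finally show ?thesis
      using cT T s by (intro exI[of _ "insert s T"]) (auto simp: compact_insert add_left_mono)
  qed
  have main: "emeasure lborel (A \<inter> cball 0 (real n)) + emeasure lborel (B \<inter> cball 0 (real n)) \<le> emeasure lborel C" for n
  proof (rule ennreal_le_epsilon)
    fix e :: real assume e: "e > 0"
    obtain T where T: "compact T" "T \<subseteq> A" "T \<noteq> {}" "emeasure lborel (A \<inter> cball 0 (real n)) \<le> emeasure lborel T + ennreal (e/2)"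
      using inner[OF A(1) ab(1), of "e/2" n] e by auto
    obtain U where U: "compact U" "U \<subseteq> B" "U \<noteq> {}" "emeasure lborel (B \<inter> cball 0 (real n)) \<le> emeasure lborel U + ennreal (e/2)"
      using inner[OF B(1) ab(2), of "e/2" n] e by auto
    have "emeasure lborel (A \<inter> cball 0 (real n)) + emeasure lborel (B \<inter> cball 0 (real n))
       \<le> (emeasure lborel T + ennreal (e/2)) + (emeasure lborel U + ennreal (e/2))"
      by (intro add_mono T U)
    also have "\<dots> = (emeasure lborel T + emeasure lborel U) + (ennreal (e/2) + ennreal (e/2))"
      by (simp only: ac_simps)
    also have "ennreal (e/2) + ennreal (e/2) = ennreal e" using e by (simp flip: ennreal_plus)
    also have "(emeasure lborel T + emeasure lborel U) \<le> emeasure lborel C"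
      using T U C by (intro brunn_minkowski_real_compact sum) auto
    finally show "emeasure lborel (A \<inter> cball 0 (real n)) + emeasure lborel (B \<inter> cball 0 (real n)) \<le> emeasure lborel C + ennreal e"
      by (simp add: add_right_mono)
  qed
  have lim: "(\<lambda>n. emeasure lborel (S \<inter> cball 0 (real n))) \<longlonglongrightarrow> emeasure lborel S" if "S \<in> sets borel" for S :: "real set"
  proof -
    have "(\<Union>n. S \<inter> cball 0 (real n)) = S" by (auto simp: real_arch_simple)
    moreover have "incseq (\<lambda>n. S \<inter> cball 0 (real n))" by (intro incseq_SucI) auto
    ultimately show ?thesis
      using Lim_emeasure_incseq[of "\<lambda>n. S \<inter> cball 0 (real n)" lborel] that by (auto simp: image_subset_iff)
  qed
  show ?thesis
    by (rule LIMSEQ_le_const2[OF tendsto_add[OF lim[OF A(1)] lim[OF B(1)]]]) (use main in auto)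
qed

lemma nn_integral_layer_cake:
  fixes p :: "'a \<Rightarrow> ennreal"
  assumes "sigma_finite_measure M" and [measurable]: "p \<in> borel_measurable M"
  shows "(\<integral>\<^sup>+x. p x \<partial>M) = (\<integral>\<^sup>+\<tau>. indicator {0..} \<tau> * emeasure M {x \<in> space M. ennreal \<tau> < p x} \<partial>lborel)"
proof -
  interpret M: sigma_finite_measure M by fact
  interpret P: pair_sigma_finite M lborel ..
  have pt: "p x = (\<integral>\<^sup>+\<tau>. indicator {0..} \<tau> * indicator {x \<in> space M. ennreal \<tau> < p x} x \<partial>lborel)"
    if "x \<in> space M" for x
  proof -
    have "(\<integral>\<^sup>+\<tau>. indicator {0..} \<tau> * indicator {x \<in> space M. ennreal \<tau> < p x} x \<partial>lborel)
        = (\<integral>\<^sup>+\<tau>. indicator {\<tau>. 0 \<le> \<tau> \<and> ennreal \<tau> < p x} \<tau> \<partial>lborel)"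
      using that by (intro nn_integral_cong) (auto simp: indicator_def)
    also have "\<dots> = emeasure lborel {\<tau>. 0 \<le> \<tau> \<and> ennreal \<tau> < p x}"
      by (intro nn_integral_indicator) simp
    also have "\<dots> = p x"
    proof (cases "p x")
      case (real r)
      then have "{\<tau>. 0 \<le> \<tau> \<and> ennreal \<tau> < p x} = {0..<r}" by (auto simp: ennreal_less_iff)
      then show ?thesis using real by simp
    next
      case top
      then have eq: "{\<tau>. 0 \<le> \<tau> \<and> ennreal \<tau> < p x} = {0..}" by auto
      have U: "(UNIV :: real set) = {0..} \<union> (\<lambda>x. 0 + (-1) *\<^sub>R x) ` {0::real..}"
      proof (intro equalityI subsetI)
        fix x :: real
        have "x = 0 + (-1) *\<^sub>R (- x)" by simp
        then show "x \<in> {0..} \<union> (\<lambda>x. 0 + (-1) *\<^sub>R x) ` {0::real..}"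
          by (cases "0 \<le> x") (auto intro!: image_eqI[of _ _ "- x"])
      qed auto
      have "\<top> = emeasure lborel ({0..} \<union> (\<lambda>x. 0 + (-1) *\<^sub>R x) ` {0::real..})"
        by (subst U[symmetric]) simp
      also have "\<dots> \<le> emeasure lborel {0::real..} + emeasure lborel ((\<lambda>x. 0 + (-1) *\<^sub>R x) ` {0::real..})"
        using affine_image_borel[of "-1::real" "{0::real..}" 0]
        by (intro emeasure_subadditive) auto
      also have "\<dots> = emeasure lborel {0::real..} + emeasure lborel {0::real..}"
        by (subst emeasure_affine_image) auto
      finally have "emeasure lborel {0::real..} = \<top>"
        by (cases "emeasure lborel {0::real..}") (auto simp: top_unique simp flip: ennreal_plus)
      then show ?thesis by (subst eq) (simp add: top)
    qed
    finally show ?thesis by simp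
  qed
  have "(\<integral>\<^sup>+x. p x \<partial>M) = (\<integral>\<^sup>+x. (\<integral>\<^sup>+\<tau>. indicator {0..} \<tau> * indicator {x \<in> space M. ennreal \<tau> < p x} x \<partial>lborel) \<partial>M)"
    by (intro nn_integral_cong pt)
  also have "\<dots> = (\<integral>\<^sup>+\<tau>. (\<integral>\<^sup>+x. indicator {0..} \<tau> * indicator {x \<in> space M. ennreal \<tau> < p x} x \<partial>M) \<partial>lborel)"
    by (rule P.Fubini'[symmetric]) measurable
  also have "\<dots> = (\<integral>\<^sup>+\<tau>. indicator {0..} \<tau> * emeasure M {x \<in> space M. ennreal \<tau> < p x} \<partial>lborel)"
    by (intro nn_integral_cong, subst nn_integral_cmult) auto
  finally show ?thesis .
qed

text \<open>
  The common core of the Prekopa-Leindler inequality and of Busemann's theorem: integrate the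
  one-dimensional Brunn-Minkowski inequality over the superlevel sets. Since both functions
  have supremum one, their superlevel sets become empty at the same level.
\<close>

lemma integral_superlevel_superadditive:
  fixes p q h :: "real \<Rightarrow> ennreal"
  assumes [measurable]: "p \<in> borel_measurable borel" "q \<in> borel_measurable borel" "h \<in> borel_measurable borel"
    and lm: "0 < l" "0 < m"
    and p1: "\<And>x. p x \<le> 1" and q1: "\<And>x. q x \<le> 1"
    and ps: "\<And>\<tau>. 0 \<le> \<tau> \<Longrightarrow> \<tau> < 1 \<Longrightarrow> \<exists>x. ennreal \<tau> < p x"
    and qs: "\<And>\<tau>. 0 \<le> \<tau> \<Longrightarrow> \<tau> < 1 \<Longrightarrow> \<exists>x. ennreal \<tau> < q x"
    and h: "\<And>x y. 0 < p x \<Longrightarrow> 0 < q y \<Longrightarrow> min (p x) (q y) \<le> h (l * x + m * y)"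
  shows "ennreal l * (\<integral>\<^sup>+x. p x \<partial>lborel) + ennreal m * (\<integral>\<^sup>+x. q x \<partial>lborel) \<le> (\<integral>\<^sup>+x. h x \<partial>lborel)"
proof -
  let ?L = "\<lambda>f \<tau>. {x \<in> space lborel. ennreal \<tau> < (f x :: ennreal)} :: real set"
  have sc: "emeasure lborel ((\<lambda>x. 0 + c *\<^sub>R x) ` A) = ennreal c * emeasure lborel A"
    if "0 < c" "A \<in> sets borel" for c and A :: "real set"
    using emeasure_affine_image[of c A 0] that by simp
  have lev: "indicator {0..} \<tau> * (ennreal l * emeasure lborel (?L p \<tau>) + ennreal m * emeasure lborel (?L q \<tau>))
       \<le> indicator {0..} \<tau> * emeasure lborel (?L h \<tau>)" for \<tau> :: real
  proof (cases "0 \<le> \<tau> \<and> \<tau> < 1")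
    case True
    have "ennreal l * emeasure lborel (?L p \<tau>) + ennreal m * emeasure lborel (?L q \<tau>)
        = emeasure lborel ((\<lambda>x. 0 + l *\<^sub>R x) ` ?L p \<tau>) + emeasure lborel ((\<lambda>x. 0 + m *\<^sub>R x) ` ?L q \<tau>)"
      using lm by (subst (1 2) sc) auto
    also have "\<dots> \<le> emeasure lborel (?L h \<tau>)"
    proof (rule brunn_minkowski_real)
      show "(\<lambda>x. 0 + l *\<^sub>R x) ` ?L p \<tau> \<in> sets borel" "(\<lambda>x. 0 + m *\<^sub>R x) ` ?L q \<tau> \<in> sets borel"
        using lm by (intro affine_image_borel; simp)+
      show "(\<lambda>x. 0 + l *\<^sub>R x) ` ?L p \<tau> \<noteq> {}" "(\<lambda>x. 0 + m *\<^sub>R x) ` ?L q \<tau> \<noteq> {}"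
        using ps[of \<tau>] qs[of \<tau>] True by auto
      show "?L h \<tau> \<in> sets borel" by simp
      fix x y assume "x \<in> (\<lambda>x. 0 + l *\<^sub>R x) ` ?L p \<tau>" "y \<in> (\<lambda>x. 0 + m *\<^sub>R x) ` ?L q \<tau>"
      then obtain x' y' where xy: "x = l * x'" "y = m * y'" "ennreal \<tau> < p x'" "ennreal \<tau> < q y'" by auto
      have "ennreal \<tau> < min (p x') (q y')" using xy by simp
      also have "\<dots> \<le> h (l * x' + m * y')"
        using xy by (intro h) (auto intro: le_less_trans[of 0 "ennreal \<tau>"])
      finally show "x + y \<in> ?L h \<tau>" using xy by simp
    qed
    finally show ?thesis by (intro mult_left_mono) auto
  next
    case False
    have "?L p \<tau> = {}" "?L q \<tau> = {}" if "\<tau> \<ge> 1"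
      using p1 q1 that order_trans[of _ 1 "ennreal \<tau>"] by (auto simp: not_less ennreal_ge_1)
    then show ?thesis using False by (cases "\<tau> \<ge> 1") (auto simp: indicator_def)
  qed
  have "ennreal l * (\<integral>\<^sup>+x. p x \<partial>lborel) + ennreal m * (\<integral>\<^sup>+x. q x \<partial>lborel)
     = (\<integral>\<^sup>+\<tau>. indicator {0..} \<tau> * (ennreal l * emeasure lborel (?L p \<tau>) + ennreal m * emeasure lborel (?L q \<tau>)) \<partial>lborel)"
    apply (subst (1 2) nn_integral_layer_cake[OF sigma_finite_lborel])
      apply simp_all
    apply (simp add: nn_integral_cmult[symmetric] nn_integral_add[symmetric] distrib_left ac_simps)
    done
  also have "\<dots> \<le> (\<integral>\<^sup>+\<tau>. indicator {0..} \<tau> * emeasure lborel (?L h \<tau>) \<partial>lborel)"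
    by (intro nn_integral_mono lev)
  also have "\<dots> = (\<integral>\<^sup>+x. h x \<partial>lborel)"
    by (rule nn_integral_layer_cake[OF sigma_finite_lborel, symmetric]) simp
  finally show ?thesis .
qed

text \<open>
  After division by their suprema the geometric mean of the two functions dominates their minimum.
  The superlevel inequality then gives an arithmetic mean of the normalised integrals, and the
  weighted inequality of the means restores the homogeneous form.
\<close>

lemma prekopa_leindler_real:
  fixes F G :: "real \<Rightarrow> real" and H :: "real \<Rightarrow> ennreal"
  assumes [measurable]: "F \<in> borel_measurable borel" "G \<in> borel_measurable borel" "H \<in> borel_measurable borel"
    and t: "0 < t" "t < 1"
    and F: "\<And>x. 0 \<le> F x" "\<And>x. F x \<le> M" and G: "\<And>x. 0 \<le> G x" "\<And>x. G x \<le> M"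
    and H: "\<And>x y. 0 < F x \<Longrightarrow> 0 < G y \<Longrightarrow> ennreal (F x powr (1 - t) * G y powr t) \<le> H ((1 - t) * x + t * y)"
    and a: "(\<integral>\<^sup>+x. ennreal (F x) \<partial>lborel) = ennreal a" "0 \<le> a"
    and b: "(\<integral>\<^sup>+x. ennreal (G x) \<partial>lborel) = ennreal b" "0 \<le> b"
  shows "ennreal (a powr (1 - t) * b powr t) \<le> (\<integral>\<^sup>+x. H x \<partial>lborel)"
proof (cases "a = 0 \<or> b = 0")
  case False
  then have ab: "a > 0" "b > 0" using a b by auto
  have sup: "\<exists>S>0. (\<forall>x. K x \<le> S) \<and> (\<forall>\<tau><S. \<exists>x. \<tau> < K x)"
    if K: "\<And>x. 0 \<le> K x" "\<And>x. K x \<le> M" and c: "(\<integral>\<^sup>+x. ennreal (K x) \<partial>lborel) = ennreal c" "0 < c"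
    for K :: "real \<Rightarrow> real" and c
  proof -
    have bd: "bdd_above (range K)" using K by (auto intro!: bdd_aboveI[of _ M])
    have "\<exists>x. K x \<noteq> 0"
    proof (rule ccontr)
      assume "\<nexists>x. K x \<noteq> 0"
      then have "(\<integral>\<^sup>+x. ennreal (K x) \<partial>lborel) = 0" by simp
      with c show False by simp
    qed
    then obtain x where "K x > 0" using K by (metis order_le_less)
    then have "0 < (SUP x. K x)" using cSUP_upper[OF UNIV_I bd, of x] by simp
    moreover have "\<forall>x. K x \<le> (SUP x. K x)" using cSUP_upper[OF UNIV_I bd] by simp
    moreover have "\<forall>\<tau><(SUP x. K x). \<exists>x. \<tau> < K x" using less_cSUP_iff[OF _ bd] by simp
    ultimately show ?thesis by blast
  qed
  obtain S where S: "S > 0" "\<And>x. F x \<le> S" "\<And>\<tau>. \<tau> < S \<Longrightarrow> \<exists>x. \<tau> < F x"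
    using sup[OF F a(1) ab(1)] by auto
  obtain T where T: "T > 0" "\<And>x. G x \<le> T" "\<And>\<tau>. \<tau> < T \<Longrightarrow> \<exists>x. \<tau> < G x"
    using sup[OF G b(1) ab(2)] by auto
  define c where "c = S powr (1 - t) * T powr t"
  have c: "c > 0" using S T by (simp add: c_def)
  have "ennreal (1 - t) * (\<integral>\<^sup>+x. ennreal (F x / S) \<partial>lborel) + ennreal t * (\<integral>\<^sup>+x. ennreal (G x / T) \<partial>lborel)
      \<le> (\<integral>\<^sup>+x. ennreal (1 / c) * H x \<partial>lborel)"
  proof (rule integral_superlevel_superadditive)
    show "ennreal (F x / S) \<le> 1" "ennreal (G x / T) \<le> 1" for x
      using S T F(1)[of x] G(1)[of x] by (auto simp: ennreal_le_1)
    show "\<exists>x. ennreal \<tau> < ennreal (F x / S)" if "0 \<le> \<tau>" "\<tau> < 1" for \<tau>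
      using S(3)[of "\<tau> * S"] S(1) that F by (auto simp: ennreal_less_iff field_simps)
    show "\<exists>x. ennreal \<tau> < ennreal (G x / T)" if "0 \<le> \<tau>" "\<tau> < 1" for \<tau>
      using T(3)[of "\<tau> * T"] T(1) that G by (auto simp: ennreal_less_iff field_simps)
    show "min (ennreal (F x / S)) (ennreal (G y / T)) \<le> ennreal (1 / c) * H ((1 - t) * x + t * y)"
      if "0 < ennreal (F x / S)" "0 < ennreal (G y / T)" for x y
    proof -
      have pos: "F x > 0" "G y > 0" using that S T F G by (auto simp: zero_less_divide_iff)
      define u v where "u = F x / S" and "v = G y / T"
      have uv: "u > 0" "v > 0" using pos S T by (auto simp: u_def v_def)
      have "min u v = min u v powr (1 - t) * min u v powr t"
        using uv by (simp flip: powr_add)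
      also have "\<dots> \<le> u powr (1 - t) * v powr t"
        using uv t by (intro mult_mono powr_mono2) auto
      also have "\<dots> = (1 / c) * (F x powr (1 - t) * G y powr t)"
        using pos S T by (simp add: u_def v_def c_def powr_divide)
      finally have "ennreal (min u v) \<le> ennreal (1 / c) * ennreal (F x powr (1 - t) * G y powr t)"
        using c by (subst ennreal_mult[symmetric]) (auto intro: ennreal_leI)
      also have "\<dots> \<le> ennreal (1 / c) * H ((1 - t) * x + t * y)"
        using H[OF pos] by (intro mult_left_mono) auto
      finally show ?thesis using uv by (simp add: u_def[symmetric] v_def[symmetric] min_def ennreal_le_iff2 split: if_splits)
    qed
  qed (use t in auto)
  also have "(\<integral>\<^sup>+x. ennreal (F x / S) \<partial>lborel) = ennreal (a / S)"
    using S a F by (simp add: divide_ennreal[symmetric] nn_integral_divide)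
  also have "(\<integral>\<^sup>+x. ennreal (G x / T) \<partial>lborel) = ennreal (b / T)"
    using T b G by (simp add: divide_ennreal[symmetric] nn_integral_divide)
  also have "ennreal (1 - t) * ennreal (a / S) + ennreal t * ennreal (b / T) = ennreal ((1 - t) * (a / S) + t * (b / T))"
    using t S T a b by (simp flip: ennreal_mult ennreal_plus)
  also have "(\<integral>\<^sup>+x. ennreal (1 / c) * H x \<partial>lborel) = ennreal (1 / c) * (\<integral>\<^sup>+x. H x \<partial>lborel)"
    by (rule nn_integral_cmult) simp
  finally have le: "ennreal ((1 - t) * (a / S) + t * (b / T)) \<le> ennreal (1 / c) * (\<integral>\<^sup>+x. H x \<partial>lborel)" .
  have "(a / S) powr (1 - t) * (b / T) powr t \<le> (1 - t) * (a / S) + t * (b / T)"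
    using t ab S T by (intro Youngs_inequality_0) auto
  moreover have "(a / S) powr (1 - t) * (b / T) powr t = (1 / c) * (a powr (1 - t) * b powr t)"
    using ab S T by (simp add: c_def powr_divide)
  ultimately have "ennreal ((1 / c) * (a powr (1 - t) * b powr t)) \<le> ennreal (1 / c) * (\<integral>\<^sup>+x. H x \<partial>lborel)"
    using le by (metis ennreal_leI order_trans)
  then have "ennreal c * ennreal ((1 / c) * (a powr (1 - t) * b powr t)) \<le> ennreal c * (ennreal (1 / c) * (\<integral>\<^sup>+x. H x \<partial>lborel))"
    by (intro mult_left_mono) simp_all
  moreover have "ennreal c * ennreal (1 / c) = 1" using c by (simp flip: ennreal_mult)
  moreover have "ennreal c * ennreal ((1 / c) * (a powr (1 - t) * b powr t)) = ennreal (a powr (1 - t) * b powr t)"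
    using c by (simp flip: ennreal_mult)
  ultimately show ?thesis by (simp only: mult.assoc[symmetric] mult_1)
qed auto

text \<open>
  By the induction hypothesis the volumes of the sections by the new coordinate satisfy the
  hypothesis of the one-dimensional Prekopa-Leindler inequality. The coordinates are indexed by a
  set, because the dimension changes during the induction.
\<close>

lemma brunn_minkowski_PiM:
  fixes A B C :: "('i \<Rightarrow> real) set"
  assumes "finite I" and t: "0 < t" "t < 1"
    and "A \<in> sets (PiM I (\<lambda>_. lborel))" "B \<in> sets (PiM I (\<lambda>_. lborel))" "C \<in> sets (PiM I (\<lambda>_. lborel))"
    and "A \<subseteq> PiE I (\<lambda>_. {-R..R})" "B \<subseteq> PiE I (\<lambda>_. {-R..R})"
    and "\<And>x y. x \<in> A \<Longrightarrow> y \<in> B \<Longrightarrow> (\<lambda>i\<in>I. (1 - t) * x i + t * y i) \<in> C"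
  shows "ennreal (measure (PiM I (\<lambda>_. lborel)) A powr (1 - t) * measure (PiM I (\<lambda>_. lborel)) B powr t)
      \<le> emeasure (PiM I (\<lambda>_. lborel)) C"
  using assms(1,4-)
proof (induction I arbitrary: A B C rule: finite_induct)
  case empty
  show ?case
  proof (cases "A = {} \<or> B = {}")
    case False
    then obtain x y where "x \<in> A" "y \<in> B" by auto
    then have "(\<lambda>i\<in>{}. (1 - t) * x i + t * y i) \<in> C" by (intro empty)
    then have "{\<lambda>_. undefined} \<subseteq> C" by (simp add: restrict_def)
    then have C: "C = {\<lambda>_. undefined}" using sets.sets_into_space[OF empty(3)] by (auto simp: space_PiM)
    have "A = {\<lambda>_. undefined}" "B = {\<lambda>_. undefined}" using False empty by auto
    then show ?thesis using C by (simp add: PiM_empty measure_def)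
  qed auto
next
  case (insert i I)
  interpret product_sigma_finite "\<lambda>_::'i. lborel :: real measure" by standard
  let ?P = "\<lambda>J. PiM J (\<lambda>_::'i. lborel :: real measure)"
  define sec where "sec D s = {x \<in> space (?P I). x(i := s) \<in> D}" for D :: "('i \<Rightarrow> real) set" and s
  have upd: "(\<lambda>x. x(i := s)) \<in> ?P I \<rightarrow>\<^sub>M ?P (insert i I)" for s
    by (intro measurable_fun_upd[where J=I]) auto
  have secm: "sec D s \<in> sets (?P I)" if "D \<in> sets (?P (insert i I))" for D s
    using measurable_sets[OF upd that, of s] by (simp add: sec_def vimage_def Int_def conj_commute)
  have ind: "(\<integral>\<^sup>+ x. indicator D (x(i := s)) \<partial>?P I) = emeasure (?P I) (sec D s)" 
    if "D \<in> sets (?P (insert i I))" for D s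
  proof -
    have "(\<integral>\<^sup>+ x. indicator D (x(i := s)) \<partial>?P I) = (\<integral>\<^sup>+ x. indicator (sec D s) x \<partial>?P I)"
      by (intro nn_integral_cong) (auto simp: sec_def indicator_def)
    then show ?thesis using secm[OF that] by simp
  qed
  have em: "emeasure (?P (insert i I)) D = (\<integral>\<^sup>+ s. emeasure (?P I) (sec D s) \<partial>lborel)"
    if D: "D \<in> sets (?P (insert i I))" for D
  proof -
    have "emeasure (?P (insert i I)) D = (\<integral>\<^sup>+ x. indicator D x \<partial>?P (insert i I))" using D by simp
    also have "\<dots> = (\<integral>\<^sup>+ s. (\<integral>\<^sup>+ x. indicator D (x(i := s)) \<partial>?P I) \<partial>lborel)"
      using insert.hyps D by (intro product_nn_integral_insert_rev) auto
    finally show ?thesis using ind[OF D] by simp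
  qed
  have mm: "(\<lambda>s. emeasure (?P I) (sec D s)) \<in> borel_measurable lborel"
    if D: "D \<in> sets (?P (insert i I))" for D
  proof -
    interpret PI: sigma_finite_measure "?P I" by (rule sigma_finite) fact
    have "(\<lambda>(s, x). x(i := s)) \<in> lborel \<Otimes>\<^sub>M ?P I \<rightarrow>\<^sub>M ?P (insert i I)"
      unfolding case_prod_beta
      by (rule measurable_fun_upd[where J=I]) auto
    then have "(\<lambda>(s, x). indicator D (x(i := s)) :: ennreal) \<in> borel_measurable (lborel \<Otimes>\<^sub>M ?P I)"
      using D by (auto simp: case_prod_beta intro!: measurable_compose[OF _ borel_measurable_indicator])
    from PI.borel_measurable_nn_integral_fst[OF this] show ?thesis
      using ind[OF D] by simp
  qed
  define M where "M = max 1 (\<Prod>i\<in>I. if - R \<le> R then R - - R else 0)"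
  have boxm: "PiE I (\<lambda>_. {-R..R}) \<in> sets (?P I)" using insert.hyps by (intro sets_PiM_I_finite) auto
  have boxe: "emeasure (?P I) (PiE I (\<lambda>_. {-R..R})) \<le> ennreal M"
    using insert.hyps
    by (subst emeasure_PiM) (auto simp del: prod_constant simp add: M_def emeasure_lborel_Icc_eq prod_ennreal intro!: ennreal_leI)
  have sec_sub: "sec D s \<subseteq> PiE I (\<lambda>_. {-R..R})" if "D \<subseteq> PiE (insert i I) (\<lambda>_. {-R..R})" for D s
  proof
    fix x assume x: "x \<in> sec D s"
    then have "x(i := s) \<in> PiE (insert i I) (\<lambda>_. {-R..R})" "x \<in> extensional I" using that by (auto simp: sec_def space_PiM PiE_def)
    then have "x j \<in> {-R..R}" if "j \<in> I" for j
      using that insert.hyps PiE_mem[of "x(i := s)" "insert i I" "\<lambda>_. {-R..R}" j] by (cases "j = i") auto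
    then show "x \<in> PiE I (\<lambda>_. {-R..R})" using \<open>x \<in> extensional I\<close> by (auto simp: PiE_def)
  qed
  have secM: "emeasure (?P I) (sec D s) \<le> ennreal M" if "D \<subseteq> PiE (insert i I) (\<lambda>_. {-R..R})" for D s
    using emeasure_mono[OF sec_sub[OF that] boxm, of s] boxe by (rule order_trans)
  define F where "F D s = measure (?P I) (sec D s)" for D s
  have F: "ennreal (F D s) = emeasure (?P I) (sec D s)" "F D s \<le> M" "0 \<le> F D s"
    if "D \<subseteq> PiE (insert i I) (\<lambda>_. {-R..R})" for D s
  proof -
    show eq: "ennreal (F D s) = emeasure (?P I) (sec D s)" unfolding F_def
      using secM[OF that, of s] by (intro emeasure_eq_ennreal_measure[symmetric]) (auto simp: top_unique)
    show "0 \<le> F D s" by (simp add: F_def)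
    show "F D s \<le> M" using secM[OF that, of s] unfolding eq[symmetric] by (subst (asm) ennreal_le_iff) (auto simp: M_def)
  qed
  have boxf: "emeasure (?P (insert i I)) (PiE (insert i I) (\<lambda>_. {-R..R})) < \<top>"
    using insert.hyps by (subst emeasure_PiM) (auto simp del: prod_constant simp add: emeasure_lborel_Icc_eq prod_ennreal)
  have boxm': "PiE (insert i I) (\<lambda>_. {-R..R}) \<in> sets (?P (insert i I))" using insert.hyps by (intro sets_PiM_I_finite) auto
  have I: "(\<integral>\<^sup>+ s. ennreal (F D s) \<partial>lborel) = ennreal (measure (?P (insert i I)) D)"
    if D: "D \<in> sets (?P (insert i I))" and s: "D \<subseteq> PiE (insert i I) (\<lambda>_. {-R..R})" for D
  proof -
    have "emeasure (?P (insert i I)) D < \<top>" using emeasure_mono[OF s boxm'] boxf by (rule le_less_trans)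
    then have "emeasure (?P (insert i I)) D = ennreal (measure (?P (insert i I)) D)"
      by (intro emeasure_eq_ennreal_measure) auto
    then show ?thesis using F(1)[OF s] em[OF D] by simp
  qed
  have Fm: "F D \<in> borel_measurable borel" if D: "D \<in> sets (?P (insert i I))" for D
    using mm[OF D] unfolding F_def measure_def by measurable
  note prems = insert.prems
  have "ennreal (measure (?P (insert i I)) A powr (1 - t) * measure (?P (insert i I)) B powr t)
     \<le> (\<integral>\<^sup>+ s. emeasure (?P I) (sec C s) \<partial>lborel)"
  proof (rule prekopa_leindler_real[OF Fm[OF prems(1)] Fm[OF prems(2)] _ t _ _ _ _ _ I[OF prems(1,4)] _ I[OF prems(2,5)]])
    show "(\<lambda>s. emeasure (?P I) (sec C s)) \<in> borel_measurable borel" using mm[OF prems(3)] by simp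
    show "0 \<le> F A x" "F A x \<le> M" "0 \<le> F B x" "F B x \<le> M" for x using F prems by auto
    show "ennreal (F A x powr (1 - t) * F B y powr t) \<le> emeasure (?P I) (sec C ((1 - t) * x + t * y))" for x y
      unfolding F_def
    proof (rule insert.IH)
      show "sec A x \<in> sets (?P I)" "sec B y \<in> sets (?P I)" "sec C ((1 - t) * x + t * y) \<in> sets (?P I)"
        using secm prems by auto
      show "sec A x \<subseteq> PiE I (\<lambda>_. {-R..R})" "sec B y \<subseteq> PiE I (\<lambda>_. {-R..R})" using sec_sub prems by auto
      fix u v assume uv: "u \<in> sec A x" "v \<in> sec B y"
      then have "(\<lambda>j\<in>insert i I. (1 - t) * (u(i := x)) j + t * (v(i := y)) j) \<in> C"
        using prems(6)[of "u(i := x)" "v(i := y)"] by (simp only: sec_def mem_Collect_eq)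
      also have "(\<lambda>j\<in>insert i I. (1 - t) * (u(i := x)) j + t * (v(i := y)) j)
         = (\<lambda>j\<in>I. (1 - t) * u j + t * v j)(i := (1 - t) * x + t * y)"
        using insert.hyps by (auto simp: restrict_def fun_eq_iff)
      finally show "(\<lambda>j\<in>I. (1 - t) * u j + t * v j) \<in> sec C ((1 - t) * x + t * y)"
        by (simp add: sec_def space_PiM fun_upd_def)
    qed
  qed auto
  then show ?case using em[OF prems(3)] by simp
qed

theorem brunn_minkowski:
  fixes A B C :: "'a::euclidean_space set"
  assumes t: "0 < t" "t < 1"
    and "A \<in> sets borel" "B \<in> sets borel" "C \<in> sets borel" and bnd: "bounded A" "bounded B"
    and sum: "\<And>x y. x \<in> A \<Longrightarrow> y \<in> B \<Longrightarrow> (1 - t) *\<^sub>R x + t *\<^sub>R y \<in> C"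
  shows "ennreal (measure lborel A powr (1 - t) * measure lborel B powr t) \<le> emeasure lborel C"
proof -
  let ?P = "PiM (Basis :: 'a set) (\<lambda>_. lborel :: real measure)"
  let ?T = "\<lambda>f. \<Sum>b\<in>Basis. f b *\<^sub>R b :: 'a"
  let ?V = "\<lambda>D. ?T -` D \<inter> space ?P"
  have T: "?T \<in> ?P \<rightarrow>\<^sub>M borel" by measurable
  have Tb: "?T f \<bullet> b = f b" if "b \<in> Basis" for f b
    using that by (simp add: inner_sum_left_Basis)
  have em: "emeasure lborel D = emeasure ?P (?V D)" if "D \<in> sets borel" for D
    using that by (subst lborel_eq, subst emeasure_distr) (auto)
  obtain R where R: "\<And>x. x \<in> A \<union> B \<Longrightarrow> norm x \<le> R"
    using bnd by (metis bounded_Un bounded_iff)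
  have box: "?V D \<subseteq> PiE Basis (\<lambda>_. {-R..R})" if "D \<subseteq> A \<union> B" for D
  proof
    fix f assume f: "f \<in> ?V D"
    then have "norm (?T f) \<le> R" using R that by auto
    then have *: "\<bar>f b\<bar> \<le> R" if "b \<in> Basis" for b using Basis_le_norm[OF that, of "?T f"] Tb[OF that] by simp
    then have "f b \<in> {-R..R}" if "b \<in> Basis" for b using *[OF that] by (auto simp: abs_le_iff)
    then show "f \<in> PiE Basis (\<lambda>_. {-R..R})" using f by (auto simp: space_PiM PiE_def)
  qed
  have "ennreal (measure ?P (?V A) powr (1 - t) * measure ?P (?V B) powr t) \<le> emeasure ?P (?V C)"
  proof (rule brunn_minkowski_PiM[OF finite_Basis t, where R=R])
    show "?V A \<in> sets ?P" "?V B \<in> sets ?P" "?V C \<in> sets ?P"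
      using measurable_sets[OF T] assms by auto
    show "?V A \<subseteq> PiE Basis (\<lambda>_. {-R..R})" "?V B \<subseteq> PiE Basis (\<lambda>_. {-R..R})" using box by auto
    fix x y assume xy: "x \<in> ?V A" "y \<in> ?V B"
    have "?T (\<lambda>i\<in>Basis. (1 - t) * x i + t * y i) = (1 - t) *\<^sub>R ?T x + t *\<^sub>R ?T y"
      by (simp add: scaleR_sum_right sum.distrib scaleR_add_left)
    also have "\<dots> \<in> C" using xy by (intro sum) auto
    finally show "(\<lambda>i\<in>Basis. (1 - t) * x i + t * y i) \<in> ?V C" by (simp add: space_PiM)
  qed
  then show ?thesis using em assms by (simp add: measure_def)
qed

section \<open>Hausdorff measure as an outer measure\<close>

lemma diameter_leI:
  assumes "0 \<le> c" "\<And>x y. x \<in> S \<Longrightarrow> y \<in> S \<Longrightarrow> dist x y \<le> c"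
  shows "diameter S \<le> c"
  using assms by (auto simp: diameter_def intro!: cSUP_least)

lemma le_ennreal_mult_INF:
  fixes x :: ennreal
  assumes c: "0 < c" and le: "\<And>i. i \<in> I \<Longrightarrow> x \<le> ennreal c * f i"
  shows "x \<le> ennreal c * (INF i\<in>I. f i)"
proof -
  have one: "ennreal (1 / c) * (ennreal c * y) = y" "ennreal c * (ennreal (1 / c) * y) = y" for y
    using c by (simp_all add: mult.assoc[symmetric] ennreal_mult[symmetric])
  have "ennreal (1 / c) * x \<le> (INF i\<in>I. f i)"
  proof (rule INF_greatest)
    fix i assume "i \<in> I"
    from mult_left_mono[OF le[OF this], of "ennreal (1 / c)"] show "ennreal (1 / c) * x \<le> f i" by (simp add: one)
  qed
  from mult_left_mono[OF this, of "ennreal c"] show ?thesis by (simp add: one)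
qed

lemma premeasure_leI:
  assumes "A \<subseteq> (\<Union>i. E i)" "\<And>i. bounded (E i)" "\<And>i. diameter (E i) \<le> \<delta>"
  shows "hausdorff_premeasure m \<delta> A \<le> (\<Sum>i. hausdorff_weight m (E i))"
  unfolding hausdorff_premeasure_def using assms by (intro INF_lower) auto

lemma premeasure_mono: "A \<subseteq> B \<Longrightarrow> hausdorff_premeasure m \<delta> A \<le> hausdorff_premeasure m \<delta> B"
  unfolding hausdorff_premeasure_def by (intro INF_superset_mono) auto

lemma premeasure_le_measure: "0 < \<delta> \<Longrightarrow> hausdorff_premeasure m \<delta> A \<le> hausdorff_measure m A"
  unfolding hausdorff_measure_def by (intro SUP_upper) auto

lemma hausdorff_measure_mono: "A \<subseteq> B \<Longrightarrow> hausdorff_measure m A \<le> hausdorff_measure m B"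
  unfolding hausdorff_measure_def by (intro SUP_mono) (auto intro: premeasure_mono)

lemma premeasure_le_weight:
  assumes "bounded E" "diameter E \<le> \<delta>" "0 \<le> \<delta>"
  shows "hausdorff_premeasure m \<delta> E \<le> hausdorff_weight m E"
proof -
  let ?E = "\<lambda>i::nat. if i = 0 then E else {}"
  have "hausdorff_premeasure m \<delta> E \<le> (\<Sum>i. hausdorff_weight m (?E i))"
    using assms by (intro premeasure_leI) auto
  also have "\<dots> = (\<Sum>i\<in>{0}. hausdorff_weight m (?E i))"
    by (intro suminf_finite) (auto simp: hausdorff_weight_def)
  finally show ?thesis by simp
qed

lemma premeasure_empty: "0 \<le> \<delta> \<Longrightarrow> hausdorff_premeasure m \<delta> {} = 0"
  using premeasure_le_weight[of "{}" \<delta> m] by (auto simp: hausdorff_weight_def)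

lemma hausdorff_measure_empty: "hausdorff_measure m {} = 0"
  unfolding hausdorff_measure_def by (auto intro!: SUP_eq_const[THEN trans] simp: premeasure_empty)

lemma premeasure_UN_le:
  "hausdorff_premeasure m \<delta> (\<Union>n::nat. A n) \<le> (\<Sum>n. hausdorff_premeasure m \<delta> (A n))"
proof (rule ennreal_le_epsilon)
  fix e :: real assume e: "e > 0" and fin: "(\<Sum>n. hausdorff_premeasure m \<delta> (A n)) < \<top>"
  have "\<exists>E. A n \<subseteq> (\<Union>i. E i) \<and> (\<forall>i::nat. bounded (E i) \<and> diameter (E i) \<le> \<delta>) \<and>
      (\<Sum>i. hausdorff_weight m (E i)) \<le> hausdorff_premeasure m \<delta> (A n) + ennreal (e * (1/2) ^ Suc n)" for n
  proof -
    have "hausdorff_premeasure m \<delta> (A n) \<noteq> \<infinity>"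
      using fin ennreal_suminf_lessD[OF fin] by (auto simp: less_top)
    from INF_approx_ennreal[OF _ hausdorff_premeasure_def this, of "e * (1/2) ^ Suc n"] e
    show ?thesis by (auto intro: less_imp_le)
  qed
  then obtain E where E: "\<And>n. A n \<subseteq> (\<Union>i. E n i)" "\<And>n i. bounded (E n i)" "\<And>n i::nat. diameter (E n i) \<le> \<delta>"
     "\<And>n. (\<Sum>i. hausdorff_weight m (E n i)) \<le> hausdorff_premeasure m \<delta> (A n) + ennreal (e * (1/2) ^ Suc n)"
    by metis
  have "(\<Union>n. A n) \<subseteq> (\<Union>i. case_prod E (prod_decode i))"
  proof
    fix x assume "x \<in> (\<Union>n. A n)"
    then obtain n i where "x \<in> E n i" using E(1) by blast
    then have "x \<in> case_prod E (prod_decode (prod_encode (n, i)))" by simp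
    then show "x \<in> (\<Union>i. case_prod E (prod_decode i))" by (rule UN_I[OF UNIV_I])
  qed
  then have "hausdorff_premeasure m \<delta> (\<Union>n. A n) \<le> (\<Sum>i. hausdorff_weight m (case_prod E (prod_decode i)))"
    using E by (intro premeasure_leI) (auto split: prod.split)
  also have "\<dots> = (\<Sum>n. \<Sum>i. hausdorff_weight m (E n i))"
    using suminf_ennreal_2dimen[of "\<lambda>n. \<Sum>i. hausdorff_weight m (E n i)" "\<lambda>p. hausdorff_weight m (case_prod E p)"] by simp
  also have "\<dots> \<le> (\<Sum>n. hausdorff_premeasure m \<delta> (A n) + ennreal (e * (1/2) ^ Suc n))"
    by (intro suminf_le E) auto
  also have "\<dots> = (\<Sum>n. hausdorff_premeasure m \<delta> (A n)) + (\<Sum>n. ennreal (e * (1/2) ^ Suc n))"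
    by (intro suminf_add[symmetric]) auto
  also have "(\<Sum>n. ennreal (e * (1/2) ^ Suc n)) = ennreal e"
    using e by (intro suminf_ennreal_eq) (auto intro!: sums_mult[OF power_half_series, of e, simplified])
  finally show "hausdorff_premeasure m \<delta> (\<Union>n. A n) \<le> (\<Sum>n. hausdorff_premeasure m \<delta> (A n)) + ennreal e" .
qed

lemma hausdorff_measure_UN_le:
  "hausdorff_measure m (\<Union>n::nat. A n) \<le> (\<Sum>n. hausdorff_measure m (A n))"
  unfolding hausdorff_measure_def[of _ "\<Union>n::nat. A n"]
proof (intro SUP_least)
  fix \<delta> :: real assume "\<delta> \<in> {0<..}"
  then show "hausdorff_premeasure m \<delta> (\<Union>n. A n) \<le> (\<Sum>n. hausdorff_measure m (A n))"
    by (intro order_trans[OF premeasure_UN_le] suminf_le premeasure_le_measure) auto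
qed

lemma premeasure_finite_UN_le:
  assumes "finite I" "0 \<le> \<delta>"
  shows "hausdorff_premeasure m \<delta> (\<Union>i\<in>I. A i) \<le> (\<Sum>i\<in>I. hausdorff_premeasure m \<delta> (A i))"
  using assms(1)
proof (induction I rule: finite_induct)
  case (insert i I)
  let ?B = "\<lambda>n::nat. if n = 0 then A i else if n = 1 then (\<Union>i\<in>I. A i) else {}"
  have "(\<Union>i\<in>insert i I. A i) = (\<Union>n. ?B n)" by (auto split: if_splits)
  then have "hausdorff_premeasure m \<delta> (\<Union>i\<in>insert i I. A i) \<le> (\<Sum>n. hausdorff_premeasure m \<delta> (?B n))"
    using premeasure_UN_le[of m \<delta> ?B] by simp
  also have "\<dots> = (\<Sum>n\<in>{0,1}. hausdorff_premeasure m \<delta> (?B n))"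
    using assms by (intro suminf_finite) (auto simp: premeasure_empty)
  also have "\<dots> = hausdorff_premeasure m \<delta> (A i) + hausdorff_premeasure m \<delta> (\<Union>i\<in>I. A i)" by simp
  also have "\<dots> \<le> (\<Sum>i\<in>insert i I. hausdorff_premeasure m \<delta> (A i))"
    using insert by (simp add: add_left_mono)
  finally show ?case .
qed (simp add: premeasure_empty assms)

lemma premeasure_lipschitz:
  assumes L: "0 < L" and f: "\<And>x y. x \<in> A \<Longrightarrow> y \<in> A \<Longrightarrow> dist (f x) (f y) \<le> L * dist x y"
  shows "hausdorff_premeasure m (L * \<delta>) (f ` A) \<le> ennreal (L ^ m) * hausdorff_premeasure m \<delta> A"
proof -
  have "hausdorff_premeasure m (L * \<delta>) (f ` A) \<le> ennreal (L ^ m) * (\<Sum>i. hausdorff_weight m (E i))"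
    if E: "A \<subseteq> (\<Union>i. E i)" "\<And>i::nat. bounded (E i) \<and> diameter (E i) \<le> \<delta>" for E
  proof -
    have E0: "0 \<le> diameter (E i)" for i using E diameter_ge_0 by blast
    have d: "dist x y \<le> L * diameter (E i)" if "x \<in> f ` (E i \<inter> A)" "y \<in> f ` (E i \<inter> A)" for x y i
    proof -
      obtain u v where uv: "u \<in> E i \<inter> A" "v \<in> E i \<inter> A" "x = f u" "y = f v" using \<open>x \<in> _\<close> \<open>y \<in> _\<close> by auto
      have "dist x y \<le> L * dist u v" using uv f by auto
      also have "\<dots> \<le> L * diameter (E i)" using uv E L by (intro mult_left_mono diameter_bounded_bound) auto
      finally show ?thesis .
    qed
    have b: "bounded (f ` (E i \<inter> A))" for i
      unfolding bounded_two_points using d by blast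
    have dm: "diameter (f ` (E i \<inter> A)) \<le> L * diameter (E i)" for i
      using E0 L d by (intro diameter_leI) auto
    have "hausdorff_premeasure m (L * \<delta>) (f ` A) \<le> (\<Sum>i. hausdorff_weight m (f ` (E i \<inter> A)))"
      using E b dm L order_trans[OF dm mult_left_mono] by (intro premeasure_leI) (auto, blast)
    also have "\<dots> \<le> (\<Sum>i. ennreal (L ^ m) * hausdorff_weight m (E i))"
    proof (intro suminf_le)
      fix i
      show "hausdorff_weight m (f ` (E i \<inter> A)) \<le> ennreal (L ^ m) * hausdorff_weight m (E i)"
      proof (cases "E i \<inter> A = {}")
        case False
        have "unit_ball_vol (real m) / 2 ^ m * diameter (f ` (E i \<inter> A)) ^ m
           \<le> unit_ball_vol (real m) / 2 ^ m * (L * diameter (E i)) ^ m"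
          using diameter_ge_0[OF b] dm by (intro mult_left_mono power_mono) auto
        also have "\<dots> = L ^ m * (unit_ball_vol (real m) / 2 ^ m * diameter (E i) ^ m)"
          by (simp add: power_mult_distrib)
        finally show ?thesis using False L E0[of i]
          by (auto simp: hausdorff_weight_def ennreal_mult[symmetric] intro!: ennreal_leI)
      qed (simp add: hausdorff_weight_def)
    qed auto
    finally show ?thesis by simp
  qed
  then show ?thesis
    unfolding hausdorff_premeasure_def[of m \<delta>] using L by (intro le_ennreal_mult_INF) auto
qed

lemma hausdorff_measure_lipschitz:
  assumes L: "0 < L" and f: "\<And>x y. x \<in> A \<Longrightarrow> y \<in> A \<Longrightarrow> dist (f x) (f y) \<le> L * dist x y"
  shows "hausdorff_measure m (f ` A) \<le> ennreal (L ^ m) * hausdorff_measure m A"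
  unfolding hausdorff_measure_def[of _ "f ` A"]
proof (intro SUP_least)
  fix \<delta> :: real assume d: "\<delta> \<in> {0<..}"
  have "hausdorff_premeasure m (L * (\<delta> / L)) (f ` A) \<le> ennreal (L ^ m) * hausdorff_premeasure m (\<delta> / L) A"
    by (intro premeasure_lipschitz assms)
  also have "\<dots> \<le> ennreal (L ^ m) * hausdorff_measure m A"
    using d L by (intro mult_left_mono premeasure_le_measure) auto
  finally show "hausdorff_premeasure m \<delta> (f ` A) \<le> ennreal (L ^ m) * hausdorff_measure m A" using L by simp
qed

lemma hausdorff_measure_affine_le:
  fixes t :: "'a::real_normed_vector"
  assumes "0 < c"
  shows "hausdorff_measure m ((\<lambda>x. t + c *\<^sub>R x) ` A) \<le> ennreal (c ^ m) * hausdorff_measure m A"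
  using assms by (intro hausdorff_measure_lipschitz) (auto simp: dist_norm simp flip: scaleR_diff_right)

lemma premeasure_translate_le:
  fixes t :: "'a::real_normed_vector"
  shows "hausdorff_premeasure m \<delta> ((\<lambda>x. t + x) ` A) \<le> hausdorff_premeasure m \<delta> A"
  using premeasure_lipschitz[of 1 A "\<lambda>x. t + x" m \<delta>] by simp

lemma hausdorff_measure_countable_UN_le:
  assumes "countable I"
  shows "hausdorff_measure m (\<Union>i\<in>I. A i) \<le> (\<integral>\<^sup>+i. hausdorff_measure m (A i) \<partial>count_space I)"
proof -
  define X where "X n = (if n \<in> to_nat_on I ` I then A (from_nat_into I n) else {})" for n
  have "(\<Union>i\<in>I. A i) \<subseteq> (\<Union>n. X n)"
  proof
    fix x assume "x \<in> (\<Union>i\<in>I. A i)"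
    then obtain i where "i \<in> I" "x \<in> A i" by auto
    then have "x \<in> X (to_nat_on I i)" using assms by (auto simp: X_def)
    then show "x \<in> (\<Union>n. X n)" by blast
  qed
  then have "hausdorff_measure m (\<Union>i\<in>I. A i) \<le> hausdorff_measure m (\<Union>n. X n)"
    by (rule hausdorff_measure_mono)
  also have "\<dots> \<le> (\<Sum>n. hausdorff_measure m (X n))" by (rule hausdorff_measure_UN_le)
  also have "\<dots> = (\<integral>\<^sup>+n. hausdorff_measure m (X n) \<partial>count_space UNIV)"
    by (simp add: nn_integral_count_space_nat)
  also have "\<dots> = (\<integral>\<^sup>+n. hausdorff_measure m (A (from_nat_into I n)) * indicator (to_nat_on I ` I) n \<partial>count_space UNIV)"
    by (intro nn_integral_cong) (auto simp: X_def hausdorff_measure_empty)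
  also have "\<dots> = (\<integral>\<^sup>+n. hausdorff_measure m (A (from_nat_into I n)) \<partial>count_space (to_nat_on I ` I))"
    by (simp add: nn_integral_count_space_indicator)
  also have "\<dots> = (\<integral>\<^sup>+i. hausdorff_measure m (A (from_nat_into I (to_nat_on I i))) \<partial>count_space I)"
    using assms by (intro nn_integral_bij_count_space[symmetric] inj_on_imp_bij_betw inj_on_to_nat_on)
  also have "\<dots> = (\<integral>\<^sup>+i. hausdorff_measure m (A i) \<partial>count_space I)"
    using assms by (intro nn_integral_cong) auto
  finally show ?thesis .
qed

section \<open>Hausdorff measure on a linear subspace\<close>

lemma linear_inj_bounded_below:
  fixes f :: "'e::euclidean_space \<Rightarrow> 'a::real_normed_vector"
  assumes f: "linear f" "inj f"
  obtains b where "b > 0" "\<And>x. b * norm x \<le> norm (f x)"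
proof -
  have cont: "continuous_on (sphere 0 1) (\<lambda>x. norm (f x))"
    using f(1) by (intro continuous_intros linear_continuous_on) (simp add: linear_conv_bounded_linear)
  obtain x0 where x0: "x0 \<in> sphere 0 1" "\<And>x. x \<in> sphere 0 1 \<Longrightarrow> norm (f x0) \<le> norm (f x)"
    using continuous_attains_inf[OF _ _ cont] by (auto simp: sphere_eq_empty)
  show thesis
  proof
    show "norm (f x0) > 0"
      using x0 f linear_injective_0[OF f(1)] by auto
    fix x :: 'e
    show "norm (f x0) * norm x \<le> norm (f x)"
    proof (cases "x = 0")
      case False
      then have "norm (f x0) \<le> norm (f ((1 / norm x) *\<^sub>R x))" by (intro x0) simp
      also have "\<dots> = norm (f x) / norm x" using linear_scale[OF f(1)] by simp
      finally show ?thesis using False by (simp add: field_simps)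
    qed simp
  qed
qed

text \<open>
  The Lebesgue measure of this set is the only quantity through which the norm of a subspace enters
  its Hausdorff measure.
\<close>

definition param_ball :: "('e::euclidean_space \<Rightarrow> 'a::real_normed_vector) \<Rightarrow> 'e set" where
  "param_ball \<phi> = {c. norm (\<phi> c) < 1}"

text \<open>
  A subspace is accessed through a linear parametrisation by a Euclidean space, where Lebesgue
  measure is available.
\<close>

locale linear_param =
  fixes \<phi> :: "'e::euclidean_space \<Rightarrow> 'a::real_normed_vector"
  assumes lin: "linear \<phi>" and inj: "inj \<phi>"
begin

lemma cont: "continuous_on S \<phi>"
  using lin by (intro linear_continuous_on) (simp add: linear_conv_bounded_linear)

lemmas hom = linear_add[OF lin] linear_diff[OF lin] linear_scale[OF lin] linear_0[OF lin] linear_neg[OF lin]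

lemma scaleR_mem_rangeD:
  assumes "u \<notin> range \<phi>" "a *\<^sub>R u \<in> range \<phi>"
  shows "a = 0"
proof (rule ccontr)
  assume a: "a \<noteq> 0"
  obtain c where "a *\<^sub>R u = \<phi> c" using assms(2) by auto
  then have "\<phi> ((1 / a) *\<^sub>R c) = (1 / a) *\<^sub>R (a *\<^sub>R u)" by (simp add: hom)
  also have "\<dots> = u" using a by simp
  finally show False using assms(1) by (metis rangeI)
qed

lemma bounded_vimage:
  assumes "\<And>x. x \<in> S \<Longrightarrow> norm (\<phi> x) \<le> r"
  shows "bounded S"
proof -
  obtain b where b: "b > 0" "\<And>x. b * norm x \<le> norm (\<phi> x)"
    using linear_inj_bounded_below[OF lin inj] by blast
  have "norm x \<le> r / b" if "x \<in> S" for x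
    using order_trans[OF b(2) assms[OF that]] b(1) by (simp add: field_simps)
  then show ?thesis by (auto simp: bounded_iff)
qed

lemma open_param_ball: "open (param_ball \<phi>)"
  unfolding param_ball_def by (intro open_Collect_less continuous_intros cont)

lemma param_ball_borel [measurable]: "param_ball \<phi> \<in> sets borel"
  using open_param_ball by auto

lemma bounded_param_ball: "bounded (param_ball \<phi>)"
  by (rule bounded_vimage[of _ 1]) (simp add: param_ball_def)

lemma scaled_param_ball: "0 < r \<Longrightarrow> (\<lambda>x. 0 + r *\<^sub>R x) ` param_ball \<phi> = {c. norm (\<phi> c) < r}"
  by (subst affine_image_eq_vimage) (auto simp: param_ball_def hom field_simps)

lemma emeasure_param_ball: "emeasure lborel (param_ball \<phi>) = ennreal (measure lborel (param_ball \<phi>))"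
  using emeasure_bounded_finite[OF bounded_param_ball] by (intro emeasure_eq_ennreal_measure) auto

lemma measure_param_ball_pos: "0 < measure lborel (param_ball \<phi>)"
proof -
  have "0 \<in> param_ball \<phi>" by (simp add: param_ball_def hom)
  then obtain e where e: "e > 0" "ball 0 e \<subseteq> param_ball \<phi>"
    using open_param_ball by (meson open_contains_ball)
  have "ennreal (measure lborel (ball (0::'e) e)) \<le> emeasure lborel (param_ball \<phi>)"
    using e emeasure_bounded_finite[OF bounded_ball, of "0::'e" e]
    by (subst emeasure_eq_ennreal_measure[symmetric]) (auto intro!: emeasure_mono)
  then have "measure lborel (ball (0::'e) e) \<le> measure lborel (param_ball \<phi>)"
    by (simp add: emeasure_param_ball)
  with content_ball_pos[OF e(1), of "0::'e"] show ?thesis by linarith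
qed

text \<open>
  The difference body \<open>(D - D) / 2\<close> lies in the ball of radius \<open>d / 2\<close> and has at least the volume of
  \<open>D\<close> by the Brunn-Minkowski inequality for \<open>D\<close> and \<open>- D\<close>. The ball is open, so the argument is
  made for all radii above \<open>d / 2\<close>.
\<close>

lemma isodiametric:
  assumes D: "closed D" and d: "0 \<le> d" "\<And>x y. x \<in> D \<Longrightarrow> y \<in> D \<Longrightarrow> norm (\<phi> x - \<phi> y) \<le> d"
  shows "emeasure lborel D \<le> ennreal (measure lborel (param_ball \<phi>) * (d / 2) ^ DIM('e))"
proof (cases "D = {}")
  case False
  then obtain x0 where x0: "x0 \<in> D" by auto
  have bD: "bounded D"
  proof (rule bounded_vimage)
    show "norm (\<phi> x) \<le> d + norm (\<phi> x0)" if "x \<in> D" for x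
      using d(2)[OF that x0] norm_triangle_ineq2[of "\<phi> x" "\<phi> x0"] by linarith
  qed
  let ?D' = "(\<lambda>x. 0 + (-1) *\<^sub>R x) ` D"
  have Db: "D \<in> sets borel" using D by auto
  have D': "?D' \<in> sets borel" "emeasure lborel ?D' = emeasure lborel D" "bounded ?D'"
    using affine_image_borel[of "-1" D 0] emeasure_affine_image[of "-1" D 0] Db bD by (auto simp: bounded_uminus)
  have fin: "emeasure lborel D = ennreal (measure lborel D)"
    using emeasure_bounded_finite[OF bD] by (intro emeasure_eq_ennreal_measure) auto
  have main: "measure lborel D \<le> measure lborel (param_ball \<phi>) * (r / 2) ^ DIM('e)" if r: "d < r" for r
  proof -
    let ?C = "{c. norm (\<phi> c) < r / 2}"
    have C: "?C = (\<lambda>x. 0 + (r/2) *\<^sub>R x) ` param_ball \<phi>" using r d by (subst scaled_param_ball) auto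
    have "ennreal (measure lborel D powr (1 - 1/2) * measure lborel ?D' powr (1/2)) \<le> emeasure lborel ?C"
    proof (rule brunn_minkowski)
      show "?C \<in> sets borel" unfolding C using r d by (intro affine_image_borel) auto
      fix x y assume xy: "x \<in> D" "y \<in> ?D'"
      then obtain z where z: "z \<in> D" "y = - z" by auto
      have "norm (\<phi> ((1 - 1/2) *\<^sub>R x + (1/2) *\<^sub>R y)) = norm ((1/2) *\<^sub>R (\<phi> x - \<phi> z))"
        by (simp add: z hom algebra_simps)
      also have "\<dots> < r / 2" using d(2)[OF xy(1) z(1)] r by simp
      finally show "(1 - 1/2) *\<^sub>R x + (1/2) *\<^sub>R y \<in> ?C" by simp
    qed (use Db D' bD in auto)
    also have "measure lborel ?D' = measure lborel D" using D'(2) by (simp add: measure_def)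
    also have "measure lborel D powr (1 - 1/2) * measure lborel D powr (1/2) = measure lborel D"
      by (simp flip: powr_add)
    also have "emeasure lborel ?C = ennreal (\<bar>r / 2\<bar> ^ DIM('e)) * emeasure lborel (param_ball \<phi>)"
      unfolding C using r d by (intro emeasure_affine_image) auto
    also have "\<dots> = ennreal (measure lborel (param_ball \<phi>) * (r / 2) ^ DIM('e))"
      using r d by (simp add: emeasure_param_ball ennreal_mult mult.commute)
    finally show ?thesis using r d by (subst (asm) ennreal_le_iff) auto
  qed
  have "((\<lambda>r. measure lborel (param_ball \<phi>) * (r / 2) ^ DIM('e)) \<longlongrightarrow> measure lborel (param_ball \<phi>) * (d / 2) ^ DIM('e)) (at_right d)"
    by (intro tendsto_intros) simp
  moreover have "\<forall>\<^sub>F r in at_right d. measure lborel D \<le> measure lborel (param_ball \<phi>) * (r / 2) ^ DIM('e)"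
    by (rule eventually_mono[OF eventually_at_right_less main])
  ultimately have "measure lborel D \<le> measure lborel (param_ball \<phi>) * (d / 2) ^ DIM('e)"
    by (intro tendsto_lowerbound) auto
  then show ?thesis unfolding fin by (rule ennreal_leI)
qed simp

abbreviation "\<kappa> \<equiv> measure lborel (param_ball \<phi>)"

text \<open>
  The isodiametric inequality is applied to every member of a cover, after passing to closures,
  which changes no diameter.
\<close>

lemma hausdorff_lower:
  "ennreal (unit_ball_vol (real DIM('e))) * emeasure lborel A \<le> ennreal \<kappa> * hausdorff_measure DIM('e) (\<phi> ` A)"
proof -
  have "ennreal (unit_ball_vol (real DIM('e))) * emeasure lborel A \<le> ennreal \<kappa> * (\<Sum>i. hausdorff_weight DIM('e) (E i))"
    if E: "\<phi> ` A \<subseteq> (\<Union>i. E i)" "\<And>i::nat. bounded (E i)" for E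
  proof -
    define D where "D i = closure (\<phi> -` E i)" for i
    have AD: "A \<subseteq> (\<Union>i. D i)"
    proof
      fix x assume "x \<in> A"
      then obtain i where "x \<in> \<phi> -` E i" using E(1) by auto
      then show "x \<in> (\<Union>i. D i)" using closure_subset[of "\<phi> -` E i"] by (auto simp: D_def)
    qed
    have dD: "norm (\<phi> x - \<phi> y) \<le> diameter (E i)" if "x \<in> D i" "y \<in> D i" for x y i
    proof -
      have cl: "closed {x. norm (\<phi> x - \<phi> y) \<le> c}" for y c by (intro closed_Collect_le continuous_intros cont)
      have 1: "norm (\<phi> x - \<phi> y) \<le> diameter (E i)" if x: "x \<in> D i" and y: "y \<in> \<phi> -` E i" for x y
      proof -
        have "\<phi> -` E i \<subseteq> {x. norm (\<phi> x - \<phi> y) \<le> diameter (E i)}"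
          using y E(2) diameter_bounded_bound[of "E i"] by (auto simp: dist_norm)
        from closure_minimal[OF this cl] x show ?thesis by (auto simp: D_def)
      qed
      have "\<phi> -` E i \<subseteq> {y. norm (\<phi> y - \<phi> x) \<le> diameter (E i)}"
        using 1[OF \<open>x \<in> D i\<close>] by (subst norm_minus_commute) auto
      from closure_minimal[OF this cl] \<open>y \<in> D i\<close> have "norm (\<phi> y - \<phi> x) \<le> diameter (E i)" by (auto simp: D_def)
      then show ?thesis by (subst norm_minus_commute)
    qed
    have D0: "0 \<le> diameter (E i)" for i using E by (simp add: diameter_ge_0)
    have "ennreal (unit_ball_vol (real DIM('e))) * emeasure lborel A \<le> ennreal (unit_ball_vol (real DIM('e))) * emeasure lborel (\<Union>i. D i)"
      using AD by (intro mult_left_mono emeasure_mono) (auto simp: D_def)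
    also have "\<dots> \<le> ennreal (unit_ball_vol (real DIM('e))) * (\<Sum>i. emeasure lborel (D i))"
      by (intro mult_left_mono emeasure_subadditive_countably) (auto simp: D_def)
    also have "\<dots> = (\<Sum>i. ennreal (unit_ball_vol (real DIM('e))) * emeasure lborel (D i))" by simp
    also have "\<dots> \<le> (\<Sum>i. ennreal \<kappa> * hausdorff_weight DIM('e) (E i))"
    proof (intro suminf_le)
      fix i
      show "ennreal (unit_ball_vol (real DIM('e))) * emeasure lborel (D i) \<le> ennreal \<kappa> * hausdorff_weight DIM('e) (E i)"
      proof (cases "E i = {}")
        case False
        have "ennreal (unit_ball_vol (real DIM('e))) * emeasure lborel (D i) \<le> ennreal (unit_ball_vol (real DIM('e))) * ennreal (\<kappa> * (diameter (E i) / 2) ^ DIM('e))"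
          using dD D0 by (intro mult_left_mono isodiametric) (auto simp: D_def)
        also have "\<dots> = ennreal \<kappa> * hausdorff_weight DIM('e) (E i)"
          using False D0[of i] by (simp add: hausdorff_weight_def power_divide ac_simps flip: ennreal_mult)
        finally show ?thesis .
      qed (simp add: D_def)
    qed auto
    finally show ?thesis by simp
  qed
  then have "ennreal (unit_ball_vol (real DIM('e))) * emeasure lborel A \<le> ennreal \<kappa> * hausdorff_premeasure DIM('e) 1 (\<phi> ` A)"
    unfolding hausdorff_premeasure_def using measure_param_ball_pos by (intro le_ennreal_mult_INF) auto
  also have "\<dots> \<le> ennreal \<kappa> * hausdorff_measure DIM('e) (\<phi> ` A)"
    by (intro mult_left_mono premeasure_le_measure) auto
  finally show ?thesis .
qed

end

context linear_param
begin

text \<open>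
  The cube consists of \<open>N ^ DIM('e)\<close> translates of a cube with side \<open>1 / N\<close>, so that an estimate
  of small cubes controls the premeasure at every scale.
\<close>

lemma premeasure_subdivide:
  assumes N: "0 < N" and \<delta>: "0 \<le> \<delta>"
  shows "hausdorff_premeasure m \<delta> (\<phi> ` cbox 0 One)
    \<le> of_nat (N ^ DIM('e)) * hausdorff_premeasure m \<delta> (\<phi> ` ((\<lambda>x. 0 + (1 / real N) *\<^sub>R x) ` cbox 0 One))"
proof -
  let ?Q = "(\<lambda>x. 0 + (1 / real N) *\<^sub>R x) ` cbox 0 One :: 'e set"
  let ?I = "PiE (Basis :: 'e set) (\<lambda>_. {..<N})"
  let ?v = "\<lambda>k. \<Sum>b\<in>Basis. (real (k b) / real N) *\<^sub>R b :: 'e"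
  have sub: "\<phi> ` cbox 0 One \<subseteq> (\<Union>k\<in>?I. (\<lambda>x. \<phi> (?v k) + x) ` (\<phi> ` ?Q))"
  proof
    fix y assume "y \<in> \<phi> ` cbox 0 One"
    then obtain x where x: "x \<in> cbox 0 (One :: 'e)" "y = \<phi> x" by auto
    define k where "k = (\<lambda>b\<in>Basis. min (N - 1) (nat \<lfloor>real N * (x \<bullet> b)\<rfloor>))"
    have k: "k \<in> ?I" using N by (auto simp: k_def)
    have bd: "0 \<le> real N * (x \<bullet> b) - real (k b) \<and> real N * (x \<bullet> b) - real (k b) \<le> 1" if b: "b \<in> Basis" for b
    proof -
      have xb: "0 \<le> x \<bullet> b" "x \<bullet> b \<le> 1" using x b by (auto simp: mem_box)
      then have "0 \<le> real N * (x \<bullet> b)" "real N * (x \<bullet> b) \<le> real N" using N by (auto simp: mult_left_le)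
      moreover have "real (N - 1) = real N - 1" using N by simp
      moreover have "real (nat \<lfloor>real N * (x \<bullet> b)\<rfloor>) = of_int \<lfloor>real N * (x \<bullet> b)\<rfloor>" using \<open>0 \<le> real N * (x \<bullet> b)\<close> by simp
      moreover have "real (k b) = min (real (N - 1)) (real (nat \<lfloor>real N * (x \<bullet> b)\<rfloor>))" using b by (simp add: k_def)
      ultimately show ?thesis by linarith
    qed
    define z where "z = (\<Sum>b\<in>Basis. (real N * (x \<bullet> b) - real (k b)) *\<^sub>R b)"
    have z: "z \<in> cbox 0 One" using bd by (auto simp: mem_box z_def)
    have "x = ?v k + (1 / real N) *\<^sub>R z"
    proof (rule euclidean_eqI)
      fix b :: 'e assume b: "b \<in> Basis"
      then have "(?v k + (1 / real N) *\<^sub>R z) \<bullet> b = real (k b) / real N + (1 / real N) * (real N * (x \<bullet> b) - real (k b))"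
        by (simp add: z_def inner_left_distrib)
      also have "\<dots> = x \<bullet> b" using N by (simp add: field_simps)
      finally show "x \<bullet> b = (?v k + (1 / real N) *\<^sub>R z) \<bullet> b" ..
    qed
    then have "y = \<phi> (?v k) + \<phi> (0 + (1 / real N) *\<^sub>R z)" using x by (simp add: hom)
    then show "y \<in> (\<Union>k\<in>?I. (\<lambda>x. \<phi> (?v k) + x) ` (\<phi> ` ?Q))" using k z by blast
  qed
  have fI: "finite ?I" by (intro finite_PiE) auto
  have "hausdorff_premeasure m \<delta> (\<phi> ` cbox 0 One)
      \<le> hausdorff_premeasure m \<delta> (\<Union>k\<in>?I. (\<lambda>x. \<phi> (?v k) + x) ` (\<phi> ` ?Q))"
    by (rule premeasure_mono[OF sub])
  also have "\<dots> \<le> (\<Sum>k\<in>?I. hausdorff_premeasure m \<delta> ((\<lambda>x. \<phi> (?v k) + x) ` (\<phi> ` ?Q)))"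
    by (rule premeasure_finite_UN_le[OF fI \<delta>])
  also have "\<dots> \<le> (\<Sum>k\<in>?I. hausdorff_premeasure m \<delta> (\<phi> ` ?Q))"
    by (intro sum_mono premeasure_translate_le)
  also have "\<dots> = of_nat (N ^ DIM('e)) * hausdorff_premeasure m \<delta> (\<phi> ` ?Q)"
    by (simp add: card_PiE)
  finally show ?thesis .
qed

lemma image_affine: "\<phi> ` ((\<lambda>x. t + c *\<^sub>R x) ` A) = (\<lambda>x. \<phi> t + c *\<^sub>R x) ` (\<phi> ` A)"
  by (auto simp: image_image hom)

lemma hausdorff_cube_finite: "hausdorff_measure DIM('e) (\<phi> ` cbox 0 One) < \<top>"
proof -
  let ?Q = "cbox 0 One :: 'e set"
  have bQ: "bounded (\<phi> ` ?Q)"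
    by (intro compact_imp_bounded compact_continuous_image cont compact_cbox)
  define d where "d = diameter (\<phi> ` ?Q)"
  have d0: "0 \<le> d" unfolding d_def using bQ by (rule diameter_ge_0)
  define c where "c = unit_ball_vol (real DIM('e)) / 2 ^ DIM('e) * d ^ DIM('e)"
  have "hausdorff_premeasure DIM('e) \<delta> (\<phi> ` ?Q) \<le> ennreal c" if \<delta>: "\<delta> > 0" for \<delta>
  proof -
    obtain N :: nat where N: "N > 0" "d / real N \<le> \<delta>"
    proof -
      obtain n :: nat where "d / \<delta> < real n" using reals_Archimedean2 by blast
      moreover from this have "0 < real n" using d0 \<delta> by (meson divide_nonneg_pos le_less_trans)
      ultimately show ?thesis using that[of n] \<delta> by (simp add: field_simps)
    qed
    let ?S = "\<phi> ` ((\<lambda>x. 0 + (1 / real N) *\<^sub>R x) ` ?Q)"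
    have dist: "dist x y \<le> d / real N" if "x \<in> ?S" "y \<in> ?S" for x y
    proof -
      have S: "?S = (\<lambda>x. (1 / real N) *\<^sub>R x) ` (\<phi> ` ?Q)" by (subst image_affine) (simp only: hom(4) add_0_left)
      obtain u where u: "u \<in> \<phi> ` ?Q" "x = (1 / real N) *\<^sub>R u" using \<open>x \<in> ?S\<close> unfolding S by (rule imageE)
      obtain v where v: "v \<in> \<phi> ` ?Q" "y = (1 / real N) *\<^sub>R v" using \<open>y \<in> ?S\<close> unfolding S by (rule imageE)
      note uv = u(1) v(1) u(2) v(2)
      have "dist x y = dist u v / real N" using N by (simp add: uv dist_norm flip: scaleR_diff_right)
      then show ?thesis using diameter_bounded_bound[OF bQ uv(1,2)] N by (simp add: d_def divide_right_mono)
    qed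
    have bS: "bounded ?S" unfolding bounded_two_points using dist by blast
    have dS: "diameter ?S \<le> d / real N" using dist d0 by (intro diameter_leI) auto
    have "hausdorff_weight DIM('e) ?S \<le> ennreal (c / real N ^ DIM('e))"
    proof -
      have "diameter ?S ^ DIM('e) \<le> (d / real N) ^ DIM('e)"
        using dS diameter_ge_0[OF bS] by (intro power_mono) auto
      then have "unit_ball_vol (real DIM('e)) / 2 ^ DIM('e) * diameter ?S ^ DIM('e)
          \<le> unit_ball_vol (real DIM('e)) / 2 ^ DIM('e) * (d / real N) ^ DIM('e)"
        by (intro mult_left_mono) auto
      also have "\<dots> = c / real N ^ DIM('e)" by (simp add: c_def power_divide)
      finally show ?thesis unfolding hausdorff_weight_def by (auto intro!: ennreal_leI)
    qed
    moreover have "hausdorff_premeasure DIM('e) \<delta> ?S \<le> hausdorff_weight DIM('e) ?S"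
      using bS dS N \<delta> by (intro premeasure_le_weight) auto
    ultimately have "of_nat (N ^ DIM('e)) * hausdorff_premeasure DIM('e) \<delta> ?S \<le> of_nat (N ^ DIM('e)) * ennreal (c / real N ^ DIM('e))"
      by (intro mult_left_mono) auto
    also have "\<dots> = ennreal c" using N d0 by (simp add: ennreal_of_nat_eq_real_of_nat c_def flip: ennreal_mult)
    finally show ?thesis using premeasure_subdivide[OF N(1), of \<delta> "DIM('e)"] \<delta> by auto
  qed
  then have "hausdorff_measure DIM('e) (\<phi> ` ?Q) \<le> ennreal c" unfolding hausdorff_measure_def by (intro SUP_least) auto
  then show ?thesis by (rule le_less_trans) simp
qed

lemma hausdorff_cube_le:
  assumes s: "0 \<le> s" "\<And>i. i \<in> Basis \<Longrightarrow> v \<bullet> i - u \<bullet> i = s"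
  shows "hausdorff_measure DIM('e) (\<phi> ` cbox u v)
     \<le> hausdorff_measure DIM('e) (\<phi> ` cbox 0 One) * emeasure lborel (cbox u v)"
proof (cases "s = 0")
  case False
  then have s': "s > 0" using s by simp
  have eq: "cbox u v = (\<lambda>x. u + s *\<^sub>R x) ` cbox 0 One"
    using s s' by (subst affine_image_eq_vimage) (auto simp: mem_box inner_diff_left field_simps)
  have "emeasure lborel (cbox u v) = ennreal (s ^ DIM('e))"
    unfolding eq using s' by (subst emeasure_affine_image) auto
  moreover have "hausdorff_measure DIM('e) (\<phi> ` cbox u v) \<le> ennreal (s ^ DIM('e)) * hausdorff_measure DIM('e) (\<phi> ` cbox 0 One)"
    unfolding eq image_affine by (rule hausdorff_measure_affine_le[OF s'])
  ultimately show ?thesis by (simp add: mult.commute)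
next
  case True
  have "u = v"
  proof (rule euclidean_eqI)
    fix i :: 'e assume "i \<in> Basis"
    from s(2)[OF this] True show "u \<bullet> i = v \<bullet> i" by linarith
  qed
  have "hausdorff_measure DIM('e) (\<phi> ` {u}) \<le> 0"
    unfolding hausdorff_measure_def
  proof (intro SUP_least)
    fix \<delta> :: real assume "\<delta> \<in> {0<..}"
    then have "hausdorff_premeasure DIM('e) \<delta> (\<phi> ` {u}) \<le> hausdorff_weight DIM('e) (\<phi> ` {u})"
      by (intro premeasure_le_weight) auto
    then show "hausdorff_premeasure DIM('e) \<delta> (\<phi> ` {u}) \<le> 0"
      by (simp add: hausdorff_weight_def zero_power[OF DIM_positive])
  qed
  then show ?thesis using \<open>u = v\<close> by simp
qed

text \<open>
  A bounded set is covered by dyadic cubes whose total volume is almost that of the set, and the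
  Hausdorff measure of a cube scales like its volume.
\<close>

lemma hausdorff_le_cube_bounded:
  assumes S: "S \<in> sets borel" "bounded S"
  shows "hausdorff_measure DIM('e) (\<phi> ` S) \<le> hausdorff_measure DIM('e) (\<phi> ` cbox 0 One) * emeasure lborel S"
proof -
  obtain h where h: "hausdorff_measure DIM('e) (\<phi> ` cbox 0 One) = ennreal h" "h \<ge> 0"
    using hausdorff_cube_finite by (cases "hausdorff_measure DIM('e) (\<phi> ` cbox 0 One)") auto
  obtain R where R: "R > 0" "S \<subseteq> cball 0 R" using S(2) bounded_pos by (auto simp: bounded_pos subset_eq)
  have Sc: "S \<subseteq> cbox (- R *\<^sub>R One) (R *\<^sub>R One)"
  proof
    fix x assume "x \<in> S"
    then have "norm x \<le> R" using R by auto
    then have "\<bar>x \<bullet> b\<bar> \<le> R" if "b \<in> Basis" for b using Basis_le_norm[OF that, of x] by simp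
    then have "- R \<le> x \<bullet> b \<and> x \<bullet> b \<le> R" if "b \<in> Basis" for b using that by (simp add: abs_le_iff minus_le_iff)
    then show "x \<in> cbox (- R *\<^sub>R One) (R *\<^sub>R One)" by (simp add: mem_box)
  qed
  have fS: "S \<in> lmeasurable" using S by (simp add: bounded_set_imp_lmeasurable)
  have Sm: "emeasure lborel S = ennreal (measure lebesgue S)"
  proof -
    have "emeasure lborel S = emeasure lebesgue S" using S by simp
    then show ?thesis using fS by (simp add: emeasure_eq_measure2)
  qed
  have "hausdorff_measure DIM('e) (\<phi> ` S) \<le> ennreal h * emeasure lborel S + ennreal e" if e: "e > 0" for e
  proof -
    obtain \<D> where D: "countable \<D>"
      "\<And>K. K \<in> \<D> \<Longrightarrow> K \<subseteq> cbox (- R *\<^sub>R One) (R *\<^sub>R One) \<and> K \<noteq> {} \<and> (\<exists>c d. K = cbox c d)"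
      "pairwise (\<lambda>A B. interior A \<inter> interior B = {}) \<D>"
      "\<And>u v. cbox u v \<in> \<D> \<Longrightarrow> \<exists>n. \<forall>i \<in> Basis. v \<bullet> i - u \<bullet> i = ((R *\<^sub>R One) \<bullet> i - (- R *\<^sub>R One) \<bullet> i)/2^n"
      "S \<subseteq> \<Union>\<D>" "\<Union>\<D> \<in> lmeasurable" "measure lebesgue (\<Union>\<D>) \<le> measure lebesgue S + e / (h + 1)"
      by (rule measurable_outer_intervals_bounded[OF fS Sc, of "e / (h + 1)"]) (use e h in auto)
    have Db: "K \<in> sets borel" if "K \<in> \<D>" for K using D(2)[OF that] by auto
    have "hausdorff_measure DIM('e) (\<phi> ` S) \<le> hausdorff_measure DIM('e) (\<Union>K\<in>\<D>. \<phi> ` K)"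
      using D(5) by (intro hausdorff_measure_mono) auto
    also have "\<dots> \<le> (\<integral>\<^sup>+K. hausdorff_measure DIM('e) (\<phi> ` K) \<partial>count_space \<D>)"
      by (rule hausdorff_measure_countable_UN_le[OF D(1)])
    also have "\<dots> \<le> (\<integral>\<^sup>+K. ennreal h * emeasure lborel (interior K) \<partial>count_space \<D>)"
    proof (intro nn_integral_mono)
      fix K assume "K \<in> space (count_space \<D>)"
      then have K: "K \<in> \<D>" by simp
      then obtain u v where uv: "K = cbox u v" using D(2) by blast
      obtain n where n: "\<And>i. i \<in> Basis \<Longrightarrow> v \<bullet> i - u \<bullet> i = 2 * R / 2 ^ n"
        using D(4)[of u v] K uv by auto
      have "hausdorff_measure DIM('e) (\<phi> ` K) \<le> ennreal h * emeasure lborel K"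
        unfolding uv h(1)[symmetric] using n R by (intro hausdorff_cube_le[of "2 * R / 2 ^ n"]) auto
      also have "emeasure lborel K = emeasure lborel (interior K)"
        unfolding uv interior_cbox using n R
        by (simp add: emeasure_lborel_cbox_eq emeasure_lborel_box_eq)
      finally show "hausdorff_measure DIM('e) (\<phi> ` K) \<le> ennreal h * emeasure lborel (interior K)" .
    qed
    also have "\<dots> = ennreal h * (\<integral>\<^sup>+K. emeasure lborel (interior K) \<partial>count_space \<D>)"
      by (intro nn_integral_cmult) simp
    also have "(\<integral>\<^sup>+K. emeasure lborel (interior K) \<partial>count_space \<D>) = emeasure lborel (\<Union>K\<in>\<D>. interior K)"
      using D(3) by (intro emeasure_UN_countable[symmetric] D(1)) (auto simp: disjoint_family_on_def pairwise_def)
    also have "\<dots> \<le> emeasure lborel (\<Union>\<D>)"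
      using Db D(1) interior_subset by (intro emeasure_mono) (auto intro!: sets.countable_Union)
    also have "emeasure lborel (\<Union>\<D>) = emeasure lebesgue (\<Union>\<D>)"
    proof -
      have "\<Union>\<D> \<in> sets lborel" using Db D(1) by (auto intro!: sets.countable_Union)
      then show ?thesis by (simp add: Un_commute)
    qed
    also have "\<dots> = ennreal (measure lebesgue (\<Union>\<D>))" using D(6) by (simp add: emeasure_eq_measure2)
    also have "ennreal h * \<dots> \<le> ennreal h * ennreal (measure lebesgue S + e / (h + 1))"
      by (intro mult_left_mono ennreal_leI D) auto
    also have "\<dots> = ennreal (h * measure lebesgue S + h * e / (h + 1))"
      using h e by (simp add: algebra_simps flip: ennreal_mult)
    also have "\<dots> \<le> ennreal (h * measure lebesgue S + e)"
      using h e by (intro ennreal_leI) (simp add: field_simps)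
    also have "\<dots> = ennreal h * emeasure lborel S + ennreal e"
      using h e by (simp add: Sm ennreal_mult)
    finally show ?thesis by (simp add: mult_left_mono)
  qed
  note main = this
  show ?thesis unfolding h by (rule ennreal_le_epsilon) (rule main)
qed

text \<open>
  Let \<open>h\<close> be the Hausdorff measure of the unit cube, \<open>\<omega>\<close> the volume of the Euclidean unit ball and \<open>n\<close>
  the dimension. Put into the cube a copy of the unit ball of the norm, of radius \<open>r\<close>. As a single
  covering set it costs \<open>\<omega> * r ^ n\<close>, and what is left of the cube costs at most
  \<open>h * (1 - r ^ n * \<kappa>)\<close>. After subdivision into cubes so small that the balls in them are admissible
  covering sets this gives \<open>h \<le> \<omega> * r ^ n + h * (1 - r ^ n * \<kappa>)\<close>, that is, \<open>h * \<kappa> \<le> \<omega>\<close>.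
\<close>

lemma hausdorff_cube_upper:
  "hausdorff_measure DIM('e) (\<phi> ` cbox 0 One) * ennreal \<kappa> \<le> ennreal (unit_ball_vol (real DIM('e)))"
proof -
  let ?Q = "cbox 0 One :: 'e set" and ?\<omega> = "unit_ball_vol (real DIM('e))" and ?n = "DIM('e)"
  let ?B = "param_ball \<phi>"
  obtain h where h: "hausdorff_measure DIM('e) (\<phi> ` ?Q) = ennreal h" "h \<ge> 0"
    using hausdorff_cube_finite by (cases "hausdorff_measure DIM('e) (\<phi> ` ?Q)") auto
  obtain R where R: "R > 0" "\<And>x. x \<in> ?B \<Longrightarrow> norm x \<le> R" using bounded_param_ball by (auto simp: bounded_pos)
  define r where "r = 1 / (2 * R)"
  have r: "r > 0" using R by (simp add: r_def)
  define K where "K = (\<lambda>x. (1/2) *\<^sub>R One + r *\<^sub>R x) ` ?B"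
  have Kb: "K \<in> sets borel" unfolding K_def using r by (intro affine_image_borel) auto
  have KQ: "K \<subseteq> ?Q"
  proof
    fix y assume "y \<in> K"
    then obtain x where x: "x \<in> ?B" "y = (1/2) *\<^sub>R One + r *\<^sub>R x" by (auto simp: K_def)
    have "\<bar>r * (x \<bullet> b)\<bar> \<le> 1/2" if "b \<in> Basis" for b
    proof -
      have "\<bar>r * (x \<bullet> b)\<bar> \<le> r * R" using r R(2)[OF x(1)] Basis_le_norm[OF that, of x] by (simp add: abs_mult)
      then show ?thesis using R by (simp add: r_def)
    qed
    then have "0 \<le> 1/2 + r * (x \<bullet> b) \<and> 1/2 + r * (x \<bullet> b) \<le> 1" if "b \<in> Basis" for b
      using that by (smt (verit, best) field_sum_of_halves)
    then show "y \<in> ?Q" by (simp add: x mem_box inner_left_distrib)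
  qed
  have Km: "emeasure lborel K = ennreal (r ^ ?n * \<kappa>)"
    unfolding K_def using r by (subst emeasure_affine_image) (auto simp: emeasure_param_ball ennreal_mult)
  have K1: "r ^ ?n * \<kappa> \<le> 1"
    using emeasure_mono[OF KQ, of lborel] Km r by simp
  have QK: "emeasure lborel (?Q - K) = ennreal (1 - r ^ ?n * \<kappa>)"
    using KQ Kb Km r by (subst emeasure_Diff) (auto simp: ennreal_minus[symmetric])
  have "hausdorff_premeasure ?n \<delta> (\<phi> ` ?Q) \<le> ennreal (?\<omega> * r ^ ?n + h * (1 - r ^ ?n * \<kappa>))" if \<delta>: "\<delta> > 0" for \<delta>
  proof -
    obtain N :: nat where N: "N > 0" "2 * r / real N \<le> \<delta>"
    proof -
      obtain n :: nat where "2 * r / \<delta> < real n" using reals_Archimedean2 by blast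
      moreover from this have "0 < real n" using r \<delta> by (meson divide_nonneg_pos le_less_trans mult_nonneg_nonneg less_imp_le zero_le_numeral)
      ultimately show ?thesis using that[of n] \<delta> by (simp add: field_simps)
    qed
    let ?s = "\<lambda>A. (\<lambda>x. 0 + (1 / real N) *\<^sub>R x) ` A :: 'e set"
    have split: "\<phi> ` ?s ?Q = (\<Union>i\<in>{True,False}. if i then \<phi> ` ?s K else \<phi> ` ?s (?Q - K))"
    proof -
      have "\<phi> ` ?s ?Q = \<phi> ` ?s K \<union> \<phi> ` ?s (?Q - K)"
        unfolding image_Un[symmetric] using KQ by (simp add: Un_absorb1)
      then show ?thesis by (simp add: Un_commute)
    qed
    have dist: "dist x y \<le> 2 * r / real N" if "x \<in> \<phi> ` ?s K" "y \<in> \<phi> ` ?s K" for x y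
    proof -
      have S: "\<phi> ` ?s K = (\<lambda>u. (1 / real N) *\<^sub>R \<phi> ((1/2) *\<^sub>R One + r *\<^sub>R u)) ` ?B"
        unfolding K_def image_image by (intro image_cong) (simp_all add: hom)
      obtain u where u: "x = (1 / real N) *\<^sub>R \<phi> ((1/2) *\<^sub>R One + r *\<^sub>R u)" "u \<in> ?B"
        using \<open>x \<in> \<phi> ` ?s K\<close> unfolding S by (rule imageE)
      obtain v where v: "y = (1 / real N) *\<^sub>R \<phi> ((1/2) *\<^sub>R One + r *\<^sub>R v)" "v \<in> ?B"
        using \<open>y \<in> \<phi> ` ?s K\<close> unfolding S by (rule imageE)
      note uv = u(2) v(2) u(1) v(1)
      have "x - y = (r / real N) *\<^sub>R (\<phi> u - \<phi> v)" by (simp add: uv hom algebra_simps)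
      then have "dist x y = (r / real N) * norm (\<phi> u - \<phi> v)" using r N by (simp add: dist_norm)
      also have "\<dots> \<le> (r / real N) * 2" using r uv norm_triangle_ineq4[of "\<phi> u" "\<phi> v"]
        by (intro mult_left_mono) (auto simp: param_ball_def)
      finally show ?thesis by (simp add: mult.commute)
    qed
    have bK: "bounded (\<phi> ` ?s K)" unfolding bounded_two_points using dist by blast
    have dK: "diameter (\<phi> ` ?s K) \<le> 2 * r / real N" using dist r by (intro diameter_leI) auto
    have wK: "hausdorff_weight ?n (\<phi> ` ?s K) \<le> ennreal (?\<omega> * r ^ ?n / real N ^ ?n)"
    proof -
      have "diameter (\<phi> ` ?s K) ^ ?n \<le> (2 * r / real N) ^ ?n"
        using dK diameter_ge_0[OF bK] by (intro power_mono) auto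
      then have "?\<omega> / 2 ^ ?n * diameter (\<phi> ` ?s K) ^ ?n \<le> ?\<omega> / 2 ^ ?n * (2 * r / real N) ^ ?n"
        by (intro mult_left_mono) auto
      also have "\<dots> = ?\<omega> * r ^ ?n / real N ^ ?n" by (simp add: power_divide power_mult_distrib)
      finally show ?thesis unfolding hausdorff_weight_def by (auto intro!: ennreal_leI)
    qed
    have "hausdorff_premeasure ?n \<delta> (\<phi> ` ?s ?Q) \<le> hausdorff_premeasure ?n \<delta> (\<phi> ` ?s K) + hausdorff_premeasure ?n \<delta> (\<phi> ` ?s (?Q - K))"
      using premeasure_finite_UN_le[of "{True,False}" \<delta> ?n "\<lambda>i. if i then \<phi> ` ?s K else \<phi> ` ?s (?Q - K)"] \<delta>
      unfolding split by simp
    also have "\<dots> \<le> ennreal (?\<omega> * r ^ ?n / real N ^ ?n) + ennreal (h * (1 - r ^ ?n * \<kappa>) / real N ^ ?n)"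
    proof (intro add_mono)
      show "hausdorff_premeasure ?n \<delta> (\<phi> ` ?s K) \<le> ennreal (?\<omega> * r ^ ?n / real N ^ ?n)"
        using bK dK N \<delta> by (intro order_trans[OF premeasure_le_weight wK]) auto
      have "hausdorff_premeasure ?n \<delta> (\<phi> ` ?s (?Q - K)) \<le> hausdorff_measure ?n (\<phi> ` ?s (?Q - K))"
        using \<delta> by (rule premeasure_le_measure)
      also have "\<dots> \<le> ennreal h * emeasure lborel (?s (?Q - K))"
        unfolding h(1)[symmetric]
      proof (rule hausdorff_le_cube_bounded)
        show "?s (?Q - K) \<in> sets borel" using N Kb by (intro affine_image_borel) auto
        have "bounded (?Q - K)" using bounded_subset[OF bounded_cbox] by blast
        then show "bounded (?s (?Q - K))" by (simp add: bounded_scaling)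
      qed
      also have "\<dots> = ennreal h * (ennreal ((1 / real N) ^ ?n) * ennreal (1 - r ^ ?n * \<kappa>))"
        using N Kb by (subst emeasure_affine_image) (auto simp: QK)
      also have "\<dots> = ennreal (h * (1 - r ^ ?n * \<kappa>) / real N ^ ?n)"
        using h K1 by (simp add: power_divide flip: ennreal_mult)
      finally show "hausdorff_premeasure ?n \<delta> (\<phi> ` ?s (?Q - K)) \<le> ennreal (h * (1 - r ^ ?n * \<kappa>) / real N ^ ?n)" .
    qed
    also have "\<dots> = ennreal ((?\<omega> * r ^ ?n + h * (1 - r ^ ?n * \<kappa>)) / real N ^ ?n)"
      using h K1 r by (simp add: add_divide_distrib flip: ennreal_plus)
    finally have "of_nat (N ^ ?n) * hausdorff_premeasure ?n \<delta> (\<phi> ` ?s ?Q)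
       \<le> of_nat (N ^ ?n) * ennreal ((?\<omega> * r ^ ?n + h * (1 - r ^ ?n * \<kappa>)) / real N ^ ?n)"
      by (intro mult_left_mono) auto
    also have "\<dots> = ennreal (?\<omega> * r ^ ?n + h * (1 - r ^ ?n * \<kappa>))"
      using N h K1 r by (simp add: ennreal_of_nat_eq_real_of_nat flip: ennreal_mult)
    finally show ?thesis using premeasure_subdivide[OF N(1), of \<delta> ?n] \<delta> by auto
  qed
  then have "ennreal h \<le> ennreal (?\<omega> * r ^ ?n + h * (1 - r ^ ?n * \<kappa>))"
    unfolding h(1)[symmetric] hausdorff_measure_def by (intro SUP_least) auto
  then have "h \<le> ?\<omega> * r ^ ?n + h * (1 - r ^ ?n * \<kappa>)"
    using h K1 r by (subst (asm) ennreal_le_iff) (auto intro!: add_nonneg_nonneg)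
  then have "(h * \<kappa>) * r ^ ?n \<le> ?\<omega> * r ^ ?n" by (simp add: algebra_simps)
  then have "h * \<kappa> \<le> ?\<omega>" using r by simp
  then show ?thesis using h by (simp add: ennreal_leI flip: ennreal_mult)
qed

text \<open>
  The left-hand side does not depend on the parametrisation of the subspace. In this way the
  formula also compares the Lebesgue measures in different linear coordinates.
\<close>

theorem hausdorff_measure_image:
  assumes A: "A \<in> sets borel"
  shows "hausdorff_measure DIM('e) (\<phi> ` A) = ennreal (unit_ball_vol (real DIM('e)) / \<kappa>) * emeasure lborel A"
proof (rule antisym)
  let ?\<omega> = "unit_ball_vol (real DIM('e))"
  let ?h = "hausdorff_measure DIM('e) (\<phi> ` cbox 0 One)"
  have k: "\<kappa> > 0" by (rule measure_param_ball_pos)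
  have inv: "ennreal (1 / \<kappa>) * ennreal \<kappa> = 1" using k by (simp flip: ennreal_mult)
  have \<omega>: "ennreal (?\<omega> / \<kappa>) = ennreal (1 / \<kappa>) * ennreal ?\<omega>" using k by (simp flip: ennreal_mult)
  have "?h = ennreal (1 / \<kappa>) * (?h * ennreal \<kappa>)" by (subst mult.left_commute) (simp only: inv mult_1_right)
  also have "\<dots> \<le> ennreal (?\<omega> / \<kappa>)" unfolding \<omega> by (intro mult_left_mono hausdorff_cube_upper) auto
  finally have h: "?h \<le> ennreal (?\<omega> / \<kappa>)" .
  define B where "B n = A \<inter> cball 0 (real n)" for n
  have Bb: "B n \<in> sets borel" for n using A by (auto simp: B_def)
  have "x \<in> (\<Union>n. B n)" if "x \<in> A" for x
    using that real_arch_simple[of "norm x"] by (auto simp: B_def)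
  then have AB: "A = (\<Union>n. disjointed B n)" unfolding UN_disjointed_eq by (auto simp: B_def)
  have dB: "disjointed B n \<in> sets borel" for n
    using Bb by (auto simp: disjointed_def)
  have bd: "bounded (disjointed B n)" for n
    using disjointed_subset[of B n] bounded_subset[OF bounded_cball[of 0 "real n"]] by (auto simp: B_def)
  have "hausdorff_measure DIM('e) (\<phi> ` A) \<le> (\<Sum>n. hausdorff_measure DIM('e) (\<phi> ` disjointed B n))"
    by (subst AB, subst image_UN) (rule hausdorff_measure_UN_le)
  also have "\<dots> \<le> (\<Sum>n. ?h * emeasure lborel (disjointed B n))"
    using dB bd by (intro suminf_le hausdorff_le_cube_bounded) auto
  also have "\<dots> = ?h * (\<Sum>n. emeasure lborel (disjointed B n))" by simp
  also have "(\<Sum>n. emeasure lborel (disjointed B n)) = emeasure lborel A"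
    using dB by (subst suminf_emeasure) (auto simp: disjoint_family_disjointed AB[symmetric])
  also have "?h * emeasure lborel A \<le> ennreal (?\<omega> / \<kappa>) * emeasure lborel A"
    by (intro mult_right_mono h) auto
  finally show "hausdorff_measure DIM('e) (\<phi> ` A) \<le> ennreal (?\<omega> / \<kappa>) * emeasure lborel A" .
  have "ennreal (?\<omega> / \<kappa>) * emeasure lborel A = ennreal (1 / \<kappa>) * (ennreal ?\<omega> * emeasure lborel A)"
    unfolding \<omega> by (simp add: mult.assoc)
  also have "\<dots> \<le> ennreal (1 / \<kappa>) * (ennreal \<kappa> * hausdorff_measure DIM('e) (\<phi> ` A))"
    by (intro mult_left_mono hausdorff_lower) auto
  also have "\<dots> = hausdorff_measure DIM('e) (\<phi> ` A)" using inv by (simp flip: mult.assoc)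
  finally show "ennreal (?\<omega> / \<kappa>) * emeasure lborel A \<le> hausdorff_measure DIM('e) (\<phi> ` A)" .
qed

end

section \<open>Supporting functionals that depend measurably on the point\<close>

definition sublinear :: "('a::real_vector \<Rightarrow> real) \<Rightarrow> bool" where
  "sublinear q \<longleftrightarrow> (\<forall>x y. q (x + y) \<le> q x + q y) \<and> (\<forall>c x. 0 < c \<longrightarrow> q (c *\<^sub>R x) = c * q x)"

lemma sublinearD:
  assumes "sublinear q"
  shows sublinear_add: "q (x + y) \<le> q x + q y" and sublinear_scale: "0 \<le> c \<Longrightarrow> q (c *\<^sub>R x) = c * q x"
    and sublinear_zero: "q 0 = 0" and sublinear_neg: "- q (- x) \<le> q x"
proof -
  show add: "q (x + y) \<le> q x + q y" for x y using assms by (simp add: sublinear_def)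
  have pos: "q (c *\<^sub>R x) = c * q x" if "0 < c" for c x using assms that by (simp add: sublinear_def)
  show zero: "q 0 = 0" using pos[of 2 0] by simp
  show "0 \<le> c \<Longrightarrow> q (c *\<^sub>R x) = c * q x" using pos zero by (cases "c = 0") auto
  show "- q (- x) \<le> q x" using add[of x "- x"] zero by simp
qed

text \<open>
  By homogeneity \<open>q (t *\<^sub>R x + y) - t * q x\<close> is the difference quotient of \<open>q\<close> at \<open>x\<close> in direction \<open>y\<close>
  with step \<open>1 / t\<close>. These quotients decrease to the one-sided directional derivative.
\<close>

definition dir_deriv :: "('a::real_vector \<Rightarrow> real) \<Rightarrow> 'a \<Rightarrow> 'a \<Rightarrow> real" where
  "dir_deriv q x y = (INF t\<in>{0..}. q (t *\<^sub>R x + y) - t * q x)"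

lemma dir_quotient:
  assumes q: "sublinear q" and t: "0 \<le> t"
  shows dir_quotient_ge: "- q (- y) \<le> q (t *\<^sub>R x + y) - t * q x"
    and dir_quotient_antimono: "t \<le> s \<Longrightarrow> q (s *\<^sub>R x + y) - s * q x \<le> q (t *\<^sub>R x + y) - t * q x"
proof -
  show "- q (- y) \<le> q (t *\<^sub>R x + y) - t * q x"
    using sublinear_add[OF q, of "t *\<^sub>R x + y" "- y"] sublinear_scale[OF q t, of x] by simp
  assume "t \<le> s"
  have "q (s *\<^sub>R x + y) = q ((t *\<^sub>R x + y) + (s - t) *\<^sub>R x)" by (simp add: algebra_simps)
  also have "\<dots> \<le> q (t *\<^sub>R x + y) + (s - t) * q x"
    using sublinear_add[OF q, of "t *\<^sub>R x + y" "(s - t) *\<^sub>R x"] sublinear_scale[OF q, of "s - t" x] \<open>t \<le> s\<close> by simp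
  finally show "q (s *\<^sub>R x + y) - s * q x \<le> q (t *\<^sub>R x + y) - t * q x" by (simp add: algebra_simps)
qed

lemma dir_deriv_le:
  assumes "sublinear q" "0 \<le> t"
  shows "dir_deriv q x y \<le> q (t *\<^sub>R x + y) - t * q x"
  unfolding dir_deriv_def
  using dir_quotient_ge[OF assms(1)] assms(2) by (intro cINF_lower bdd_belowI2[of _ "- q (- y)"]) auto

lemma dir_deriv_ge:
  assumes "\<And>t. 0 \<le> t \<Longrightarrow> c \<le> q (t *\<^sub>R x + y) - t * q x"
  shows "c \<le> dir_deriv q x y"
  unfolding dir_deriv_def using assms by (intro cINF_greatest) auto

lemma dir_deriv_LIMSEQ:
  assumes q: "sublinear q"
  shows "(\<lambda>n. q (real n *\<^sub>R x + y) - real n * q x) \<longlonglongrightarrow> dir_deriv q x y"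
proof (rule LIMSEQ_I)
  fix e :: real assume e: "e > 0"
  have "\<exists>t\<ge>0. q (t *\<^sub>R x + y) - t * q x < dir_deriv q x y + e"
  proof (rule ccontr)
    assume "\<not> ?thesis"
    then have "dir_deriv q x y + e \<le> dir_deriv q x y" by (intro dir_deriv_ge) (auto simp: not_less)
    with e show False by simp
  qed
  then obtain t where t: "t \<ge> 0" "q (t *\<^sub>R x + y) - t * q x < dir_deriv q x y + e" by auto
  obtain N :: nat where N: "t \<le> real N" using real_arch_simple by blast
  have "norm (q (real n *\<^sub>R x + y) - real n * q x - dir_deriv q x y) < e" if "n \<ge> N" for n
    using dir_quotient_antimono[OF q t(1), of "real n" x y] dir_deriv_le[OF q, of "real n" x y] t N that by auto
  then show "\<exists>N. \<forall>n\<ge>N. norm (q (real n *\<^sub>R x + y) - real n * q x - dir_deriv q x y) < e" by blast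
qed

lemma dir_deriv_le_self: "sublinear q \<Longrightarrow> dir_deriv q x y \<le> q y"
  using dir_deriv_le[of q 0 x y] by simp

lemma sublinear_dir_deriv:
  assumes q: "sublinear q"
  shows "sublinear (dir_deriv q x)"
  unfolding sublinear_def
proof (intro conjI allI impI)
  fix y z
  have "dir_deriv q x (y + z) - (q (t *\<^sub>R x + z) - t * q x) \<le> dir_deriv q x y" if t: "0 \<le> t" for t
  proof (rule dir_deriv_ge)
    fix s :: real assume s: "0 \<le> s"
    have "dir_deriv q x (y + z) \<le> q ((s + t) *\<^sub>R x + (y + z)) - (s + t) * q x"
      using s t by (intro dir_deriv_le q) auto
    also have "(s + t) *\<^sub>R x + (y + z) = (s *\<^sub>R x + y) + (t *\<^sub>R x + z)" by (simp add: algebra_simps)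
    also have "q \<dots> \<le> q (s *\<^sub>R x + y) + q (t *\<^sub>R x + z)" by (rule sublinear_add[OF q])
    finally show "dir_deriv q x (y + z) - (q (t *\<^sub>R x + z) - t * q x) \<le> q (s *\<^sub>R x + y) - s * q x"
      by (simp add: algebra_simps)
  qed
  then have "dir_deriv q x (y + z) - dir_deriv q x y \<le> dir_deriv q x z"
    by (intro dir_deriv_ge) (simp add: algebra_simps)
  then show "dir_deriv q x (y + z) \<le> dir_deriv q x y + dir_deriv q x z" by simp
next
  have le: "dir_deriv q x (c *\<^sub>R y) \<le> c * dir_deriv q x y" if c: "0 < c" for c y
  proof -
    have "dir_deriv q x (c *\<^sub>R y) / c \<le> dir_deriv q x y"
    proof (rule dir_deriv_ge)
      fix t :: real assume t: "0 \<le> t"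
      have "dir_deriv q x (c *\<^sub>R y) \<le> q ((c * t) *\<^sub>R x + c *\<^sub>R y) - (c * t) * q x"
        using c t by (intro dir_deriv_le q) auto
      also have "(c * t) *\<^sub>R x + c *\<^sub>R y = c *\<^sub>R (t *\<^sub>R x + y)" by (simp add: algebra_simps)
      also have "q \<dots> = c * q (t *\<^sub>R x + y)" using c by (intro sublinear_scale q) auto
      finally show "dir_deriv q x (c *\<^sub>R y) / c \<le> q (t *\<^sub>R x + y) - t * q x"
        using c by (simp add: field_simps)
    qed
    then show ?thesis using c by (simp add: field_simps)
  qed
  fix c :: real and y assume c: "0 < c"
  have "dir_deriv q x ((1 / c) *\<^sub>R (c *\<^sub>R y)) \<le> (1 / c) * dir_deriv q x (c *\<^sub>R y)"
    using c by (intro le) auto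
  then have "c * dir_deriv q x y \<le> dir_deriv q x (c *\<^sub>R y)" using c by (simp add: field_simps)
  with le[OF c, of y] show "dir_deriv q x (c *\<^sub>R y) = c * dir_deriv q x y" by simp
qed

lemma dir_deriv_neg_le:
  assumes q: "sublinear q"
  shows "dir_deriv q x (- x) \<le> - q x"
  using dir_deriv_le[OF q, of 1 x "- x"] sublinear_zero[OF q] by simp

text \<open>
  Passing from \<open>q\<close> to its directional derivative at \<open>y\<close> yields a smaller sublinear function that is
  linear along \<open>y\<close> and along all lines where \<open>q\<close> was linear. Along a spanning list this ends with a
  linear function.
\<close>

fun iter_deriv :: "('a::real_vector \<Rightarrow> real) \<Rightarrow> 'a list \<Rightarrow> 'a \<Rightarrow> real" where
  "iter_deriv q [] = q"
| "iter_deriv q (y # ys) = iter_deriv (dir_deriv q y) ys"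

lemma sublinear_iter_deriv: "sublinear q \<Longrightarrow> sublinear (iter_deriv q ys)"
  by (induction ys arbitrary: q) (auto intro: sublinear_dir_deriv)

lemma iter_deriv_le: "sublinear q \<Longrightarrow> iter_deriv q ys z \<le> q z"
  by (induction ys arbitrary: q) (auto intro: sublinear_dir_deriv dir_deriv_le_self order_trans)

lemma iter_deriv_neg_le:
  assumes "sublinear q" "y \<in> set ys"
  shows "iter_deriv q ys y + iter_deriv q ys (- y) \<le> 0"
  using assms
proof (induction ys arbitrary: q)
  case (Cons z ys)
  show ?case
  proof (cases "y = z")
    case True
    have "iter_deriv (dir_deriv q z) ys z + iter_deriv (dir_deriv q z) ys (- z) \<le> dir_deriv q z z + dir_deriv q z (- z)"
      using Cons by (intro add_mono iter_deriv_le sublinear_dir_deriv) auto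
    also have "\<dots> \<le> q z + (- q z)"
      using Cons by (intro add_mono dir_deriv_le_self dir_deriv_neg_le) auto
    finally show ?thesis using True by simp
  qed (use Cons sublinear_dir_deriv in auto)
qed simp

lemma linear_if_odd_on_spanning:
  assumes q: "sublinear q" and B: "span B = UNIV" "\<And>y. y \<in> B \<Longrightarrow> q y + q (- y) \<le> 0"
  shows "linear q"
proof -
  have odd: "q (- y) = - q y" for y
  proof -
    have "y \<in> span B" using B by simp
    then have "q y + q (- y) \<le> 0"
    proof (induction rule: span_induct_alt)
      case base
      show ?case using sublinear_zero[OF q] by simp
    next
      case (step c x y)
      have "q (c *\<^sub>R x) + q (- (c *\<^sub>R x)) \<le> 0"
      proof (cases "0 \<le> c")
        case True
        then have "q (c *\<^sub>R x) + q (- (c *\<^sub>R x)) = c * (q x + q (- x))"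
          using sublinear_scale[OF q True, of x] sublinear_scale[OF q True, of "- x"] by (simp add: algebra_simps)
        then show ?thesis using B(2)[OF step(1)] True by (simp add: mult_nonneg_nonpos)
      next
        case False
        then have "q (c *\<^sub>R x) + q (- (c *\<^sub>R x)) = (- c) * (q x + q (- x))"
          using sublinear_scale[OF q, of "- c" x] sublinear_scale[OF q, of "- c" "- x"] by (simp add: algebra_simps)
        then show ?thesis using B(2)[OF step(1)] False by (simp add: mult_nonpos_nonpos)
      qed
      then show ?case
        using sublinear_add[OF q, of "c *\<^sub>R x" y] sublinear_add[OF q, of "- (c *\<^sub>R x)" "- y"] step by simp
    qed
    then show ?thesis using sublinear_neg[OF q, of y] by simp
  qed
  show ?thesis
  proof (rule linearI)
    show "q (x + y) = q x + q y" for x y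
      using sublinear_add[OF q, of x y] sublinear_add[OF q, of "- x" "- y"] odd[of x] odd[of y] odd[of "x + y"] by simp
    show "q (c *\<^sub>R x) = c *\<^sub>R q x" for c x
      using sublinear_scale[OF q, of c x] sublinear_scale[OF q, of "- c" x] odd[of "c *\<^sub>R x"] by (cases "0 \<le> c") auto
  qed
qed

text \<open>
  An explicit Hahn-Banach functional: differentiating first at \<open>x\<close> forces the value \<open>q x\<close> at \<open>x\<close>.
  Unlike a choice of extensions, it depends measurably on \<open>x\<close>.
\<close>

definition support_functional :: "('a::real_vector \<Rightarrow> real) \<Rightarrow> 'a list \<Rightarrow> 'a \<Rightarrow> 'a \<Rightarrow> real" where
  "support_functional q ys x = iter_deriv (dir_deriv q x) ys"

lemma support_functional:
  assumes q: "sublinear q"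
  shows support_functional_le: "support_functional q ys x y \<le> q y"
    and support_functional_self: "support_functional q ys x x = q x"
    and linear_support_functional: "span (set ys) = UNIV \<Longrightarrow> linear (support_functional q ys x)"
proof -
  note d = sublinear_dir_deriv[OF q]
  show "support_functional q ys x y \<le> q y" for y unfolding support_functional_def
    using iter_deriv_le[OF d] dir_deriv_le_self[OF q] by (rule order_trans)
  then have "support_functional q ys x x \<le> q x" .
  moreover have "q x \<le> support_functional q ys x x"
  proof -
    have "support_functional q ys x (- x) \<le> - q x" unfolding support_functional_def
      using iter_deriv_le[OF d] dir_deriv_neg_le[OF q] by (rule order_trans)
    then show ?thesis
      using sublinear_neg[OF sublinear_iter_deriv[OF d], of x ys x] by (simp add: support_functional_def)
  qed
  ultimately show "support_functional q ys x x = q x" by simp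
  show "linear (support_functional q ys x)" if "span (set ys) = UNIV"
    unfolding support_functional_def using that
    by (intro linear_if_odd_on_spanning[of _ "set ys"] sublinear_iter_deriv d iter_deriv_neg_le)
qed

lemma measurable_iter_deriv:
  assumes "\<And>c. sublinear (Q c)" "\<And>y. (\<lambda>c. Q c y) \<in> borel_measurable M"
  shows "(\<lambda>c. iter_deriv (Q c) ys z) \<in> borel_measurable M"
  using assms
proof (induction ys arbitrary: Q)
  case (Cons y ys)
  have "(\<lambda>c. dir_deriv (Q c) y z) \<in> borel_measurable M" for z
    by (intro borel_measurable_LIMSEQ_real[OF dir_deriv_LIMSEQ[OF Cons.prems(1)]]
          borel_measurable_diff borel_measurable_times borel_measurable_const Cons.prems(2))
  then show ?case using Cons.IH[of "\<lambda>c. dir_deriv (Q c) y"] Cons.prems(1) by (simp add: sublinear_dir_deriv)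
qed simp

lemma measurable_support_functional:
  assumes q: "sublinear q" and m: "\<And>t y. (\<lambda>c. q (t *\<^sub>R g c + y)) \<in> borel_measurable M"
  shows "(\<lambda>c. support_functional q ys (g c) z) \<in> borel_measurable M"
  unfolding support_functional_def
proof (rule measurable_iter_deriv[OF sublinear_dir_deriv[OF q]])
  have "(\<lambda>c. q (g c)) \<in> borel_measurable M" using m[of 1 0] by simp
  note m0 = this
  show "(\<lambda>c. dir_deriv q (g c) y) \<in> borel_measurable M" for y
    by (intro borel_measurable_LIMSEQ_real[OF dir_deriv_LIMSEQ[OF q]]
          borel_measurable_diff borel_measurable_times borel_measurable_const m m0)
qed

section \<open>Busemann's theorem on hyperplane sections\<close>

text \<open>
  In the variable \<open>1 / s\<close> a harmonic mean becomes an arithmetic mean.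
\<close>

lemma nn_integral_reciprocal:
  fixes f :: "real \<Rightarrow> ennreal"
  assumes [measurable]: "f \<in> borel_measurable borel"
  shows "(\<integral>\<^sup>+x. f x * indicator {0<..} x \<partial>lborel)
    = (\<integral>\<^sup>+x. f (1 / x) * ennreal (1 / x\<^sup>2) * indicator {0<..} x \<partial>lborel)"
proof -
  let ?I = "\<lambda>n::nat. {1 / real (Suc (Suc n)) .. real (Suc (Suc n))}"
  have lim: "(\<lambda>n. \<integral>\<^sup>+x. g x * indicator (?I n) x \<partial>lborel) \<longlonglongrightarrow> (\<integral>\<^sup>+x. g x * indicator {0<..} x \<partial>lborel)"
    if [measurable]: "g \<in> borel_measurable borel" for g :: "real \<Rightarrow> ennreal"
  proof -
    have inc: "incseq ?I"
      by (intro incseq_SucI) (auto intro: order_trans[rotated] divide_left_mono simp: field_simps)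
    have U: "(\<Union>n. ?I n) = {0<..}"
    proof (intro equalityI subsetI)
      fix x :: real assume "x \<in> {0<..}"
      then have x: "x > 0" by simp
      obtain n :: nat where n: "max x (1 / x) \<le> real n" using real_arch_simple by blast
      then have "x \<le> real (Suc (Suc n))" "1 / x \<le> real (Suc (Suc n))" by auto
      then show "x \<in> (\<Union>n. ?I n)" using x by (intro UN_I[of n]) (auto simp: field_simps)
    next
      fix x assume "x \<in> (\<Union>n. ?I n)"
      then obtain n where "1 / real (Suc (Suc n)) \<le> x" by auto
      moreover have "0 < 1 / real (Suc (Suc n))" by simp
      ultimately show "x \<in> {0<..}" by (simp only: greaterThan_iff)
    qed
    have "(\<lambda>n. emeasure (density lborel g) (?I n)) \<longlonglongrightarrow> emeasure (density lborel g) (\<Union>n. ?I n)"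
      by (intro Lim_emeasure_incseq inc) auto
    then show ?thesis unfolding U by (simp add: emeasure_density)
  qed
  have eq: "(\<integral>\<^sup>+x. f x * indicator (?I n) x \<partial>lborel) = (\<integral>\<^sup>+x. f (1 / x) * ennreal (1 / x\<^sup>2) * indicator (?I n) x \<partial>lborel)" for n
  proof -
    let ?b = "real (Suc (Suc n))" and ?a = "1 / real (Suc (Suc n))"
    have ab: "0 < ?a" "?a < ?b" by (auto simp: field_simps intro: order_less_le_trans[of _ "1 * 1"])
    have "(\<integral>\<^sup>+x. f x * indicator (?I n) x \<partial>lborel) = (\<integral>\<^sup>+x. f (- x) * indicator {- ?b .. - ?a} x \<partial>lborel)"
      by (subst nn_integral_real_affine[where c = "-1" and t = 0]) 
         (auto intro!: nn_integral_cong simp: indicator_def)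
    also have "\<dots> = (\<integral>\<^sup>+x. f (- (- 1 / x)) * ennreal (1 / x\<^sup>2) * indicator {?a .. ?b} x \<partial>lborel)"
    proof -
      have "(\<integral>\<^sup>+x. f (- x) * indicator {(- 1 / ?a) .. (- 1 / ?b)} x \<partial>lborel)
         = (\<integral>\<^sup>+x. f (- (- 1 / x)) * ennreal (1 / x\<^sup>2) * indicator {?a .. ?b} x \<partial>lborel)"
      proof (rule nn_integral_substitution_aux)
        show "((\<lambda>x. - 1 / x) has_real_derivative 1 / x\<^sup>2) (at x)" if "x \<in> {?a .. ?b}" for x
          using that ab by (auto intro!: derivative_eq_intros simp: power2_eq_square divide_simps)
        show "continuous_on {?a .. ?b} (\<lambda>x. 1 / x\<^sup>2)"
          using ab by (intro continuous_intros) auto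
      qed (use ab in auto)
      then show ?thesis by simp
    qed
    finally show ?thesis by simp
  qed
  show ?thesis
    using lim[of f] lim[of "\<lambda>x. f (1 / x) * ennreal (1 / x\<^sup>2)"] unfolding eq
    by (intro LIMSEQ_unique[of "\<lambda>n. \<integral>\<^sup>+x. f (1 / x) * ennreal (1 / x\<^sup>2) * indicator (?I n) x \<partial>lborel"]) auto
qed

text \<open>
  In the variable \<open>1 / s\<close> the functions become \<open>f (1 / x) / x\<^sup>2\<close> and \<open>g (1 / x) / x\<^sup>2\<close>. With \<open>P\<close> and
  \<open>Q\<close> as their suprema, the inequality between weighted geometric and arithmetic means shows that
  the superlevel inequality applies to these functions divided by \<open>P\<close> and \<open>Q\<close>, and to the transform
  of \<open>h\<close> multiplied by \<open>(l / sqrt P + m / sqrt Q)\<^sup>2\<close>. By the Cauchy-Schwarz inequality the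
  normalising factors cancel.
\<close>

lemma integral_harmonic_mean:
  fixes f g :: "real \<Rightarrow> real" and h :: "real \<Rightarrow> ennreal"
  assumes [measurable]: "f \<in> borel_measurable borel" "g \<in> borel_measurable borel" "h \<in> borel_measurable borel"
    and lm: "0 < l" "0 < m"
    and f: "\<And>s. 0 \<le> f s" "\<And>s. f s \<le> M" "\<And>s. R < s \<Longrightarrow> f s = 0"
    and g: "\<And>s. 0 \<le> g s" "\<And>s. g s \<le> M" "\<And>s. R < s \<Longrightarrow> g s = 0"
    and h: "\<And>s s' r. 0 < s \<Longrightarrow> 0 < s' \<Longrightarrow> 0 < f s \<Longrightarrow> 0 < g s' \<Longrightarrow> r = 1 / (l / s + m / s') \<Longrightarrow>
        ennreal (f s powr (l * r / s) * g s' powr (m * r / s')) \<le> h r"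
    and a: "(\<integral>\<^sup>+s. ennreal (f s) * indicator {0<..} s \<partial>lborel) = ennreal a" "0 < a"
    and b: "(\<integral>\<^sup>+s. ennreal (g s) * indicator {0<..} s \<partial>lborel) = ennreal b" "0 < b"
  shows "ennreal (1 / (l / a + m / b)) \<le> (\<integral>\<^sup>+s. h s * indicator {0<..} s \<partial>lborel)"
proof -
  have sup: "\<exists>P>0. (\<forall>s>0. s\<^sup>2 * k s \<le> P) \<and> (\<forall>\<tau><P. \<exists>s>0. \<tau> < s\<^sup>2 * k s)"
    if k: "\<And>s. 0 \<le> k s" "\<And>s. k s \<le> M" "\<And>s. R < s \<Longrightarrow> k s = 0" 
      and c: "(\<integral>\<^sup>+s. ennreal (k s) * indicator {0<..} s \<partial>lborel) = ennreal c" "0 < c"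
    for k :: "real \<Rightarrow> real" and c
  proof -
    let ?S = "(\<lambda>s. s\<^sup>2 * k s) ` {0<..}"
    have M0: "0 \<le> M" using k(1,2) order_trans by blast
    have bd: "bdd_above ?S"
    proof (rule bdd_aboveI2)
      fix s :: real assume "s \<in> {0<..}"
      then have s: "s > 0" by simp
      show "s\<^sup>2 * k s \<le> R\<^sup>2 * M"
      proof (cases "R < s")
        case False
        then show ?thesis using s k M0 by (intro mult_mono power_mono) auto
      qed (use k M0 in auto)
    qed
    have "\<exists>s>0. k s \<noteq> 0"
    proof (rule ccontr)
      assume "\<not> (\<exists>s>0. k s \<noteq> 0)"
      then have "(\<integral>\<^sup>+s. ennreal (k s) * indicator {0<..} s \<partial>lborel) = (\<integral>\<^sup>+s. 0 \<partial>(lborel :: real measure))"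
        by (intro nn_integral_cong) (auto simp: indicator_def)
      with c show False by simp
    qed
    then obtain s where s: "s > 0" "k s > 0" using k by (metis order_le_less)
    then have "0 < s\<^sup>2 * k s" by simp
    also have "\<dots> \<le> Sup ?S" using s by (intro cSup_upper bd) auto
    finally have "0 < Sup ?S" .
    moreover have "\<forall>s>0. s\<^sup>2 * k s \<le> Sup ?S" by (auto intro!: cSup_upper bd)
    moreover have "\<forall>\<tau><Sup ?S. \<exists>s>0. \<tau> < s\<^sup>2 * k s"
      using less_cSup_iff[OF _ bd] by (auto simp: image_iff)
    ultimately show ?thesis by blast
  qed
  obtain P where P: "P > 0" "\<And>s. s > 0 \<Longrightarrow> s\<^sup>2 * f s \<le> P" "\<And>\<tau>. \<tau> < P \<Longrightarrow> \<exists>s>0. \<tau> < s\<^sup>2 * f s"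
    using sup[OF f a] by auto
  obtain Q where Q: "Q > 0" "\<And>s. s > 0 \<Longrightarrow> s\<^sup>2 * g s \<le> Q" "\<And>\<tau>. \<tau> < Q \<Longrightarrow> \<exists>s>0. \<tau> < s\<^sup>2 * g s"
    using sup[OF g b] by auto
  define D where "D = l / sqrt P + m / sqrt Q"
  have D: "D > 0" using lm P Q by (simp add: D_def add_pos_pos)
  define p where "p x = (if 0 < x then f (1 / x) / x\<^sup>2 / P else 0)" for x :: real
  define q where "q x = (if 0 < x then g (1 / x) / x\<^sup>2 / Q else 0)" for x :: real
  have [measurable]: "p \<in> borel_measurable borel" "q \<in> borel_measurable borel"
    unfolding p_def[abs_def] q_def[abs_def] by measurable
  have "ennreal l * (\<integral>\<^sup>+x. ennreal (p x) \<partial>lborel) + ennreal m * (\<integral>\<^sup>+x. ennreal (q x) \<partial>lborel)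
     \<le> (\<integral>\<^sup>+x. ennreal (D\<^sup>2) * (h (1 / x) * ennreal (1 / x\<^sup>2) * indicator {0<..} x) \<partial>lborel)"
  proof (rule integral_superlevel_superadditive)
    show "ennreal (p x) \<le> 1" "ennreal (q x) \<le> 1" for x
      using P(1) P(2)[of "1/x"] Q(1) Q(2)[of "1/x"] by (auto simp: p_def q_def field_simps)
    show "\<exists>x. ennreal \<tau> < ennreal (p x)" if \<tau>: "0 \<le> \<tau>" "\<tau> < 1" for \<tau>
    proof -
      obtain s where "s > 0" "\<tau> * P < s\<^sup>2 * f s" using P(3)[of "\<tau> * P"] P(1) \<tau> by auto
      then show ?thesis using P(1) \<tau> by (intro exI[of _ "1/s"]) (auto simp: p_def ennreal_less_iff field_simps)
    qed
    show "\<exists>x. ennreal \<tau> < ennreal (q x)" if \<tau>: "0 \<le> \<tau>" "\<tau> < 1" for \<tau>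
    proof -
      obtain s where "s > 0" "\<tau> * Q < s\<^sup>2 * g s" using Q(3)[of "\<tau> * Q"] Q(1) \<tau> by auto
      then show ?thesis using Q(1) \<tau> by (intro exI[of _ "1/s"]) (auto simp: q_def ennreal_less_iff field_simps)
    qed
    fix x y assume pq: "0 < ennreal (p x)" "0 < ennreal (q y)"
    then have xy: "x > 0" "y > 0" by (auto simp: p_def q_def split: if_splits)
    have fg: "f (1 / x) > 0" "g (1 / y) > 0" using pq xy f(1)[of "1 / x"] g(1)[of "1 / y"] by (auto simp: p_def q_def order_le_less)
    define w where "w = l * x + m * y"
    have w: "w > 0" using lm xy by (simp add: w_def add_pos_pos)
    define \<alpha> \<beta> where "\<alpha> = l * x / w" and "\<beta> = m * y / w"
    have ab1: "\<alpha> > 0" "\<beta> > 0" "\<alpha> + \<beta> = 1" using lm xy w by (auto simp: \<alpha>_def \<beta>_def add_divide_distrib[symmetric] w_def)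
    have H: "ennreal (f (1 / x) powr \<alpha> * g (1 / y) powr \<beta>) \<le> h (1 / w)"
    proof -
      have "ennreal (f (1 / x) powr (l * (1 / w) / (1 / x)) * g (1 / y) powr (m * (1 / w) / (1 / y))) \<le> h (1 / w)"
        using xy fg w by (intro h) (auto simp: w_def)
      then show ?thesis by (simp add: \<alpha>_def \<beta>_def)
    qed
    have p: "p x = f (1 / x) * (1 / (x * sqrt P))\<^sup>2" and q: "q y = g (1 / y) * (1 / (y * sqrt Q))\<^sup>2"
      using xy P Q by (auto simp: p_def q_def power_divide power_mult_distrib)
    have pos: "p x > 0" "q y > 0" using pq by auto
    have Y: "(1 / (x * sqrt P)) powr \<alpha> * (1 / (y * sqrt Q)) powr \<beta> \<le> D / w"
    proof -
      have "(1 / (x * sqrt P)) powr \<alpha> * (1 / (y * sqrt Q)) powr \<beta> \<le> \<alpha> * (1 / (x * sqrt P)) + \<beta> * (1 / (y * sqrt Q))"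
        using ab1 xy P Q by (intro Youngs_inequality_0) auto
      also have "\<dots> = D / w" using xy P Q w by (simp add: \<alpha>_def \<beta>_def D_def field_simps)
      finally show ?thesis .
    qed
    have sq: "(c\<^sup>2) powr e = (c powr e)\<^sup>2" if "c > 0" for c e :: real
      using that by (simp add: power2_eq_square powr_mult)
    have "min (p x) (q y) = min (p x) (q y) powr \<alpha> * min (p x) (q y) powr \<beta>"
      using pos ab1 by (simp flip: powr_add)
    also have "\<dots> \<le> p x powr \<alpha> * q y powr \<beta>"
      using pos ab1 by (intro mult_mono powr_mono2) auto
    also have "\<dots> = (f (1 / x) powr \<alpha> * g (1 / y) powr \<beta>) * ((1 / (x * sqrt P)) powr \<alpha> * (1 / (y * sqrt Q)) powr \<beta>)\<^sup>2"
      unfolding p q using fg xy P Q by (simp add: powr_mult sq power_mult_distrib)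
    also have "\<dots> \<le> (f (1 / x) powr \<alpha> * g (1 / y) powr \<beta>) * (D / w)\<^sup>2"
      using Y by (intro mult_left_mono power_mono) auto
    finally have "ennreal (min (p x) (q y)) \<le> ennreal (f (1 / x) powr \<alpha> * g (1 / y) powr \<beta>) * ennreal ((D / w)\<^sup>2)"
      by (simp add: ennreal_leI flip: ennreal_mult)
    also have "\<dots> \<le> h (1 / w) * ennreal ((D / w)\<^sup>2)" by (intro mult_right_mono H) auto
    also have "\<dots> = ennreal (D\<^sup>2) * (h (1 / w) * ennreal (1 / w\<^sup>2) * indicator {0<..} w)"
    proof -
      have "ennreal ((D / w)\<^sup>2) = ennreal (D\<^sup>2) * ennreal (1 / w\<^sup>2)" by (simp add: power_divide flip: ennreal_mult)
      then show ?thesis using w by (simp add: ac_simps)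
    qed
    finally show "min (ennreal (p x)) (ennreal (q y)) \<le> ennreal (D\<^sup>2) * (h (1 / (l * x + m * y)) * ennreal (1 / (l * x + m * y)\<^sup>2) * indicator {0<..} (l * x + m * y))"
      using pos unfolding w_def by (simp add: min_def ennreal_le_iff2 split: if_splits)
  qed (use lm in measurable)
  also have "(\<integral>\<^sup>+x. ennreal (D\<^sup>2) * (h (1 / x) * ennreal (1 / x\<^sup>2) * indicator {0<..} x) \<partial>lborel)
      = ennreal (D\<^sup>2) * (\<integral>\<^sup>+s. h s * indicator {0<..} s \<partial>lborel)"
    by (subst nn_integral_cmult) (auto simp: nn_integral_reciprocal[of h])
  also have "(\<integral>\<^sup>+x. ennreal (p x) \<partial>lborel) = ennreal (a / P)"
  proof -
    have "(\<integral>\<^sup>+x. ennreal (p x) \<partial>lborel) = (\<integral>\<^sup>+x. ennreal (1 / P) * (ennreal (f (1 / x)) * ennreal (1 / x\<^sup>2) * indicator {0<..} x) \<partial>lborel)"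
      using P f by (intro nn_integral_cong) (auto simp: p_def indicator_def divide_simps simp flip: ennreal_mult)
    also have "\<dots> = ennreal (1 / P) * ennreal a"
      by (subst nn_integral_cmult) (auto simp: nn_integral_reciprocal[of "\<lambda>x. ennreal (f x)", symmetric] a)
    finally show ?thesis using P a by (simp flip: ennreal_mult)
  qed
  also have "(\<integral>\<^sup>+x. ennreal (q x) \<partial>lborel) = ennreal (b / Q)"
  proof -
    have "(\<integral>\<^sup>+x. ennreal (q x) \<partial>lborel) = (\<integral>\<^sup>+x. ennreal (1 / Q) * (ennreal (g (1 / x)) * ennreal (1 / x\<^sup>2) * indicator {0<..} x) \<partial>lborel)"
      using Q g by (intro nn_integral_cong) (auto simp: q_def indicator_def divide_simps simp flip: ennreal_mult)
    also have "\<dots> = ennreal (1 / Q) * ennreal b"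
      by (subst nn_integral_cmult) (auto simp: nn_integral_reciprocal[of "\<lambda>x. ennreal (g x)", symmetric] b)
    finally show ?thesis using Q b by (simp flip: ennreal_mult)
  qed
  also have "ennreal l * ennreal (a / P) + ennreal m * ennreal (b / Q) = ennreal (l * a / P + m * b / Q)"
    using lm a b P Q by (simp flip: ennreal_mult ennreal_plus)
  finally have le: "ennreal (l * a / P + m * b / Q) \<le> ennreal (D\<^sup>2) * (\<integral>\<^sup>+s. h s * indicator {0<..} s \<partial>lborel)" .
  \<comment> \<open>The Cauchy-Schwarz inequality.\<close>
  have cs: "D\<^sup>2 \<le> (l * a / P + m * b / Q) * (l / a + m / b)"
  proof -
    define u v where "u = sqrt P" and "v = sqrt Q"
    have uv: "u > 0" "v > 0" "P = u\<^sup>2" "Q = v\<^sup>2" using P Q by (auto simp: u_def v_def)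
    have "(l * a / u\<^sup>2 + m * b / v\<^sup>2) * (l / a + m / b) - (l / u + m / v)\<^sup>2 = l * m * ((a / b) / u\<^sup>2 + (b / a) / v\<^sup>2 - 2 / (u * v))"
      using uv a b by (simp add: power2_eq_square divide_simps) (simp add: algebra_simps)
    also have "\<dots> = l * m * (sqrt (a / b) / u - sqrt (b / a) / v)\<^sup>2"
    proof -
      have "sqrt (a / b) * sqrt (b / a) = 1" using a b by (simp flip: real_sqrt_mult)
      moreover have "(sqrt (a / b))\<^sup>2 = a / b" "(sqrt (b / a))\<^sup>2 = b / a" using a b by auto
      ultimately show ?thesis by (simp add: power2_diff power_divide)
    qed
    finally show ?thesis using lm uv(3,4) unfolding D_def u_def[symmetric] v_def[symmetric] by (smt (verit) mult_nonneg_nonneg zero_le_power2)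
  qed
  show ?thesis
  proof (cases "(\<integral>\<^sup>+s. h s * indicator {0<..} s \<partial>lborel)")
    case (real c)
    have "ennreal (l * a / P + m * b / Q) \<le> ennreal (D\<^sup>2 * c)"
      using le real by (subst ennreal_mult) auto
    then have "l * a / P + m * b / Q \<le> D\<^sup>2 * c"
      using real by (subst (asm) ennreal_le_iff) auto
    also have "\<dots> \<le> ((l * a / P + m * b / Q) * (l / a + m / b)) * c"
      using cs real by (intro mult_right_mono) auto
    finally have "(l * a / P + m * b / Q) * 1 \<le> (l * a / P + m * b / Q) * ((l / a + m / b) * c)" by (simp add: mult.assoc)
    moreover have "l * a / P + m * b / Q > 0" using lm a b P Q by (simp add: add_pos_pos)
    ultimately have "1 \<le> (l / a + m / b) * c" by simp
    moreover have "l / a + m / b > 0" using lm a b by (simp add: add_pos_pos)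
    ultimately have "1 / (l / a + m / b) \<le> c" by (simp add: pos_divide_le_eq mult.commute)
    then show ?thesis unfolding real by (rule ennreal_leI)
  qed simp
qed

text \<open>
  Both measures are multiples of the Hausdorff measure, by the density formula for the
  parametrisations \<open>R\<close> and identity.
\<close>

lemma linear_image_scale:
  fixes R :: "'e::euclidean_space \<Rightarrow> 'e"
  assumes R: "linear R" "inj R"
  obtains c where "c > 0" "\<And>A. A \<in> sets borel \<Longrightarrow> emeasure lborel (R ` A) = ennreal c * emeasure lborel A"
proof -
  interpret R: linear_param R using R by (rule linear_param.intro)
  interpret I: linear_param "\<lambda>x::'e. x" by unfold_locales (auto simp: linear_iff)
  define c where "c = measure lborel (param_ball (\<lambda>x::'e. x)) / measure lborel (param_ball R)"
  have "emeasure lborel (R ` A) = ennreal c * emeasure lborel A" if A: "A \<in> sets borel" for A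
  proof -
    have RA: "R ` A \<in> sets borel"
    proof -
      obtain g where g: "linear g" "g \<circ> R = id" "R \<circ> g = id"
        using linear_injective_isomorphism[OF R] by (metis comp_apply eq_id_iff ext)
      have "R ` A = g -` A" using g by (auto simp: fun_eq_iff image_iff) metis
      then show ?thesis using linear_vimage_borel[OF g(1) A] by simp
    qed
    let ?w = "unit_ball_vol (real DIM('e))"
    have w: "?w \<noteq> 0" by (metis unit_ball_vol_pos less_irrefl of_nat_0_le_iff)
    have "ennreal (?w / I.\<kappa>) * emeasure lborel (R ` A) = hausdorff_measure DIM('e) (R ` A)"
      using I.hausdorff_measure_image[OF RA] by simp
    also have "\<dots> = ennreal (?w / R.\<kappa>) * emeasure lborel A" by (rule R.hausdorff_measure_image[OF A])
    finally have "ennreal (I.\<kappa> / ?w) * (ennreal (?w / I.\<kappa>) * emeasure lborel (R ` A))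
        = ennreal (I.\<kappa> / ?w) * (ennreal (?w / R.\<kappa>) * emeasure lborel A)" by simp
    moreover have "ennreal (I.\<kappa> / ?w) * ennreal (?w / I.\<kappa>) = 1"
      using I.measure_param_ball_pos w by (simp flip: ennreal_mult)
    moreover have "ennreal (I.\<kappa> / ?w) * ennreal (?w / R.\<kappa>) = ennreal c"
      using I.measure_param_ball_pos R.measure_param_ball_pos w
      by (simp add: c_def flip: ennreal_mult)
    ultimately show ?thesis by (simp flip: mult.assoc)
  qed
  moreover have "c > 0" using I.measure_param_ball_pos R.measure_param_ball_pos by (simp add: c_def)
  ultimately show thesis using that by blast
qed

lemma emeasure_prod_sections:
  fixes S :: "(real \<times> 'f::euclidean_space) set"
  assumes S: "S \<in> sets borel"
  shows "emeasure lborel S = (\<integral>\<^sup>+s. emeasure lborel (Pair s -` S) \<partial>lborel)"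
    and "Pair s -` S \<in> sets borel"
    and "(\<lambda>s. emeasure lborel (Pair s -` S)) \<in> borel_measurable borel"
proof -
  have S': "S \<in> sets (lborel \<Otimes>\<^sub>M lborel)" using S by (simp only: lborel_prod sets_lborel)
  show "emeasure lborel S = (\<integral>\<^sup>+s. emeasure lborel (Pair s -` S) \<partial>lborel)"
    using lborel.emeasure_pair_measure_alt[OF S'] by (simp add: lborel_prod)
  show "Pair s -` S \<in> sets borel" using sets_Pair1[OF S'] by simp
  show "(\<lambda>s. emeasure lborel (Pair s -` S)) \<in> borel_measurable borel"
    using lborel.measurable_emeasure_Pair[OF S'] by simp
qed

text \<open>
  The range is the graph over the range of \<open>\<phi>\<close> with slope \<open>a\<close> in the direction \<open>u\<close>.
\<close>

definition tilt :: "('e \<Rightarrow> 'a::real_vector) \<Rightarrow> ('e \<Rightarrow> real) \<Rightarrow> 'a \<Rightarrow> 'e \<Rightarrow> 'a" where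
  "tilt \<phi> a u c = \<phi> c + a c *\<^sub>R u"

lemma linear_param_tilt:
  assumes "linear_param \<phi>" "u \<notin> range \<phi>" "linear a"
  shows "linear_param (tilt \<phi> a u)"
proof (rule linear_param.intro)
  interpret linear_param \<phi> by fact
  show lt: "linear (tilt \<phi> a u)"
    unfolding tilt_def using linear_add[OF assms(3)] linear_scale[OF assms(3)] by (intro linearI) (auto simp: hom algebra_simps)
  have "c = 0" if "tilt \<phi> a u c = 0" for c
  proof -
    have eq: "a c *\<^sub>R u = \<phi> (- c)" using that by (simp add: tilt_def hom eq_neg_iff_add_eq_0 add.commute)
    then have "a c = 0" by (intro scaleR_mem_rangeD[OF assms(2)]) simp
    with eq have "\<phi> c = \<phi> 0" by (simp add: hom)
    then show ?thesis using inj by (simp add: inj_eq)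
  qed
  then show "inj (tilt \<phi> a u)" using linear_injective_0[OF lt] by blast
qed

text \<open>
  The hyperplanes share the subspace of codimension two where the first coordinate \<open>s\<close> vanishes.
  A convex combination of a point of the first hyperplane over \<open>s\<close> and a point of the second one
  over \<open>s'\<close> lies in the third hyperplane exactly if it lies over \<open>1 / (l / s + m / s')\<close>. By the
  Brunn-Minkowski inequality the section volumes therefore satisfy the hypothesis of the
  harmonic mean inequality. Negative \<open>m\<close> is covered by using the sections of the second ball over
  negative \<open>s'\<close>, which have the same volumes by symmetry.
\<close>

lemma busemann_pencil:
  fixes \<theta> :: "real \<times> 'f::euclidean_space \<Rightarrow> 'a::real_normed_vector"
  assumes \<theta>: "linear_param \<theta>" and u: "u \<notin> range \<theta>" and lm: "0 < l" "m \<noteq> 0" "l + m = 1"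
  defines "G \<equiv> \<lambda>t. measure lborel (param_ball (tilt \<theta> (\<lambda>p. t * fst p) u))"
  shows "1 / G (l * t1 + m * t2) \<le> l / G t1 + \<bar>m\<bar> / G t2"
proof -
  interpret T: linear_param "tilt \<theta> (\<lambda>p. t * fst p) u" for t
    using \<theta> u by (intro linear_param_tilt) (auto simp: linear_iff algebra_simps)
  interpret \<theta>: linear_param \<theta> by fact
  let ?B = "\<lambda>t. param_ball (tilt \<theta> (\<lambda>p. t * fst p) u)"
  define sec where "sec t s = Pair s -` ?B t" for t s
  have secI: "y \<in> sec t s \<longleftrightarrow> norm (\<theta> (s, y) + (t * s) *\<^sub>R u) < 1" for t s y
    by (simp add: sec_def param_ball_def tilt_def)
  have Bb: "?B t \<in> sets borel" for t by (rule T.param_ball_borel)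
  have secb: "sec t s \<in> sets borel" for t s using emeasure_prod_sections(2)[OF Bb] by (simp add: sec_def)
  have "\<exists>r. \<forall>p\<in>?B t. norm p \<le> r" for t using T.bounded_param_ball[of t] by (auto simp: bounded_iff)
  then obtain r where r: "\<And>t p. p \<in> ?B t \<Longrightarrow> norm p \<le> r t" by metis
  have rs: "norm s \<le> r t" "norm y \<le> r t" if "y \<in> sec t s" for y s t
    using r[of "(s, y)" t] that norm_fst_le[of s y] norm_snd_le[of y s] by (auto simp: sec_def intro: order_trans)
  have secbd: "bounded (sec t s)" for t s by (rule boundedI[of _ "r t"]) (rule rs)
  define f where "f t s = measure lborel (sec t s)" for t s
  have fe: "ennreal (f t s) = emeasure lborel (sec t s)" for t s
    unfolding f_def using emeasure_bounded_finite[OF secbd[of t s]] by (intro emeasure_eq_ennreal_measure[symmetric]) auto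
  have fm [measurable]: "f t \<in> borel_measurable borel" for t
    using emeasure_prod_sections(3)[OF Bb[of t]] unfolding f_def measure_def sec_def by measurable
  define M where "M = max (measure lborel (cball (0::'f) (r t1))) (measure lborel (cball (0::'f) (r t2)))"
  have fM: "f t s \<le> measure lborel (cball (0::'f) (r t))" for t s
    unfolding f_def using rs(2) secb emeasure_bounded_finite[OF bounded_cball]
    by (intro measure_mono_fmeasurable) (auto simp: fmeasurable_def)
  have f0: "f t s = 0" if "s > r t" for t s
  proof -
    have "sec t s = {}" using rs(1)[of _ t s] that by (auto simp: abs_le_iff)
    then show ?thesis by (simp add: f_def)
  qed
  have sym: "f t (- s) = f t s" for t s
  proof -
    have "norm (\<theta> (- s, y) + (t * - s) *\<^sub>R u) = norm (- (\<theta> (s, - y) + (t * s) *\<^sub>R u))" for y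
      using \<theta>.hom(5)[of "(s, - y)"] by simp
    then have "y \<in> sec t (- s) \<longleftrightarrow> - y \<in> sec t s" for y
      unfolding secI norm_minus_cancel by simp
    then have "sec t (- s) = (\<lambda>y. 0 + (-1) *\<^sub>R y) ` sec t s"
      by (subst affine_image_eq_vimage) auto
    then have "emeasure lborel (sec t (- s)) = emeasure lborel (sec t s)"
      using secb emeasure_affine_image[of "-1" "sec t s" 0] by simp
    then show ?thesis by (simp add: f_def measure_def)
  qed
  have half: "(\<integral>\<^sup>+s. ennreal (f t s) * indicator {0<..} s \<partial>lborel) = ennreal (G t / 2)" for t
  proof -
    let ?h = "\<integral>\<^sup>+s. ennreal (f t s) * indicator {0<..} s \<partial>lborel"
    have "(\<integral>\<^sup>+s. ennreal (f t s) * indicator {..<0} s \<partial>lborel) = ?h"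
      by (subst nn_integral_real_affine[where c = "-1" and t = 0])
         (auto simp: sym indicator_def intro!: nn_integral_cong)
    moreover have "ennreal (G t) = (\<integral>\<^sup>+s. ennreal (f t s) \<partial>lborel)"
      unfolding G_def T.emeasure_param_ball[symmetric] emeasure_prod_sections(1)[OF Bb] fe sec_def ..
    moreover have "(\<integral>\<^sup>+s. ennreal (f t s) \<partial>lborel) = (\<integral>\<^sup>+s. ennreal (f t s) * indicator {0<..} s + ennreal (f t s) * indicator {..<0} s \<partial>lborel)"
      by (intro nn_integral_cong_AE AE_I[of _ _ "{0}"]) (auto simp: indicator_def split: if_splits)
    moreover have "\<dots> = ?h + (\<integral>\<^sup>+s. ennreal (f t s) * indicator {..<0} s \<partial>lborel)"
      by (intro nn_integral_add) measurable
    ultimately have "ennreal (G t) = ?h + ?h" by simp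
    then show ?thesis by (cases ?h) (auto simp: G_def simp flip: ennreal_plus)
  qed
  have Gpos: "G t > 0" for t unfolding G_def by (rule T.measure_param_ball_pos)
  \<comment> \<open>The sections of the second ball are taken over \<open>e * s'\<close>.\<close>
  define e where "e = sgn m"
  have e: "m = e * \<bar>m\<bar>" "e * e = 1" using lm by (auto simp: e_def sgn_if)
  have fe_sym: "f t (e * s) = f t s" for t s using sym[of t s] lm by (auto simp: e_def sgn_if)
  let ?t = "l * t1 + m * t2"
  have "ennreal (1 / (l / (G t1 / 2) + \<bar>m\<bar> / (G t2 / 2))) \<le> (\<integral>\<^sup>+s. ennreal (f ?t s) * indicator {0<..} s \<partial>lborel)"
  proof (rule integral_harmonic_mean[where f = "f t1" and g = "f t2" and R = "max (r t1) (r t2)" and M = M, OF _ _ _ _ _ _ _ _ _ _ _ _ half _ half])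
    show "f t1 s \<le> M" "f t2 s \<le> M" for s using fM[of t1 s] fM[of t2 s] by (auto simp: M_def)
    show "f t1 s = 0" "f t2 s = 0" if "max (r t1) (r t2) < s" for s using f0 that by auto
    show "0 \<le> f t1 s" "0 \<le> f t2 s" for s by (auto simp: f_def)
    fix s s' r' :: real
    assume s: "0 < s" "0 < s'" "0 < f t1 s" "0 < f t2 s'" and r': "r' = 1 / (l / s + \<bar>m\<bar> / s')"
    have D: "l / s + \<bar>m\<bar> / s' > 0" using lm s by (intro add_pos_pos) auto
    define \<alpha> \<beta> where "\<alpha> = l * r' / s" and "\<beta> = \<bar>m\<bar> * r' / s'"
    have r'0: "r' > 0" using D r' by simp
    have ab: "\<alpha> > 0" "\<beta> > 0" using lm s r'0 by (auto simp: \<alpha>_def \<beta>_def)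
    have ab1: "\<alpha> + \<beta> = 1"
    proof -
      have "\<alpha> + \<beta> = r' * (l / s + \<bar>m\<bar> / s')" by (simp add: \<alpha>_def \<beta>_def algebra_simps)
      then show ?thesis using D r' by simp
    qed
    have "ennreal (measure lborel (sec t1 s) powr (1 - \<beta>) * measure lborel (sec t2 (e * s')) powr \<beta>) \<le> emeasure lborel (sec ?t r')"
    proof (rule brunn_minkowski)
      show "0 < \<beta>" "\<beta> < 1" using ab ab1 by auto
      fix y z assume yz: "y \<in> sec t1 s" "z \<in> sec t2 (e * s')"
      have c1: "\<alpha> * s + \<beta> * (e * s') = r'"
      proof -
        have "\<alpha> * s + \<beta> * (e * s') = l * r' + (e * \<bar>m\<bar>) * r'" using s by (simp add: \<alpha>_def \<beta>_def)
        also have "\<dots> = r'" using lm(3) e(1) by (simp flip: distrib_right)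
        finally show ?thesis .
      qed
      have c2: "\<alpha> * (t1 * s) + \<beta> * (t2 * (e * s')) = ?t * r'"
      proof -
        have "\<alpha> * (t1 * s) + \<beta> * (t2 * (e * s')) = l * r' * t1 + (e * \<bar>m\<bar>) * r' * t2" using s by (simp add: \<alpha>_def \<beta>_def)
        also have "\<dots> = ?t * r'" using e(1) by (simp add: algebra_simps)
        finally show ?thesis .
      qed
      have "(r', (1 - \<beta>) *\<^sub>R y + \<beta> *\<^sub>R z) = \<alpha> *\<^sub>R (s, y) + \<beta> *\<^sub>R (e * s', z)"
        using ab1 c1 by (simp add: scaleR_Pair)
      then have "\<theta> (r', (1 - \<beta>) *\<^sub>R y + \<beta> *\<^sub>R z) = \<alpha> *\<^sub>R \<theta> (s, y) + \<beta> *\<^sub>R \<theta> (e * s', z)"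
        by (simp only: \<theta>.hom)
      then have "\<theta> (r', (1 - \<beta>) *\<^sub>R y + \<beta> *\<^sub>R z) + (?t * r') *\<^sub>R u
         = \<alpha> *\<^sub>R (\<theta> (s, y) + (t1 * s) *\<^sub>R u) + \<beta> *\<^sub>R (\<theta> (e * s', z) + (t2 * (e * s')) *\<^sub>R u)"
        unfolding c2[symmetric] by (simp add: algebra_simps)
      also have "norm \<dots> \<le> \<alpha> * norm (\<theta> (s, y) + (t1 * s) *\<^sub>R u) + \<beta> * norm (\<theta> (e * s', z) + (t2 * (e * s')) *\<^sub>R u)"
        using ab by (intro order_trans[OF norm_triangle_ineq]) simp
      also have "\<dots> < \<alpha> * 1 + \<beta> * 1"
        using yz ab by (intro add_strict_mono mult_strict_left_mono) (auto simp: secI)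
      finally show "(1 - \<beta>) *\<^sub>R y + \<beta> *\<^sub>R z \<in> sec ?t r'" using ab1 by (simp add: secI)
    qed (use secb secbd in auto)
    moreover have "1 - \<beta> = \<alpha>" using ab1 by simp
    ultimately show "ennreal (f t1 s powr (l * r' / s) * f t2 s' powr (\<bar>m\<bar> * r' / s')) \<le> ennreal (f ?t r')"
      unfolding fe by (simp add: f_def[symmetric] fe_sym \<alpha>_def \<beta>_def)
  qed (use lm Gpos in auto)
  then have "1 / (l / (G t1 / 2) + \<bar>m\<bar> / (G t2 / 2)) \<le> G ?t / 2"
    unfolding half using Gpos[of ?t] by (subst (asm) ennreal_le_iff) auto
  moreover have "l / (G t1 / 2) + \<bar>m\<bar> / (G t2 / 2) = 2 * (l / G t1 + \<bar>m\<bar> / G t2)" by (simp add: distrib_left mult.commute)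
  ultimately have "(1 / (l / G t1 + \<bar>m\<bar> / G t2)) / 2 \<le> G ?t / 2" by (metis divide_divide_eq_left' mult.commute)
  moreover have "x \<le> y" if "x / 2 \<le> y / 2" for x y :: real using that by simp
  ultimately have "1 / (l / G t1 + \<bar>m\<bar> / G t2) \<le> G ?t" by blast
  moreover have "l / G t1 + \<bar>m\<bar> / G t2 > 0" using lm Gpos by (intro add_pos_pos) auto
  ultimately show ?thesis using Gpos[of ?t]
    by (simp add: pos_divide_le_eq mult.commute)
qed

lemma obtain_linear_param:
  fixes V :: "'a::real_normed_vector set"
  assumes V: "subspace V" "dim V = DIM('e::euclidean_space)"
  obtains \<phi> :: "'e::euclidean_space \<Rightarrow> 'a" where "linear_param \<phi>" "range \<phi> = V"
proof -
  obtain B where B: "B \<subseteq> V" "independent B" "V \<subseteq> span B" "card B = dim V"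
    using basis_exists by blast
  have fB: "finite B" using B(4) V(2) by (intro card_ge_0_finite) simp
  obtain f where f: "bij_betw f (Basis :: 'e set) B"
    using finite_same_card_bij[OF finite_Basis fB] B V by auto
  define \<phi> where "\<phi> c = (\<Sum>b\<in>Basis. (c \<bullet> b) *\<^sub>R f b)" for c :: 'e
  have lin: "linear \<phi>"
    by (intro linearI) (auto simp: \<phi>_def inner_add_left scaleR_add_left sum.distrib scaleR_sum_right)
  have eq: "\<phi> c = (\<Sum>v\<in>B. (c \<bullet> inv_into Basis f v) *\<^sub>R v)" for c
  proof -
    have "(\<Sum>v\<in>B. (c \<bullet> inv_into Basis f v) *\<^sub>R v) = (\<Sum>b\<in>Basis. (c \<bullet> inv_into Basis f (f b)) *\<^sub>R f b)"
      by (rule sum.reindex_bij_betw[OF f, symmetric])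
    also have "\<dots> = \<phi> c" unfolding \<phi>_def using f by (intro sum.cong) (auto simp: bij_betw_def)
    finally show ?thesis ..
  qed
  have "c = 0" if "\<phi> c = 0" for c
  proof (rule euclidean_eqI)
    fix b :: 'e assume b: "b \<in> Basis"
    have "f b \<in> B" "inv_into Basis f (f b) = b" using f b by (auto simp: bij_betw_def)
    with independentD[OF B(2) fB order_refl, of "\<lambda>v. c \<bullet> inv_into Basis f v" "f b"] that eq[of c]
    show "c \<bullet> b = 0 \<bullet> b" by simp
  qed
  then have "inj \<phi>" using linear_injective_0[OF lin] by blast
  have "range \<phi> = span B"
  proof (intro equalityI subsetI)
    fix x assume "x \<in> range \<phi>"
    then obtain c where "x = \<phi> c" by auto
    then show "x \<in> span B" unfolding eq by (auto intro: span_sum span_scale span_base)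
  next
    fix x assume "x \<in> span B"
    then obtain w where w: "x = (\<Sum>v\<in>B. w v *\<^sub>R v)" unfolding span_finite[OF fB] by auto
    have "x = (\<Sum>b\<in>Basis. w (f b) *\<^sub>R f b)" unfolding w by (rule sum.reindex_bij_betw[OF f, symmetric])
    also have "\<dots> = \<phi> (\<Sum>b\<in>Basis. w (f b) *\<^sub>R b)" unfolding \<phi>_def by (intro sum.cong) auto
    finally show "x \<in> range \<phi>" by blast
  qed
  also have "span B = V" using B V span_minimal by (metis subset_antisym)
  finally show thesis using that[of \<phi>] lin \<open>inj \<phi>\<close> by (auto simp: linear_param_def)
qed

text \<open>
  Coordinates in which the functional \<open>l\<close> is the first coordinate, with the effect on volume.
\<close>

lemma obtain_coordinates:
  fixes l :: "real \<times> 'f::euclidean_space"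
  assumes "l \<noteq> 0"
  obtains R :: "real \<times> 'f \<Rightarrow> real \<times> 'f" and c where "linear R" "inj R" "surj R" "\<And>p. l \<bullet> R p = fst p" "c > 0"
    "\<And>X. X \<in> sets borel \<Longrightarrow> emeasure lborel X = ennreal c * emeasure lborel (R -` X)"
proof -
  have "dim {x. l \<bullet> x = 0} = DIM('f)" using dim_hyperplane[OF assms] by simp
  then obtain \<psi> :: "'f \<Rightarrow> real \<times> 'f" where \<psi>: "linear_param \<psi>" "range \<psi> = {x. l \<bullet> x = 0}"
    using obtain_linear_param[OF subspace_hyperplane] by metis
  interpret \<psi>: linear_param \<psi> by fact
  define R where "R p = (fst p / (l \<bullet> l)) *\<^sub>R l + \<psi> (snd p)" for p
  have lR: "linear R" by (intro linearI) (auto simp: R_def \<psi>.hom algebra_simps add_divide_distrib)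
  have fst: "l \<bullet> R p = fst p" for p
  proof -
    have "l \<bullet> \<psi> (snd p) = 0" using \<psi>(2) by auto
    then show ?thesis using assms by (simp add: R_def inner_add_right)
  qed
  have "p = 0" if "R p = 0" for p
  proof -
    have "fst p = 0" using fst[of p] that by simp
    moreover from this have "\<psi> (snd p) = \<psi> 0" using that by (simp add: R_def \<psi>.hom)
    moreover from this have "snd p = 0" by (rule injD[OF \<psi>.inj])
    ultimately show ?thesis by (simp add: prod_eq_iff)
  qed
  then have iR: "inj R" using linear_injective_0[OF lR] by blast
  then have sR: "surj R" using linear_injective_imp_surjective[OF lR] by blast
  obtain c where c: "c > 0" "\<And>A. A \<in> sets borel \<Longrightarrow> emeasure lborel (R ` A) = ennreal c * emeasure lborel A"
    using linear_image_scale[OF lR iR] by blast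
  have "emeasure lborel X = ennreal c * emeasure lborel (R -` X)" if "X \<in> sets borel" for X
    using c(2)[OF linear_vimage_borel[OF lR that]] surj_image_vimage_eq[OF sR] by simp
  with that[OF lR iR sR fst c(1)] show thesis by blast
qed

text \<open>
  Busemann's theorem for hyperplanes transversal to \<open>u\<close>: in coordinates where the difference of the
  slopes is the first coordinate, the three hyperplanes form a pencil.
\<close>

lemma busemann_inequality:
  fixes \<phi> :: "real \<times> 'f::euclidean_space \<Rightarrow> 'a::real_normed_vector" and a b :: "real \<times> 'f"
  assumes \<phi>: "linear_param \<phi>" and u: "u \<notin> range \<phi>" and lm: "0 < l" "m \<noteq> 0" "l + m = 1"
  defines "G \<equiv> \<lambda>a. measure lborel (param_ball (tilt \<phi> (\<lambda>c. a \<bullet> c) u))"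
  shows "1 / G (l *\<^sub>R a + m *\<^sub>R b) \<le> l / G a + \<bar>m\<bar> / G b"
proof -
  have lp: "linear_param (tilt \<phi> (\<lambda>c. a \<bullet> c) u)" for a
    by (rule linear_param_tilt[OF \<phi> u]) (rule bounded_linear.linear[OF bounded_linear_inner_right])
  interpret T: linear_param "tilt \<phi> (\<lambda>c. x \<bullet> c) u" for x by (rule lp)
  interpret \<phi>: linear_param \<phi> by fact
  have Gpos: "G a > 0" for a unfolding G_def by (rule T.measure_param_ball_pos)
  show ?thesis
  proof (cases "a = b")
    case True
    have e: "l *\<^sub>R b + m *\<^sub>R b = b" using lm by (simp flip: scaleR_add_left)
    have "1 / G b \<le> (l + \<bar>m\<bar>) / G b" using lm Gpos[of b] by (intro divide_right_mono) auto
    then have "1 / G (l *\<^sub>R b + m *\<^sub>R b) \<le> l / G b + \<bar>m\<bar> / G b" unfolding e by (simp add: add_divide_distrib)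
    then show ?thesis unfolding \<open>a = b\<close> .
  next
    case False
    define d where "d = b - a"
    have "d \<noteq> 0" using False by (simp add: d_def)
    obtain R :: "real \<times> 'f \<Rightarrow> real \<times> 'f" and c
      where R: "linear R" "inj R" "surj R" "\<And>p. d \<bullet> R p = fst p" "c > 0"
      "\<And>X. X \<in> sets borel \<Longrightarrow> emeasure lborel X = ennreal c * emeasure lborel (R -` X)"
      using obtain_coordinates[OF \<open>d \<noteq> 0\<close>] by metis
    define \<theta> where "\<theta> = tilt \<phi> (\<lambda>c. a \<bullet> c) u \<circ> R"
    have \<theta>: "linear_param \<theta>" unfolding \<theta>_def
      by (rule linear_param.intro) (auto intro!: linear_compose inj_compose R T.lin T.inj)
    have u\<theta>: "u \<notin> range \<theta>"
    proof
      assume "u \<in> range \<theta>"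
      then obtain p where p: "u = \<phi> (R p) + (a \<bullet> R p) *\<^sub>R u" by (auto simp: \<theta>_def tilt_def)
      then have "(1 - a \<bullet> R p) *\<^sub>R u = \<phi> (R p)" by (simp add: algebra_simps)
      then have 1: "1 - a \<bullet> R p = 0" by (intro \<phi>.scaleR_mem_rangeD[OF u]) simp
      then have "\<phi> (R p) = \<phi> 0" using p by (simp add: \<phi>.hom)
      then have "R p = 0" by (rule injD[OF \<phi>.inj])
      with 1 show False by simp
    qed
    have rel: "G (a + t *\<^sub>R d) = c * measure lborel (param_ball (tilt \<theta> (\<lambda>p. t * fst p) u))" for t
    proof -
      have "param_ball (tilt \<theta> (\<lambda>p. t * fst p) u) = R -` param_ball (tilt \<phi> (\<lambda>c. (a + t *\<^sub>R d) \<bullet> c) u)"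
        by (auto simp: param_ball_def tilt_def \<theta>_def R(4) inner_add_left algebra_simps)
      then show ?thesis unfolding G_def measure_def using R(5) R(6)[OF T.param_ball_borel]
        by (simp add: enn2real_mult)
    qed
    have "1 / measure lborel (param_ball (tilt \<theta> (\<lambda>p. (l * 0 + m * 1) * fst p) u))
       \<le> l / measure lborel (param_ball (tilt \<theta> (\<lambda>p. 0 * fst p) u)) + \<bar>m\<bar> / measure lborel (param_ball (tilt \<theta> (\<lambda>p. 1 * fst p) u))"
      by (rule busemann_pencil[OF \<theta> u\<theta> lm])
    then have "1 / (G (a + (l * 0 + m * 1) *\<^sub>R d) / c) \<le> l / (G (a + 0 *\<^sub>R d) / c) + \<bar>m\<bar> / (G (a + 1 *\<^sub>R d) / c)"
      unfolding rel using R(5) by simp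
    moreover have "a + (l * 0 + m * 1) *\<^sub>R d = l *\<^sub>R a + m *\<^sub>R b"
    proof -
      have "l *\<^sub>R a + m *\<^sub>R b = (l + m) *\<^sub>R a + m *\<^sub>R d" by (simp add: d_def algebra_simps)
      then show ?thesis by (simp add: lm(3))
    qed
    moreover have "a + 0 *\<^sub>R d = a" "a + 1 *\<^sub>R d = b" by (auto simp: d_def)
    ultimately have "c * (1 / G (l *\<^sub>R a + m *\<^sub>R b)) \<le> c * (l / G a + \<bar>m\<bar> / G b)"
      by (simp add: algebra_simps)
    then show ?thesis using R(5) by (simp only: mult_le_cancel_left_pos)
  qed
qed

text \<open>
  The determinant of a rank-one perturbation of the identity. In coordinates where \<open>l\<close> is the first
  coordinate \<open>s\<close>, the map multiplies \<open>s\<close> by \<open>1 + l \<bullet> z\<close> and translates each section.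
\<close>

lemma emeasure_shear_vimage:
  fixes l z :: "real \<times> 'f::euclidean_space"
  assumes k: "1 + l \<bullet> z \<noteq> 0" and S: "S \<in> sets borel"
  shows "emeasure lborel ((\<lambda>c. c + (l \<bullet> c) *\<^sub>R z) -` S) = ennreal (1 / \<bar>1 + l \<bullet> z\<bar>) * emeasure lborel S"
proof (cases "l = 0")
  case False
  let ?T = "\<lambda>c. c + (l \<bullet> c) *\<^sub>R z"
  have lT: "linear ?T" by (intro linearI) (auto simp: inner_add_right algebra_simps)
  obtain R :: "real \<times> 'f \<Rightarrow> real \<times> 'f" and c
    where R: "linear R" "inj R" "surj R" "\<And>p. l \<bullet> R p = fst p" "c > 0"
    "\<And>X. X \<in> sets borel \<Longrightarrow> emeasure lborel X = ennreal c * emeasure lborel (R -` X)"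
    using obtain_coordinates[OF False] by metis
  obtain w where w: "R w = z" using R(3) by (metis surjD)
  define k where "k = 1 + l \<bullet> z"
  have k': "k = 1 + fst w" using R(4)[of w] w by (simp add: k_def)
  have k0: "k \<noteq> 0" using k by (simp add: k_def)
  define T' where "T' p = p + fst p *\<^sub>R w" for p
  define S' where "S' = R -` S"
  have S': "S' \<in> sets borel" unfolding S'_def by (rule linear_vimage_borel[OF R(1) S])
  have lT': "linear T'" by (intro linearI) (auto simp: T'_def algebra_simps)
  have RT: "R -` (?T -` S) = T' -` S'"
  proof -
    have "R (T' p) = ?T (R p)" for p by (simp add: T'_def linear_add[OF R(1)] linear_scale[OF R(1)] R(4) w)
    then show ?thesis by (simp add: S'_def vimage_def)
  qed
  have sec: "emeasure lborel (Pair s -` (T' -` S')) = emeasure lborel (Pair (0 + k * s) -` S')" for s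
  proof -
    have "Pair s -` (T' -` S') = (\<lambda>y. - s *\<^sub>R snd w + 1 *\<^sub>R y) ` (Pair (k * s) -` S')"
      by (subst affine_image_eq_vimage) (auto simp: T'_def k' algebra_simps scaleR_prod_def plus_prod_def)
    then show ?thesis
      using emeasure_affine_image[of 1 "Pair (k * s) -` S'" "- s *\<^sub>R snd w"] emeasure_prod_sections(2)[OF S'] by simp
  qed
  have "emeasure lborel (T' -` S') = (\<integral>\<^sup>+s. emeasure lborel (Pair (0 + k * s) -` S') \<partial>lborel)"
    unfolding emeasure_prod_sections(1)[OF linear_vimage_borel[OF lT' S']] sec ..
  moreover have "emeasure lborel S' = ennreal \<bar>k\<bar> * (\<integral>\<^sup>+s. emeasure lborel (Pair (0 + k * s) -` S') \<partial>lborel)"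
    unfolding emeasure_prod_sections(1)[OF S']
    by (rule nn_integral_real_affine[OF emeasure_prod_sections(3)[OF S'] k0])
  ultimately have "emeasure lborel (T' -` S') = ennreal (1 / \<bar>k\<bar>) * emeasure lborel S'"
    using k0 by (simp add: mult.assoc[symmetric] flip: ennreal_mult)
  then show ?thesis
    unfolding R(6)[OF linear_vimage_borel[OF lT S]] R(6)[OF S] RT S'_def[symmetric] k_def[symmetric]
    by (simp add: ac_simps)
qed simp

lemma linear_functional_inner:
  fixes F :: "'e::euclidean_space \<Rightarrow> real"
  assumes F: "linear F"
  obtains l where "\<And>c. l \<bullet> c = F c"
proof
  fix c
  have "F c = F (\<Sum>b\<in>Basis. (c \<bullet> b) *\<^sub>R b)" by (simp only: euclidean_representation)
  also have "\<dots> = (\<Sum>b\<in>Basis. (c \<bullet> b) * F b)" by (simp add: linear_sum[OF F] linear_scale[OF F])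
  finally show "(\<Sum>b\<in>Basis. F b *\<^sub>R b) \<bullet> c = F c"
    unfolding inner_sum_left by (simp add: inner_commute[of c] mult.commute)
qed

text \<open>
  The directional derivative of \<open>g\<close> at the origin is sublinear, hence dominates a linear function.
\<close>

lemma convex_subgradient:
  fixes g :: "'e::euclidean_space \<Rightarrow> real"
  assumes conv: "\<And>l m a b. 0 < l \<Longrightarrow> 0 < m \<Longrightarrow> l + m = 1 \<Longrightarrow> g (l *\<^sub>R a + m *\<^sub>R b) \<le> l * g a + m * g b"
  obtains \<zeta> where "\<And>a. g 0 + a \<bullet> \<zeta> \<le> g a"
proof -
  define Q where "Q t a = (g (t *\<^sub>R a) - g 0) / t" for t a
  define q where "q a = (INF t\<in>{0<..}. Q t a)" for a
  have lower: "- (g (- a) - g 0) \<le> Q t a" if t: "t > 0" for t a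
  proof -
    have "g ((1 / (1 + t)) *\<^sub>R (t *\<^sub>R a) + (t / (1 + t)) *\<^sub>R (- a)) \<le> (1 / (1 + t)) * g (t *\<^sub>R a) + (t / (1 + t)) * g (- a)"
      using t by (intro conv) (auto simp: add_divide_distrib[symmetric])
    then have "g 0 \<le> (g (t *\<^sub>R a) + t * g (- a)) / (1 + t)" by (simp add: add_divide_distrib)
    then have "g 0 * (1 + t) \<le> g (t *\<^sub>R a) + t * g (- a)" using t by (simp add: pos_le_divide_eq)
    then show ?thesis unfolding Q_def pos_le_divide_eq[OF t] by (simp add: algebra_simps)
  qed
  have qle: "q a \<le> Q t a" if "t > 0" for t a
    unfolding q_def using lower that by (intro cINF_lower bdd_belowI2[of _ "- (g (- a) - g 0)"]) auto
  have qge: "c \<le> q a" if "\<And>t. t > 0 \<Longrightarrow> c \<le> Q t a" for c a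
    unfolding q_def using that by (intro cINF_greatest) auto
  have sub: "sublinear q" unfolding sublinear_def
  proof (intro conjI allI impI)
    fix a b
    have Qadd: "q (a + b) \<le> Q t a + Q t' b" if t: "t > 0" "t' > 0" for t t'
    proof -
      define s where "s = t * t' / (t + t')"
      have "s / t = t' / (t + t')" "s / t' = t / (t + t')" using t by (auto simp: s_def)
      then have s: "s > 0" "s / t + s / t' = 1" using t by (auto simp: s_def add_divide_distrib[symmetric])
      have "g (s *\<^sub>R (a + b)) = g ((s / t) *\<^sub>R (t *\<^sub>R a) + (s / t') *\<^sub>R (t' *\<^sub>R b))" using t by (simp add: algebra_simps)
      also have "\<dots> \<le> (s / t) * g (t *\<^sub>R a) + (s / t') * g (t' *\<^sub>R b)" using s t by (intro conv) auto
      finally have "g (s *\<^sub>R (a + b)) - (s / t + s / t') * g 0 \<le> s * Q t a + s * Q t' b"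
        by (simp add: Q_def algebra_simps diff_divide_distrib)
      then have "g (s *\<^sub>R (a + b)) - g 0 \<le> s * (Q t a + Q t' b)" unfolding s(2) by (simp add: algebra_simps)
      then have "Q s (a + b) \<le> Q t a + Q t' b" using s(1) by (simp add: Q_def pos_divide_le_eq mult.commute)
      then show ?thesis using qle[OF s(1), of "a + b"] by simp
    qed
    have "q (a + b) - Q t' b \<le> q a" if "t' > 0" for t' using Qadd[OF _ that] by (intro qge) (simp add: algebra_simps)
    then have "q (a + b) - q a \<le> q b" by (intro qge) (simp add: algebra_simps)
    then show "q (a + b) \<le> q a + q b" by simp
  next
    fix c :: real and a assume c: "0 < c"
    have Qc: "Q t (c *\<^sub>R a) = c * Q (t * c) a" for t using c by (simp add: Q_def)
    show "q (c *\<^sub>R a) = c * q a"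
    proof (rule antisym)
      have "q (c *\<^sub>R a) / c \<le> q a"
      proof (rule qge)
        fix t :: real assume t: "t > 0"
        have "q (c *\<^sub>R a) \<le> Q (t / c) (c *\<^sub>R a)" using t c by (intro qle) simp
        also have "\<dots> = c * Q t a" using c by (simp add: Qc)
        finally show "q (c *\<^sub>R a) / c \<le> Q t a" using c by (simp add: pos_divide_le_eq mult.commute)
      qed
      then show "q (c *\<^sub>R a) \<le> c * q a" using c by (simp add: pos_divide_le_eq mult.commute)
      show "c * q a \<le> q (c *\<^sub>R a)"
        using c qle by (intro qge) (simp add: Qc)
    qed
  qed
  obtain ys :: "'e list" where ys: "set ys = Basis" using finite_list[OF finite_Basis] by blast
  define F where "F = support_functional q ys 0"
  have F: "linear F" "\<And>a. F a \<le> q a"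
    unfolding F_def using linear_support_functional[OF sub] support_functional_le[OF sub] ys by auto
  obtain \<zeta> where \<zeta>: "\<And>a. \<zeta> \<bullet> a = F a" using linear_functional_inner[OF F(1)] by blast
  have "a \<bullet> \<zeta> = F a" for a by (subst inner_commute) (rule \<zeta>)
  then have "g 0 + a \<bullet> \<zeta> \<le> g a" for a using F(2)[of a] qle[of 1 a] by (simp add: Q_def)
  then show thesis by (rule that)
qed

text \<open>
  Busemann's theorem provides \<open>z\<close> with \<open>G a * \<bar>1 - a \<bullet> z\<bar> \<le> G 0\<close> for all slopes \<open>a\<close>. A hyperplane
  with slope \<open>l\<close> in the direction \<open>u + \<phi> z\<close> has slope \<open>a = l / (1 + l \<bullet> z)\<close> in the direction \<open>u\<close>, and the
  change of coordinates has determinant \<open>1 + l \<bullet> z = 1 / (1 - a \<bullet> z)\<close>. So the inequality is a bound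
  for the volume in question. Hyperplanes that contain \<open>u\<close> are limits of transversal ones.
\<close>

lemma busemann_projection:
  fixes \<phi> :: "real \<times> 'f::euclidean_space \<Rightarrow> 'a::real_normed_vector"
  assumes \<phi>: "linear_param \<phi>" and u: "u \<notin> range \<phi>"
  obtains z where "\<And>l. measure lborel (param_ball (tilt \<phi> (\<lambda>c. l \<bullet> c) (u + \<phi> z))) \<le> measure lborel (param_ball \<phi>)"
proof -
  interpret \<phi>: linear_param \<phi> by fact
  define G where "G a = measure lborel (param_ball (tilt \<phi> (\<lambda>c. a \<bullet> c) u))" for a
  have li: "linear (\<lambda>c. a \<bullet> c)" for a :: "real \<times> 'f" by (rule bounded_linear.linear[OF bounded_linear_inner_right])
  interpret T: linear_param "tilt \<phi> (\<lambda>c. x \<bullet> c) u" for x by (rule linear_param_tilt[OF \<phi> u li])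
  have Gpos: "G a > 0" for a unfolding G_def by (rule T.measure_param_ball_pos)
  have G0: "G 0 = measure lborel (param_ball \<phi>)" by (simp add: G_def tilt_def param_ball_def)
  have bus: "1 / G (l *\<^sub>R a + m *\<^sub>R b) \<le> l * (1 / G a) + \<bar>m\<bar> * (1 / G b)" if "0 < l" "m \<noteq> 0" "l + m = 1" for l m a b
    using busemann_inequality[OF \<phi> u that, of a b] by (simp add: G_def)
  obtain \<zeta> where \<zeta>: "\<And>a. 1 / G 0 + a \<bullet> \<zeta> \<le> 1 / G a"
    using convex_subgradient[of "\<lambda>a. 1 / G a"] bus by (metis abs_of_pos less_irrefl)
  define z where "z = - G 0 *\<^sub>R \<zeta>"
  have az: "a \<bullet> \<zeta> = - (a \<bullet> z) / G 0" for a using Gpos[of 0] by (simp add: z_def)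
  have key: "G a * \<bar>1 - a \<bullet> z\<bar> \<le> G 0" for a
  proof -
    have "(1 - a \<bullet> z) / G 0 \<le> 1 / G a" using \<zeta>[of a] by (simp add: az diff_divide_distrib)
    \<comment> \<open>The slope \<open>- a\<close> is \<open>2 *\<^sub>R 0 + (- 1) *\<^sub>R a\<close>, so the supporting function is also bounded at \<open>- a\<close> by the value at \<open>a\<close>.\<close>
    moreover have "- (1 - a \<bullet> z) / G 0 \<le> 1 / G a"
    proof -
      have "1 / G 0 + (- a) \<bullet> \<zeta> \<le> 1 / G (- a)" by (rule \<zeta>)
      also have "\<dots> \<le> 2 * (1 / G 0) + 1 * (1 / G a)" using bus[of 2 "- 1" 0 a] by simp
      finally have "1 / G 0 - a \<bullet> \<zeta> \<le> 2 / G 0 + 1 / G a" by simp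
      then show ?thesis by (simp add: az diff_divide_distrib)
    qed
    ultimately have "\<bar>1 - a \<bullet> z\<bar> / G 0 \<le> 1 / G a" by (simp add: abs_if)
    then show ?thesis using Gpos[of a] Gpos[of 0] by (simp add: field_simps)
  qed
  let ?B = "\<lambda>l. param_ball (tilt \<phi> (\<lambda>c. l \<bullet> c) (u + \<phi> z))"
  have Z: "u + \<phi> z \<notin> range \<phi>"
  proof
    assume "u + \<phi> z \<in> range \<phi>"
    then obtain c where "u + \<phi> z = \<phi> c" by auto
    then have "u = \<phi> (c - z)" by (simp add: \<phi>.hom algebra_simps)
    with u show False by blast
  qed
  interpret Z: linear_param "tilt \<phi> (\<lambda>c. x \<bullet> c) (u + \<phi> z)" for x by (rule linear_param_tilt[OF \<phi> Z li])
  have graph: "measure lborel (?B l) \<le> G 0" if k: "1 + l \<bullet> z \<noteq> 0" for l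
  proof -
    define a where "a = (1 / (1 + l \<bullet> z)) *\<^sub>R l"
    have kl: "a \<bullet> (c + (l \<bullet> c) *\<^sub>R z) = l \<bullet> c" for c
    proof -
      have "a \<bullet> (c + (l \<bullet> c) *\<^sub>R z) = (1 / (1 + l \<bullet> z)) * ((l \<bullet> c) * (1 + l \<bullet> z))"
        by (simp add: a_def inner_add_right distrib_left)
      then show ?thesis using k by simp
    qed
    have "?B l = (\<lambda>c. c + (l \<bullet> c) *\<^sub>R z) -` param_ball (tilt \<phi> (\<lambda>c. a \<bullet> c) u)"
    proof -
      have "tilt \<phi> (\<lambda>c. l \<bullet> c) (u + \<phi> z) c = tilt \<phi> (\<lambda>c. a \<bullet> c) u (c + (l \<bullet> c) *\<^sub>R z)" for c
        unfolding tilt_def kl by (simp add: \<phi>.hom algebra_simps)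
      then show ?thesis by (simp add: param_ball_def vimage_def)
    qed
    then have "emeasure lborel (?B l) = ennreal (1 / \<bar>1 + l \<bullet> z\<bar>) * ennreal (G a)"
      using emeasure_shear_vimage[OF k T.param_ball_borel] by (simp add: T.emeasure_param_ball G_def)
    then have "measure lborel (?B l) = 1 / \<bar>1 + l \<bullet> z\<bar> * G a"
      using Gpos[of a] by (simp add: measure_def flip: ennreal_mult)
    moreover have "1 - a \<bullet> z = 1 / (1 + l \<bullet> z)" using k by (simp add: a_def field_simps)
    then have "\<bar>1 - a \<bullet> z\<bar> = 1 / \<bar>1 + l \<bullet> z\<bar>" by simp
    ultimately show ?thesis using key[of a] by (simp add: mult.commute)
  qed
  have "measure lborel (?B l) \<le> G 0" for l
  proof (cases "1 + l \<bullet> z = 0")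
    case True
    \<comment> \<open>Slopes near \<open>l\<close> for which the determinant does not vanish.\<close>
    define L where "L n = (1 + 1 / real (Suc n)) *\<^sub>R l" for n
    have "1 + L n \<bullet> z \<noteq> 0" for n
    proof -
      have "1 + L n \<bullet> z = (1 + l \<bullet> z) + (1 / real (Suc n)) * (l \<bullet> z)" by (simp add: L_def algebra_simps)
      then show ?thesis using True by simp
    qed
    then have BL: "measure lborel (?B (L n)) \<le> G 0" for n by (rule graph)
    define D where "D N = (\<Inter>n\<in>{N..}. ?B (L n))" for N
    have Db: "D N \<in> sets borel" for N unfolding D_def by (intro sets.countable_INT') (auto intro: Z.param_ball_borel)
    have inc: "incseq D" unfolding D_def by (intro incseq_SucI) auto
    have "?B l \<subseteq> (\<Union>N. D N)"
    proof
      fix c assume c: "c \<in> ?B l"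
      have "(\<lambda>n. 1 + 1 / real (Suc n)) \<longlonglongrightarrow> 1 + 0"
        by (intro tendsto_intros LIMSEQ_inverse_real_of_nat[unfolded inverse_eq_divide])
      note lim = this
      have "(\<lambda>n. norm (\<phi> c + ((1 + 1 / real (Suc n)) * (l \<bullet> c)) *\<^sub>R (u + \<phi> z)))
         \<longlonglongrightarrow> norm (\<phi> c + ((1 + 0) * (l \<bullet> c)) *\<^sub>R (u + \<phi> z))"
        by (rule tendsto_norm[OF tendsto_add[OF tendsto_const tendsto_scaleR[OF tendsto_mult[OF lim tendsto_const] tendsto_const]]])
      then have "\<forall>\<^sub>F n in sequentially. norm (\<phi> c + ((1 + 1 / real (Suc n)) * (l \<bullet> c)) *\<^sub>R (u + \<phi> z)) < 1"
        using c by (intro order_tendstoD(2)) (auto simp: param_ball_def tilt_def)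
      then obtain N where "\<And>n. n \<ge> N \<Longrightarrow> norm (\<phi> c + ((1 + 1 / real (Suc n)) * (l \<bullet> c)) *\<^sub>R (u + \<phi> z)) < 1"
        by (auto simp: eventually_sequentially)
      then have "c \<in> D N" by (auto simp: D_def param_ball_def tilt_def L_def)
      then show "c \<in> (\<Union>N. D N)" by blast
    qed
    then have "emeasure lborel (?B l) \<le> emeasure lborel (\<Union>N. D N)" using Db by (intro emeasure_mono) auto
    also have "\<dots> = (SUP N. emeasure lborel (D N))" using Db inc by (intro SUP_emeasure_incseq[symmetric]) auto
    also have "\<dots> \<le> ennreal (G 0)"
    proof (rule SUP_least)
      fix N
      have "emeasure lborel (D N) \<le> emeasure lborel (?B (L N))" using Z.param_ball_borel by (intro emeasure_mono) (auto simp: D_def)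
      also have "\<dots> \<le> ennreal (G 0)" unfolding Z.emeasure_param_ball by (intro ennreal_leI BL)
      finally show "emeasure lborel (D N) \<le> ennreal (G 0)" .
    qed
    finally show ?thesis unfolding Z.emeasure_param_ball using Gpos[of 0] by simp
  qed (rule graph)
  then show thesis using that[of z] by (simp add: G0)
qed

section \<open>The energy of the area form in the plane\<close>

text \<open>
  In the plane, functionals are identified with vectors; this is the determinant of two of them.
\<close>

definition wedge :: "real \<times> real \<Rightarrow> real \<times> real \<Rightarrow> real" where
  "wedge f g = fst f * snd g - snd f * fst g"

lemma inner_real_prod: "(f :: real \<times> real) \<bullet> g = fst f * fst g + snd f * snd g"
  by (simp add: inner_prod_def)

lemma lagrange_identity: "(wedge f g)\<^sup>2 + (f \<bullet> g)\<^sup>2 = (norm f)\<^sup>2 * (norm g)\<^sup>2"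
  unfolding power2_norm_eq_inner by (simp add: wedge_def inner_real_prod power2_eq_square algebra_simps)

lemma abs_wedge_le: "\<bar>wedge f g\<bar> \<le> norm f * norm g"
proof (rule power2_le_imp_le)
  have "(wedge f g)\<^sup>2 \<le> (norm f)\<^sup>2 * (norm g)\<^sup>2"
    using lagrange_identity[of f g] zero_le_power2[of "f \<bullet> g"] by linarith
  then show "\<bar>wedge f g\<bar>\<^sup>2 \<le> (norm f * norm g)\<^sup>2" by (simp add: power_mult_distrib)
qed simp

lemma measurable_wedge [measurable]:
  "f \<in> borel_measurable M \<Longrightarrow> g \<in> borel_measurable M \<Longrightarrow> (\<lambda>x. wedge (f x) (g x)) \<in> borel_measurable M"
proof -
  have "continuous_on UNIV (\<lambda>p :: (real \<times> real) \<times> (real \<times> real). wedge (fst p) (snd p))"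
    unfolding wedge_def by (intro continuous_intros)
  then have w: "(\<lambda>p :: (real \<times> real) \<times> (real \<times> real). wedge (fst p) (snd p)) \<in> borel_measurable borel"
    by (rule borel_measurable_continuous_onI)
  assume [measurable]: "f \<in> borel_measurable M" "g \<in> borel_measurable M"
  have "(\<lambda>x. (f x, g x)) \<in> borel_measurable M" by measurable
  from measurable_compose[OF this w] show ?thesis by simp
qed

text \<open>
  Polynomials in \<open>y\<close> with nonnegative coefficients that increase to \<open>1 - sqrt (1 - y)\<close>.
\<close>

fun sqrt_approx :: "nat \<Rightarrow> real \<Rightarrow> real" where
  "sqrt_approx 0 y = 0"
| "sqrt_approx (Suc n) y = (y + (sqrt_approx n y)\<^sup>2) / 2"

lemma sqrt_approx_bounds:
  assumes y: "0 \<le> y" "y \<le> 1"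
  shows "0 \<le> sqrt_approx n y" "sqrt_approx n y \<le> 1 - sqrt (1 - y)" "sqrt_approx n y \<le> sqrt_approx (Suc n) y"
proof -
  define L where "L = 1 - sqrt (1 - y)"
  have L: "L = (y + L\<^sup>2) / 2" using y by (simp add: L_def power2_diff)
  have L0: "0 \<le> L" using y by (simp add: L_def)
  have *: "0 \<le> sqrt_approx n y \<and> sqrt_approx n y \<le> L \<and> sqrt_approx n y \<le> sqrt_approx (Suc n) y" for n
  proof (induction n)
    case (Suc n)
    have "(sqrt_approx n y)\<^sup>2 \<le> (sqrt_approx (Suc n) y)\<^sup>2" "(sqrt_approx n y)\<^sup>2 \<le> L\<^sup>2"
      using Suc by (auto intro!: power_mono simp del: sqrt_approx.simps)
    then show ?case using L y Suc by (simp add: add_nonneg_nonneg)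
  qed (use y L0 in auto)
  show "0 \<le> sqrt_approx n y" "sqrt_approx n y \<le> 1 - sqrt (1 - y)" "sqrt_approx n y \<le> sqrt_approx (Suc n) y"
    using *[of n] by (auto simp: L_def)
qed

lemma sqrt_approx_tendsto:
  assumes y: "0 \<le> y" "y \<le> 1"
  shows "(\<lambda>n. sqrt_approx n y) \<longlonglongrightarrow> 1 - sqrt (1 - y)"
proof -
  have "incseq (\<lambda>n. sqrt_approx n y)" using sqrt_approx_bounds(3)[OF y] by (rule incseq_SucI)
  then obtain L where L: "(\<lambda>n. sqrt_approx n y) \<longlonglongrightarrow> L"
    using incseq_convergent[of "\<lambda>n. sqrt_approx n y" "1 - sqrt (1 - y)"] sqrt_approx_bounds(2)[OF y] by blast
  have "(\<lambda>n. sqrt_approx (Suc n) y) \<longlonglongrightarrow> (y + L\<^sup>2) / 2"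
    unfolding sqrt_approx.simps by (intro tendsto_intros L) simp
  then have "L = (y + L\<^sup>2) / 2" using LIMSEQ_unique LIMSEQ_Suc[OF L] by blast
  then have "(1 - L)\<^sup>2 = 1 - y" by (simp add: power2_eq_square algebra_simps)
  moreover have "L \<le> 1 - sqrt (1 - y)" using sqrt_approx_bounds(2)[OF y] L by (intro LIMSEQ_le_const2) auto
  moreover have "0 \<le> sqrt (1 - y)" using y by simp
  ultimately have "1 - L = sqrt (1 - y)" by (intro real_sqrt_unique[symmetric]) linarith+
  then show ?thesis using L by (metis diff_diff_eq2 add_diff_cancel_left' add.commute)
qed

definition gram_list :: "('v \<Rightarrow> real) list \<Rightarrow> 'v \<Rightarrow> 'v \<Rightarrow> real" where
  "gram_list as f g = (\<Sum>a\<leftarrow>as. a f * a g)"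

text \<open>
  Kernels that are positive semidefinite by being finite sums of squares. They are closed under sums
  and products, hence under polynomials with nonnegative coefficients.
\<close>

definition gram_kernel :: "(real \<times> real \<Rightarrow> real \<times> real \<Rightarrow> real) \<Rightarrow> bool" where
  "gram_kernel k \<longleftrightarrow> (\<exists>as. (\<forall>a\<in>set as. a \<in> borel_measurable borel \<and> (\<exists>C. \<forall>v. \<bar>a v\<bar> \<le> C)) \<and> k = gram_list as)"

lemma gram_kernel_zero: "gram_kernel (\<lambda>f g. 0)"
  unfolding gram_kernel_def by (intro exI[of _ "[]"]) (auto simp: gram_list_def fun_eq_iff)

lemma gram_kernel_add:
  assumes "gram_kernel k" "gram_kernel k'"
  shows "gram_kernel (\<lambda>f g. k f g + k' f g)"
proof -
  obtain as bs where "\<forall>a\<in>set as. a \<in> borel_measurable borel \<and> (\<exists>C. \<forall>v. \<bar>a v\<bar> \<le> C)" "k = gram_list as"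
    "\<forall>a\<in>set bs. a \<in> borel_measurable borel \<and> (\<exists>C. \<forall>v. \<bar>a v\<bar> \<le> C)" "k' = gram_list bs"
    using assms unfolding gram_kernel_def by auto
  then show ?thesis unfolding gram_kernel_def
    by (intro exI[of _ "as @ bs"]) (auto simp: gram_list_def fun_eq_iff)
qed

lemma gram_kernel_rank1_mult:
  assumes a: "a \<in> borel_measurable borel" "\<forall>v. \<bar>a v\<bar> \<le> C" and k: "gram_kernel k"
  shows "gram_kernel (\<lambda>f g. a f * a g * k f g)"
proof -
  obtain bs where bs: "\<forall>a\<in>set bs. a \<in> borel_measurable borel \<and> (\<exists>C. \<forall>v. \<bar>a v\<bar> \<le> C)" "k = gram_list bs"
    using k unfolding gram_kernel_def by auto
  have "\<forall>b\<in>set (map (\<lambda>b v. a v * b v) bs). b \<in> borel_measurable borel \<and> (\<exists>C. \<forall>v. \<bar>b v\<bar> \<le> C)"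
  proof
    fix c assume "c \<in> set (map (\<lambda>b v. a v * b v) bs)"
    then obtain b D where b: "c = (\<lambda>v. a v * b v)" "b \<in> borel_measurable borel" "\<forall>v. \<bar>b v\<bar> \<le> D" using bs by fastforce
    have "\<bar>a v * b v\<bar> \<le> C * D" for v
    proof -
      have "0 \<le> C" using a(2) abs_ge_zero[of "a v"] order_trans by blast
      moreover have "\<bar>a v\<bar> \<le> C" "\<bar>b v\<bar> \<le> D" using a(2) b(3) by blast+
      ultimately show ?thesis unfolding abs_mult by (intro mult_mono) simp_all
    qed
    then show "c \<in> borel_measurable borel \<and> (\<exists>C. \<forall>v. \<bar>c v\<bar> \<le> C)" using a b by auto
  qed
  moreover have "a f * a g * gram_list bs f g = gram_list (map (\<lambda>b v. a v * b v) bs) f g" for f g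
    by (induction bs) (auto simp: gram_list_def algebra_simps)
  ultimately show ?thesis unfolding gram_kernel_def bs(2)
    by (intro exI[of _ "map (\<lambda>b v. a v * b v) bs"]) (auto simp: fun_eq_iff)
qed

lemma gram_kernel_mult:
  assumes "gram_kernel k" and k': "gram_kernel k'"
  shows "gram_kernel (\<lambda>f g. k f g * k' f g)"
proof -
  obtain as where as: "\<forall>a\<in>set as. a \<in> borel_measurable borel \<and> (\<exists>C. \<forall>v. \<bar>a v\<bar> \<le> C)" "k = gram_list as"
    using assms unfolding gram_kernel_def by auto
  show ?thesis unfolding as(2) using as(1)
  proof (induction as)
    case Nil
    then show ?case using gram_kernel_zero by (simp add: gram_list_def)
  next
    case (Cons a as)
    then obtain C where "a \<in> borel_measurable borel" "\<forall>v. \<bar>a v\<bar> \<le> C" by auto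
    from gram_kernel_add[OF gram_kernel_rank1_mult[OF this k'] Cons.IH] Cons.prems
    show ?case by (simp add: gram_list_def distrib_right)
  qed
qed

lemma gram_kernel_const:
  assumes "0 \<le> c"
  shows "gram_kernel (\<lambda>f g. c)"
  unfolding gram_kernel_def using assms
  by (intro exI[of _ "[\<lambda>v. sqrt c]"]) (auto simp: gram_list_def fun_eq_iff)

lemma gram_kernel_cos2: "gram_kernel (\<lambda>f g. (sgn f \<bullet> sgn g)\<^sup>2)"
proof -
  have [measurable]: "(sgn :: real \<times> real \<Rightarrow> _) \<in> borel_measurable borel" unfolding sgn_div_norm by measurable
  have b: "\<bar>fst (sgn v)\<bar> \<le> 1" "\<bar>snd (sgn v)\<bar> \<le> 1" for v :: "real \<times> real"
    using norm_fst_le[of "fst (sgn v)" "snd (sgn v)"] norm_snd_le[of "snd (sgn v)" "fst (sgn v)"] norm_sgn[of v] by (auto split: if_splits)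
  have m: "(\<lambda>v :: real \<times> real. fst (sgn v)) \<in> borel_measurable borel" "(\<lambda>v :: real \<times> real. snd (sgn v)) \<in> borel_measurable borel"
  proof -
    have "(\<lambda>v :: real \<times> real. sgn v \<bullet> (1, 0)) \<in> borel_measurable borel" "(\<lambda>v :: real \<times> real. sgn v \<bullet> (0, 1)) \<in> borel_measurable borel"
      by measurable
    then show "(\<lambda>v :: real \<times> real. fst (sgn v)) \<in> borel_measurable borel" "(\<lambda>v :: real \<times> real. snd (sgn v)) \<in> borel_measurable borel"
      by (simp_all add: inner_real_prod)
  qed
  have "gram_kernel (\<lambda>f g. sgn f \<bullet> sgn g)" unfolding gram_kernel_def
    by (intro exI[of _ "[\<lambda>v. fst (sgn v), \<lambda>v. snd (sgn v)]"])
       (auto simp: gram_list_def fun_eq_iff inner_real_prod intro: exI[of _ 1] b m)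
  from gram_kernel_mult[OF this this] show ?thesis by (simp add: power2_eq_square)
qed

lemma gram_kernel_sqrt_approx: "gram_kernel (\<lambda>f g. sqrt_approx n ((sgn f \<bullet> sgn g)\<^sup>2))"
proof (induction n)
  case (Suc n)
  have "gram_kernel (\<lambda>f g. (1/2) * ((sgn f \<bullet> sgn g)\<^sup>2 + sqrt_approx n ((sgn f \<bullet> sgn g)\<^sup>2) * sqrt_approx n ((sgn f \<bullet> sgn g)\<^sup>2)))"
    by (intro gram_kernel_mult gram_kernel_const gram_kernel_add gram_kernel_cos2 Suc) auto
  then show ?case by (simp add: power2_eq_square)
qed (use gram_kernel_zero in simp)

lemma sgn_inner_sq_le: "(sgn f \<bullet> sgn (g :: 'a::real_inner))\<^sup>2 \<le> 1"
proof -
  have "\<bar>sgn f \<bullet> sgn g\<bar> \<le> norm (sgn f) * norm (sgn g)" by (rule Cauchy_Schwarz_ineq2)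
  also have "\<dots> \<le> 1" by (simp add: norm_sgn)
  finally show ?thesis by (simp add: abs_square_le_1)
qed

text \<open>
  The sine expressed by the cosine: \<open>sgn f \<bullet> sgn g\<close> is the cosine of the angle between \<open>f\<close> and \<open>g\<close>.
\<close>

lemma abs_wedge_eq: "\<bar>wedge f g\<bar> = norm f * norm g * sqrt (1 - (sgn f \<bullet> sgn g)\<^sup>2)"
proof -
  have "(norm f * norm g * sqrt (1 - (sgn f \<bullet> sgn g)\<^sup>2))\<^sup>2 = (norm f)\<^sup>2 * (norm g)\<^sup>2 * (1 - (sgn f \<bullet> sgn g)\<^sup>2)"
    using sgn_inner_sq_le[of f g] by (simp add: power_mult_distrib)
  also have "\<dots> = (norm f)\<^sup>2 * (norm g)\<^sup>2 - (norm f * norm g * (sgn f \<bullet> sgn g))\<^sup>2" by (simp add: power_mult_distrib algebra_simps)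
  also have "norm f * norm g * (sgn f \<bullet> sgn g) = f \<bullet> g" by (cases "f = 0 \<or> g = 0") (auto simp: sgn_div_norm field_simps)
  finally have "(norm f * norm g * sqrt (1 - (sgn f \<bullet> sgn g)\<^sup>2))\<^sup>2 = \<bar>wedge f g\<bar>\<^sup>2" using lagrange_identity[of f g] by simp
  moreover have "0 \<le> norm f * norm g * sqrt (1 - (sgn f \<bullet> sgn g)\<^sup>2)"
    using sgn_inner_sq_le[of f g] by simp
  ultimately have "norm f * norm g * sqrt (1 - (sgn f \<bullet> sgn g)\<^sup>2) = \<bar>wedge f g\<bar>"
    by (rule power2_eq_imp_eq) simp
  then show ?thesis ..
qed

lemma wedge_energy_approx:
  fixes X :: "'w \<Rightarrow> real \<times> real" and Y :: "'w' \<Rightarrow> real \<times> real"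
  assumes M: "prob_space M" and N: "prob_space N"
    and [measurable]: "X \<in> borel_measurable M" "Y \<in> borel_measurable N"
    and C: "\<And>x. norm (X x) \<le> C" "\<And>x. norm (Y x) \<le> C"
  shows "(\<lambda>n. \<integral>x. (\<integral>y. norm (X x) * norm (Y y) * (1 - sqrt_approx n ((sgn (X x) \<bullet> sgn (Y y))\<^sup>2)) \<partial>N) \<partial>M)
     \<longlonglongrightarrow> (\<integral>x. (\<integral>y. \<bar>wedge (X x) (Y y)\<bar> \<partial>N) \<partial>M)"
proof -
  interpret M: prob_space M by fact
  interpret N: prob_space N by fact
  interpret P: pair_sigma_finite M N ..
  have [measurable]: "(sgn :: real \<times> real \<Rightarrow> _) \<in> borel_measurable borel" unfolding sgn_div_norm by measurable
  have sm [measurable]: "sqrt_approx n \<in> borel_measurable borel" for n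
    by (induction n) auto
  have C0: "0 \<le> C" using C(1) norm_ge_zero order_trans by blast
  define k where "k n x y = norm (X x) * norm (Y y) * (1 - sqrt_approx n ((sgn (X x) \<bullet> sgn (Y y))\<^sup>2))" for n x y
  have kb: "\<bar>k n x y\<bar> \<le> C * C" for n x y
  proof -
    have y: "0 \<le> (sgn (X x) \<bullet> sgn (Y y))\<^sup>2" "(sgn (X x) \<bullet> sgn (Y y))\<^sup>2 \<le> 1" by (auto intro: sgn_inner_sq_le)
    have "0 \<le> sqrt (1 - (sgn (X x) \<bullet> sgn (Y y))\<^sup>2)" using y by simp
    then have "\<bar>1 - sqrt_approx n ((sgn (X x) \<bullet> sgn (Y y))\<^sup>2)\<bar> \<le> 1"
      using sqrt_approx_bounds(1,2)[OF y, of n] unfolding abs_le_iff by linarith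
    then have "\<bar>k n x y\<bar> \<le> (C * C) * 1"
      unfolding k_def abs_mult using C C0 by (intro mult_mono) auto
    then show ?thesis by simp
  qed
  have kl: "(\<lambda>n. k n x y) \<longlonglongrightarrow> \<bar>wedge (X x) (Y y)\<bar>" for x y
  proof -
    have "(\<lambda>n. k n x y) \<longlonglongrightarrow> norm (X x) * norm (Y y) * (1 - (1 - sqrt (1 - (sgn (X x) \<bullet> sgn (Y y))\<^sup>2)))"
      unfolding k_def by (intro tendsto_intros sqrt_approx_tendsto) (auto intro: sgn_inner_sq_le)
    then show ?thesis by (simp add: abs_wedge_eq)
  qed
  have [measurable]: "(\<lambda>(x, y). k n x y) \<in> borel_measurable (M \<Otimes>\<^sub>M N)" for n
    unfolding k_def by measurable
  have km: "k n x \<in> borel_measurable N" if "x \<in> space M" for n x unfolding k_def by measurable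
  have inner: "(\<lambda>n. \<integral>y. k n x y \<partial>N) \<longlonglongrightarrow> (\<integral>y. \<bar>wedge (X x) (Y y)\<bar> \<partial>N)" if "x \<in> space M" for x
    by (rule integral_dominated_convergence[where w = "\<lambda>_. C * C"])
       (use kb kl km[OF that] in auto)
  have "(\<lambda>n. \<integral>x. (\<integral>y. k n x y \<partial>N) \<partial>M) \<longlonglongrightarrow> (\<integral>x. (\<integral>y. \<bar>wedge (X x) (Y y)\<bar> \<partial>N) \<partial>M)"
  proof (rule integral_dominated_convergence[where w = "\<lambda>_. C * C"])
    have "\<bar>\<integral>y. k n x y \<partial>N\<bar> \<le> C * C" for n x
    proof -
      have "\<bar>\<integral>y. k n x y \<partial>N\<bar> \<le> (\<integral>y. C * C \<partial>N)"
        using kb by (intro order_trans[OF integral_abs_bound] integral_mono') auto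
      then show ?thesis by (simp add: N.prob_space)
    qed
    then show "AE x in M. norm (\<integral>y. k n x y \<partial>N) \<le> C * C" for n by simp
    show "AE x in M. (\<lambda>n. \<integral>y. k n x y \<partial>N) \<longlonglongrightarrow> (\<integral>y. \<bar>wedge (X x) (Y y)\<bar> \<partial>N)"
      using inner by (intro AE_I2) auto
  qed auto
  then show ?thesis by (simp add: k_def)
qed

lemma gram_integral:
  fixes X :: "'w \<Rightarrow> real \<times> real" and Y :: "'w' \<Rightarrow> real \<times> real"
  assumes M: "prob_space M" and N: "prob_space N"
    and [measurable]: "X \<in> borel_measurable M" "Y \<in> borel_measurable N"
    and C: "\<And>x. norm (X x) \<le> C" "\<And>x. norm (Y x) \<le> C"
    and as: "\<forall>a\<in>set as. a \<in> borel_measurable borel \<and> (\<exists>C. \<forall>v. \<bar>a v\<bar> \<le> C)"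
  shows "(\<integral>x. (\<integral>y. norm (X x) * norm (Y y) * (1 - gram_list as (X x) (Y y)) \<partial>N) \<partial>M)
    = (\<integral>x. norm (X x) \<partial>M) * (\<integral>y. norm (Y y) \<partial>N)
      - (\<Sum>a\<leftarrow>as. (\<integral>x. norm (X x) * a (X x) \<partial>M) * (\<integral>y. norm (Y y) * a (Y y) \<partial>N))"
proof -
  interpret M: prob_space M by fact
  interpret N: prob_space N by fact
  have C0: "0 \<le> C" using C(1) norm_ge_zero order_trans by blast
  have iX: "integrable M (\<lambda>x. norm (X x) * a (X x))" "integrable N (\<lambda>x. norm (Y x) * a (Y x))"
    if a: "a \<in> borel_measurable borel" "\<forall>v. \<bar>a v\<bar> \<le> D" for a D
  proof -
    have [measurable]: "a \<in> borel_measurable borel" by fact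
    have b: "\<bar>norm v * a v\<bar> \<le> C * D" if "norm v \<le> C" for v
    proof -
      have "\<bar>a v\<bar> \<le> D" using a(2) by blast
      then show ?thesis unfolding abs_mult using that C0 by (intro mult_mono) simp_all
    qed
    show "integrable M (\<lambda>x. norm (X x) * a (X x))" by (rule M.integrable_const_bound[of _ "C * D"]) (use b C in auto)
    show "integrable N (\<lambda>x. norm (Y x) * a (Y x))" by (rule N.integrable_const_bound[of _ "C * D"]) (use b C in auto)
  qed
  have i1: "integrable M (\<lambda>x. norm (X x))" "integrable N (\<lambda>x. norm (Y x))"
    using iX[of "\<lambda>_. 1" 1] by auto
  have inner: "(\<integral>y. norm (X x) * norm (Y y) * (1 - gram_list as (X x) (Y y)) \<partial>N)
     = norm (X x) * (\<integral>y. norm (Y y) \<partial>N) - (\<Sum>a\<leftarrow>as. (norm (X x) * a (X x)) * (\<integral>y. norm (Y y) * a (Y y) \<partial>N))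
     \<and> integrable N (\<lambda>y. norm (X x) * norm (Y y) * (1 - gram_list as (X x) (Y y)))" for x
    using as
  proof (induction as)
    case Nil
    then show ?case using i1 by (simp add: gram_list_def)
  next
    case (Cons a as)
    then obtain D where a: "a \<in> borel_measurable borel" "\<forall>v. \<bar>a v\<bar> \<le> D" by auto
    have eq: "norm (X x) * norm (Y y) * (1 - gram_list (a # as) (X x) (Y y))
       = norm (X x) * norm (Y y) * (1 - gram_list as (X x) (Y y)) - (norm (X x) * a (X x)) * (norm (Y y) * a (Y y))" for y
      by (simp add: gram_list_def algebra_simps)
    show ?case unfolding eq using Cons iX(2)[OF a] by simp
  qed
  have outer: "(\<integral>x. norm (X x) * c - (\<Sum>a\<leftarrow>as. (norm (X x) * a (X x)) * d a) \<partial>M)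
      = (\<integral>x. norm (X x) \<partial>M) * c - (\<Sum>a\<leftarrow>as. (\<integral>x. norm (X x) * a (X x) \<partial>M) * d a)
      \<and> integrable M (\<lambda>x. norm (X x) * c - (\<Sum>a\<leftarrow>as. (norm (X x) * a (X x)) * d a))" for c d
    using as
  proof (induction as)
    case Nil
    then show ?case using i1 by simp
  next
    case (Cons a as)
    then obtain D where a: "a \<in> borel_measurable borel" "\<forall>v. \<bar>a v\<bar> \<le> D" by auto
    have eq: "norm (X x) * c - (\<Sum>a\<leftarrow>a # as. (norm (X x) * a (X x)) * d a)
       = (norm (X x) * c - (\<Sum>a\<leftarrow>as. (norm (X x) * a (X x)) * d a)) - (norm (X x) * a (X x)) * d a" for x
      by simp
    show ?case unfolding eq using Cons iX(1)[OF a] by simp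
  qed
  show ?thesis using inner outer by simp
qed

text \<open>
  The kernel \<open>\<bar>wedge f g\<bar>\<close> is the limit of the kernels \<open>norm f * norm g * (1 - k f g)\<close> with \<open>k\<close> a sum of
  squares. On the difference of the law of \<open>X\<close> and \<open>t\<close> times the law of \<open>Y\<close> the first term vanishes
  by the choice of \<open>t\<close>, and the second one contributes minus a sum of squares.
\<close>

lemma wedge_energy_reverse:
  fixes X :: "'w \<Rightarrow> real \<times> real" and Y :: "'w' \<Rightarrow> real \<times> real"
  assumes M: "prob_space M" and N: "prob_space N"
    and X [measurable]: "X \<in> borel_measurable M" and Y [measurable]: "Y \<in> borel_measurable N"
    and C: "\<And>x. norm (X x) \<le> C" "\<And>x. norm (Y x) \<le> C"
    and t: "(\<integral>x. norm (X x) \<partial>M) = t * (\<integral>y. norm (Y y) \<partial>N)"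
  shows "(\<integral>x. (\<integral>y. \<bar>wedge (X x) (X y)\<bar> \<partial>M) \<partial>M) - 2 * t * (\<integral>x. (\<integral>y. \<bar>wedge (X x) (Y y)\<bar> \<partial>N) \<partial>M)
     + t\<^sup>2 * (\<integral>x. (\<integral>y. \<bar>wedge (Y x) (Y y)\<bar> \<partial>N) \<partial>N) \<le> 0"
proof (rule LIMSEQ_le_const2)
  let ?k = "\<lambda>n f g. norm f * norm g * (1 - sqrt_approx n ((sgn f \<bullet> sgn g)\<^sup>2)) :: real"
  let ?Q = "\<lambda>n. (\<integral>x. (\<integral>y. ?k n (X x) (X y) \<partial>M) \<partial>M) - 2 * t * (\<integral>x. (\<integral>y. ?k n (X x) (Y y) \<partial>N) \<partial>M)
     + t\<^sup>2 * (\<integral>x. (\<integral>y. ?k n (Y x) (Y y) \<partial>N) \<partial>N)"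
  show "?Q \<longlonglongrightarrow> (\<integral>x. (\<integral>y. \<bar>wedge (X x) (X y)\<bar> \<partial>M) \<partial>M) - 2 * t * (\<integral>x. (\<integral>y. \<bar>wedge (X x) (Y y)\<bar> \<partial>N) \<partial>M)
     + t\<^sup>2 * (\<integral>x. (\<integral>y. \<bar>wedge (Y x) (Y y)\<bar> \<partial>N) \<partial>N)"
    by (intro tendsto_add tendsto_diff tendsto_mult_left wedge_energy_approx[where C = C] M N X Y C)
  have "?Q n \<le> 0" for n
  proof -
    obtain as where as: "\<forall>a\<in>set as. a \<in> borel_measurable borel \<and> (\<exists>C. \<forall>v. \<bar>a v\<bar> \<le> C)"
      "(\<lambda>(f :: real \<times> real) g. sqrt_approx n ((sgn f \<bullet> sgn g)\<^sup>2)) = gram_list as"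
      using gram_kernel_sqrt_approx[of n] unfolding gram_kernel_def by blast
    have k: "?k n f g = norm f * norm g * (1 - gram_list as f g)" for f g
      using fun_cong[OF fun_cong[OF as(2)], of f g] by simp
    define A where "A a = (\<integral>x. norm (X x) * a (X x) \<partial>M)" for a
    define B where "B a = (\<integral>x. norm (Y x) * a (Y x) \<partial>N)" for a
    define b where "b = (\<integral>y. norm (Y y) \<partial>N)"
    have "?Q n = ((t * b) * (t * b) - (\<Sum>a\<leftarrow>as. A a * A a)) - 2 * t * ((t * b) * b - (\<Sum>a\<leftarrow>as. A a * B a))
        + t\<^sup>2 * (b * b - (\<Sum>a\<leftarrow>as. B a * B a))"
      unfolding k gram_integral[OF M M X X C(1) C(1) as(1)] gram_integral[OF M N X Y C as(1)]
        gram_integral[OF N N Y Y C(2) C(2) as(1)] t A_def[symmetric] B_def[symmetric] b_def[symmetric] ..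
    also have "\<dots> = - (\<Sum>a\<leftarrow>as. (A a - t * B a)\<^sup>2)"
      by (induction as) (auto simp: power2_eq_square algebra_simps)
    also have "\<dots> \<le> 0"
    proof -
      have "0 \<le> (\<Sum>a\<leftarrow>as. (A a - t * B a)\<^sup>2)" by (intro sum_list_nonneg) auto
      then show ?thesis by simp
    qed
    finally show ?thesis .
  qed
  then show "\<exists>N. \<forall>n\<ge>N. ?Q n \<le> 0" by blast
qed

section \<open>The energy of random supporting functionals\<close>

lemma subgradient_mono:
  fixes q \<sigma> :: "real \<Rightarrow> real"
  assumes sub: "\<And>t t'. q t + \<sigma> t * (t' - t) \<le> q t'" and "t \<le> t'"
  shows "\<sigma> t \<le> \<sigma> t'"
proof (cases "t = t'")
  case False
  then have "t < t'" using assms(2) by simp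
  have "0 \<le> (\<sigma> t' - \<sigma> t) * (t' - t)" using sub[of t t'] sub[of t' t] by (simp add: algebra_simps)
  then show ?thesis using \<open>t < t'\<close> by (simp add: zero_le_mult_iff)
qed simp

text \<open>
  Here \<open>\<sigma>\<close> is any selection of subgradients, so \<open>q\<close> may fail to have the derivative \<open>\<sigma>\<close> at some
  points. The defect \<open>E x y\<close> of the formula is additive and at most \<open>(\<sigma> y - \<sigma> x) * (y - x)\<close>; division of
  the interval into \<open>n\<close> equal parts bounds it by a multiple of \<open>1 / n\<close>.
\<close>

lemma convex_FTC:
  fixes q \<sigma> :: "real \<Rightarrow> real"
  assumes sub: "\<And>t t'. q t + \<sigma> t * (t' - t) \<le> q t'" and cd: "c \<le> d"
  shows "(\<sigma> has_integral (q d - q c)) {c..d}"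
proof -
  have mono: "\<sigma> x \<le> \<sigma> y" if "x \<le> y" for x y using subgradient_mono[OF sub that] .
  have int: "\<sigma> integrable_on {x..y}" for x y
    by (intro integrable_on_lebesgue_on integrable_mono_on) (auto intro!: mono_onI mono)
  define E where "E x y = integral {x..y} \<sigma> - (q y - q x)" for x y
  have E1: "\<bar>E x y\<bar> \<le> (\<sigma> y - \<sigma> x) * (y - x)" if xy: "x \<le> y" for x y
  proof -
    have "integral {x..y} (\<lambda>_. \<sigma> x) \<le> integral {x..y} \<sigma>" "integral {x..y} \<sigma> \<le> integral {x..y} (\<lambda>_. \<sigma> y)"
      by (rule integral_le; auto intro: int mono integrable_const_ivl)+
    moreover have "integral {x..y} (\<lambda>_. k) = k * (y - x)" for k :: real using xy by (simp add: mult.commute)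
    ultimately have "\<sigma> x * (y - x) \<le> integral {x..y} \<sigma>" "integral {x..y} \<sigma> \<le> \<sigma> y * (y - x)" by metis+
    moreover have "\<sigma> x * (y - x) \<le> q y - q x" "q y - q x \<le> \<sigma> y * (y - x)"
      using sub[of x y] sub[of y x] by (auto simp: algebra_simps)
    ultimately show ?thesis unfolding E_def left_diff_distrib abs_le_iff by linarith
  qed
  have En: "\<bar>E c (c + real n * h)\<bar> \<le> (\<sigma> (c + real n * h) - \<sigma> c) * h" if h: "0 \<le> h" for n h
  proof (induction n)
    case 0
    show ?case using E1[of c c] by simp
  next
    case (Suc n)
    let ?x = "c + real n * h" and ?y = "c + real (Suc n) * h"
    have xy: "c \<le> ?x" "?x \<le> ?y" "?y - ?x = h" using h by (auto simp: algebra_simps)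
    have "integral {c..?x} \<sigma> + integral {?x..?y} \<sigma> = integral {c..?y} \<sigma>"
      using xy int by (intro Henstock_Kurzweil_Integration.integral_combine) auto
    then have "E c ?y = E c ?x + E ?x ?y" by (simp add: E_def)
    moreover have "\<bar>E ?x ?y\<bar> \<le> (\<sigma> ?y - \<sigma> ?x) * h" using E1[OF xy(2)] xy(3) by simp
    ultimately have "\<bar>E c ?y\<bar> \<le> (\<sigma> ?x - \<sigma> c) * h + (\<sigma> ?y - \<sigma> ?x) * h" using Suc by linarith
    then show ?case by (simp add: algebra_simps)
  qed
  have "\<bar>E c d\<bar> \<le> (\<sigma> d - \<sigma> c) * (d - c) * (1 / real (Suc n))" for n
  proof -
    have "c + real (Suc n) * ((d - c) / real (Suc n)) = d" by simp
    then show ?thesis using En[of "(d - c) / real (Suc n)" "Suc n"] cd by simp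
  qed
  moreover have "(\<lambda>n. (\<sigma> d - \<sigma> c) * (d - c) * (1 / real (Suc n))) \<longlonglongrightarrow> (\<sigma> d - \<sigma> c) * (d - c) * 0"
    by (rule tendsto_mult[OF tendsto_const LIMSEQ_inverse_real_of_nat[unfolded inverse_eq_divide]])
  ultimately have "\<bar>E c d\<bar> \<le> (\<sigma> d - \<sigma> c) * (d - c) * 0" by (intro LIMSEQ_le_const) auto
  then have "integral {c..d} \<sigma> = q d - q c" by (simp add: E_def)
  then show ?thesis using int[of c d] by (metis integrable_integral)
qed

lemma half_slope_integral:
  fixes q \<sigma> :: "real \<Rightarrow> real"
  assumes sub: "\<And>t t'. q t + \<sigma> t * (t' - t) \<le> q t'" and cont: "continuous_on UNIV q"
    and min: "\<And>t. q c \<le> q t" "q c < 1" and e: "c < e" "1 \<le> q e"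
  shows "(\<integral>\<^sup>+t. ennreal \<bar>\<sigma> t\<bar> * indicator {t. c < t \<and> q t < 1} t \<partial>lborel) = ennreal (1 - q c)"
proof -
  have pos: "0 \<le> \<sigma> t" if "c < t" for t
  proof -
    have "0 \<le> \<sigma> t * (t - c)" using sub[of t c] min(1)[of t] by (simp add: algebra_simps)
    then show ?thesis using that by (simp add: zero_le_mult_iff)
  qed
  have mono: "q x \<le> q y" if "c < x" "x \<le> y" for x y
    using sub[of x y] mult_nonneg_nonneg[OF pos[OF that(1)], of "y - x"] that(2) by simp
  let ?A = "{t. c \<le> t \<and> 1 \<le> q t}"
  have clA: "closed ?A"
  proof -
    have "?A = {c..} \<inter> (q -` {1..})" by auto
    moreover have "closed (q -` {1..})" using cont by (intro continuous_closed_vimage) (auto simp: continuous_on_eq_continuous_at)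
    ultimately show ?thesis by auto
  qed
  define b where "b = Inf ?A"
  have bd: "bdd_below ?A" by (intro bdd_belowI[of _ c]) auto
  have eA: "e \<in> ?A" using e by auto
  have bA: "b \<in> ?A" unfolding b_def using eA bd clA by (intro closed_contains_Inf) auto
  have cb: "c < b" using bA min(2) by (metis (lifting) mem_Collect_eq order_le_less not_less)
  have below: "q t < 1" if "c \<le> t" "t < b" for t
  proof (rule ccontr)
    assume "\<not> q t < 1"
    then have "b \<le> t" unfolding b_def using that bd by (intro cInf_lower) auto
    then show False using that by simp
  qed
  have above: "1 \<le> q t" if "b \<le> t" for t using mono[OF cb that] bA by auto
  have qb: "q b = 1"
  proof (rule antisym)
    have "(q \<longlongrightarrow> q b) (at_left b)" using cont by (auto simp: continuous_on_def intro: tendsto_within_subset)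
    moreover have "\<forall>\<^sub>F t in at_left b. q t \<le> 1"
      using below cb by (auto simp: eventually_at_left_field intro!: exI[of _ c] less_imp_le)
    ultimately show "q b \<le> 1" by (intro tendsto_upperbound) auto
  qed (use above in auto)
  have "((\<lambda>t. \<bar>\<sigma> t\<bar>) has_integral (q b - q c)) {c..b}"
    by (rule has_integral_spike_finite[of "{c}"]) (use convex_FTC[OF sub, of c b] cb pos in auto)
  then have "(\<integral>\<^sup>+t. indicator {c..b} t * \<bar>\<sigma> t\<bar> \<partial>lborel) = ennreal (q b - q c)"
    by (intro nn_integral_has_integral_lebesgue) auto
  also have "(\<integral>\<^sup>+t. indicator {c..b} t * \<bar>\<sigma> t\<bar> \<partial>lborel) = (\<integral>\<^sup>+t. ennreal \<bar>\<sigma> t\<bar> * indicator {t. c < t \<and> q t < 1} t \<partial>lborel)"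
  proof (intro nn_integral_cong_AE AE_I[of _ _ "{c, b}"])
    have "indicator {c..b} t * ennreal \<bar>\<sigma> t\<bar> = ennreal \<bar>\<sigma> t\<bar> * indicator {t. c < t \<and> q t < 1} t" if "t \<notin> {c, b}" for t
      using that below[of t] above[of t] by (auto simp: indicator_def)
    then show "{t \<in> space lborel. ennreal (indicator {c..b} t * \<bar>\<sigma> t\<bar>) \<noteq> ennreal \<bar>\<sigma> t\<bar> * indicator {t. c < t \<and> q t < 1} t} \<subseteq> {c, b}"
      by (auto simp: ennreal_mult ennreal_indicator)
  qed (auto simp: finite_imp_null_set_lborel null_setsD1)
  finally show ?thesis using qb by simp
qed

text \<open>
  On the interval where \<open>q < 1\<close> the function descends from one to its minimum and rises to one again;
  the integral is its total variation. If the minimum is at least one, both sides vanish, because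
  \<^const>\<open>ennreal\<close> truncates negative numbers.
\<close>

lemma slope_integral:
  fixes q \<sigma> :: "real \<Rightarrow> real"
  assumes sub: "\<And>t t'. q t + \<sigma> t * (t' - t) \<le> q t'" and cont: "continuous_on UNIV q"
    and m [measurable]: "\<sigma> \<in> borel_measurable borel"
    and min: "\<And>t. q c \<le> q t" and e: "c < e" "1 \<le> q e" "e' < c" "1 \<le> q e'"
  shows "(\<integral>\<^sup>+t. ennreal \<bar>\<sigma> t\<bar> * indicator {t. q t < 1} t \<partial>lborel) = ennreal (2 * (1 - q c))"
proof (cases "q c < 1")
  case True
  have [measurable]: "q \<in> borel_measurable borel" using cont by (rule borel_measurable_continuous_onI)
  let ?I = "\<lambda>A. \<integral>\<^sup>+t. ennreal \<bar>\<sigma> t\<bar> * indicator A t \<partial>lborel"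
  have r: "?I {t. c < t \<and> q t < 1} = ennreal (1 - q c)"
    by (rule half_slope_integral[OF sub cont min True e(1,2)])
  have "(\<integral>\<^sup>+t. ennreal \<bar>- \<sigma> (- t)\<bar> * indicator {t. - c < t \<and> q (- t) < 1} t \<partial>lborel) = ennreal (1 - q (- (- c)))"
  proof (rule half_slope_integral[where e = "- e'" and q = "\<lambda>t. q (- t)"])
    show "q (- t) + - \<sigma> (- t) * (t' - t) \<le> q (- t')" for t t' using sub[of "- t" "- t'"] by (simp add: algebra_simps)
    show "continuous_on UNIV (\<lambda>t. q (- t))"
      by (rule continuous_on_compose2[OF cont]) (auto intro!: continuous_intros)
  qed (use min True e in auto)
  moreover have "?I {t. t < c \<and> q t < 1} = (\<integral>\<^sup>+t. ennreal \<bar>- \<sigma> (- t)\<bar> * indicator {t. - c < t \<and> q (- t) < 1} t \<partial>lborel)"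
    by (subst nn_integral_real_affine[where c = "-1" and t = 0])
       (auto intro!: nn_integral_cong simp: indicator_def)
  ultimately have l: "?I {t. t < c \<and> q t < 1} = ennreal (1 - q c)" by simp
  have "?I {t. q t < 1} = (\<integral>\<^sup>+t. ennreal \<bar>\<sigma> t\<bar> * indicator {t. c < t \<and> q t < 1} t + ennreal \<bar>\<sigma> t\<bar> * indicator {t. t < c \<and> q t < 1} t \<partial>lborel)"
    by (intro nn_integral_cong_AE AE_I[of _ _ "{c}"]) (auto simp: indicator_def split: if_splits)
  also have "\<dots> = ?I {t. c < t \<and> q t < 1} + ?I {t. t < c \<and> q t < 1}"
    by (intro nn_integral_add) measurable
  also have "\<dots> = ennreal (2 * (1 - q c))" unfolding r l using True by (simp flip: ennreal_plus)
  finally show ?thesis .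
next
  case False
  then have "1 \<le> q t" for t using min[of t] by simp
  then have "\<not> q t < 1" "2 * (1 - q t) \<le> 0" for t by (simp_all add: not_less)
  then show ?thesis by (simp add: ennreal_neg)
qed

text \<open>
  If the first component of \<open>a\<close> is not zero, the map is a product of two rank-one perturbations of
  the identity; otherwise a shear brings it into this form.
\<close>

lemma emeasure_linear2_vimage:
  fixes a b :: "real \<times> real"
  assumes D: "wedge a b \<noteq> 0" and S: "S \<in> sets borel"
  shows "emeasure lborel ((\<lambda>p. fst p *\<^sub>R a + snd p *\<^sub>R b) -` S) = ennreal (1 / \<bar>wedge a b\<bar>) * emeasure lborel S"
proof -
  have nz: "emeasure lborel ((\<lambda>p. fst p *\<^sub>R a + snd p *\<^sub>R b) -` S) = ennreal (1 / \<bar>wedge a b\<bar>) * emeasure lborel S"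
    if D: "wedge a b \<noteq> 0" and a: "fst a \<noteq> 0" for a b
  proof -
    define w where "w = (fst b / fst a, wedge a b / fst a)"
    let ?S1 = "\<lambda>p. p + ((1, 0) \<bullet> p) *\<^sub>R (a - (1, 0)) :: real \<times> real"
    let ?S2 = "\<lambda>p. p + ((0, 1) \<bullet> p) *\<^sub>R (w - (0, 1)) :: real \<times> real"
    have k: "1 + (1, 0) \<bullet> (a - (1, 0)) = fst a" "1 + (0, 1) \<bullet> (w - (0, 1)) = wedge a b / fst a"
      by (auto simp: inner_real_prod w_def)
    have "?S1 (?S2 p) = fst p *\<^sub>R a + snd p *\<^sub>R b" for p
      using a by (auto simp: prod_eq_iff inner_real_prod w_def wedge_def field_simps)
    then have eq: "(\<lambda>p. fst p *\<^sub>R a + snd p *\<^sub>R b) -` S = ?S2 -` (?S1 -` S)" by (auto simp: vimage_def)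
    have "linear ?S1" by (intro linearI) (auto simp: inner_add_right algebra_simps)
    then have "?S1 -` S \<in> sets borel" using S by (rule linear_vimage_borel)
    then have "emeasure lborel (?S2 -` (?S1 -` S)) = ennreal (1 / \<bar>wedge a b / fst a\<bar>) * emeasure lborel (?S1 -` S)"
      using emeasure_shear_vimage[of "(0, 1)" "w - (0, 1)" "?S1 -` S"] a D unfolding k by simp
    also have "emeasure lborel (?S1 -` S) = ennreal (1 / \<bar>fst a\<bar>) * emeasure lborel S"
      using emeasure_shear_vimage[of "(1, 0)" "a - (1, 0)" S] a S unfolding k by simp
    also have "ennreal (1 / \<bar>wedge a b / fst a\<bar>) * (ennreal (1 / \<bar>fst a\<bar>) * emeasure lborel S) = ennreal (1 / \<bar>wedge a b\<bar>) * emeasure lborel S"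
      using a by (simp add: mult.assoc[symmetric] abs_divide flip: ennreal_mult)
    finally show ?thesis unfolding eq .
  qed
  show ?thesis
  proof (cases "fst a = 0")
    case True
    let ?U = "\<lambda>p. p + ((1, 0) \<bullet> p) *\<^sub>R (0, 1) :: real \<times> real"
    have b: "fst (a + b) \<noteq> 0" "wedge (a + b) b = wedge a b" using D True by (auto simp: wedge_def algebra_simps)
    have "(\<lambda>p. fst p *\<^sub>R (a + b) + snd p *\<^sub>R b) -` S = ?U -` ((\<lambda>p. fst p *\<^sub>R a + snd p *\<^sub>R b) -` S)"
      by (auto simp: vimage_def inner_real_prod algebra_simps)
    moreover have "(\<lambda>p. fst p *\<^sub>R a + snd p *\<^sub>R b) -` S \<in> sets borel"
      using S by (intro linear_vimage_borel) (auto intro!: linearI simp: algebra_simps)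
    ultimately have "emeasure lborel ((\<lambda>p. fst p *\<^sub>R (a + b) + snd p *\<^sub>R b) -` S) = emeasure lborel ((\<lambda>p. fst p *\<^sub>R a + snd p *\<^sub>R b) -` S)"
      using emeasure_shear_vimage[of "(1, 0)" "(0, 1)" "(\<lambda>p. fst p *\<^sub>R a + snd p *\<^sub>R b) -` S"] by (simp add: inner_real_prod)
    then show ?thesis using nz[of "a + b" b] b D by simp
  qed (rule nz[OF D])
qed

lemma nn_integral_linear2:
  fixes F :: "real \<times> real \<Rightarrow> ennreal"
  assumes D: "wedge a b = 1" and F [measurable]: "F \<in> borel_measurable borel"
  shows "(\<integral>\<^sup>+p. F p \<partial>lborel) = (\<integral>\<^sup>+s. (\<integral>\<^sup>+t. F (s *\<^sub>R a + t *\<^sub>R b) \<partial>lborel) \<partial>lborel)"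
proof -
  let ?T = "\<lambda>p. fst p *\<^sub>R a + snd p *\<^sub>R b"
  have "linear ?T" by (intro linearI) (auto simp: algebra_simps)
  then have T [measurable]: "?T \<in> borel_measurable borel"
    using linear_continuous_on[of ?T UNIV] by (intro borel_measurable_continuous_onI) (simp add: linear_conv_bounded_linear)
  have "distr lborel borel ?T = (lborel :: (real \<times> real) measure)"
    using emeasure_linear2_vimage[of a b] D by (intro measure_eqI) (auto simp: emeasure_distr)
  then have "(\<integral>\<^sup>+p. F p \<partial>lborel) = (\<integral>\<^sup>+p. F p \<partial>distr lborel borel ?T)" by simp
  also have "\<dots> = (\<integral>\<^sup>+p. F (?T p) \<partial>lborel)" by (rule nn_integral_distr) auto
  also have "\<dots> = (\<integral>\<^sup>+p. F (?T p) \<partial>(lborel \<Otimes>\<^sub>M lborel))" by (simp add: lborel_prod)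
  also have "\<dots> = (\<integral>\<^sup>+s. (\<integral>\<^sup>+t. F (?T (s, t)) \<partial>lborel) \<partial>lborel)"
    by (rule lborel.nn_integral_fst[symmetric]) (simp add: lborel_prod)
  finally show ?thesis by simp
qed

lemma nn_integral_tent: "(\<integral>\<^sup>+s. ennreal (2 * (1 - \<bar>s\<bar>)) \<partial>lborel) = 2"
proof -
  have h: "(\<integral>\<^sup>+s. ennreal (2 * (1 - s)) * indicator {0..1} s \<partial>lborel) = 1"
  proof -
    have "(\<integral>\<^sup>+s. ennreal (2 * (1 - s)) * indicator {0..1} s \<partial>lborel) = ennreal ((2 * 1 - 1\<^sup>2) - (2 * 0 - 0\<^sup>2))"
      by (rule nn_integral_FTC_Icc[where F = "\<lambda>s. 2 * s - s\<^sup>2"]) (auto intro!: derivative_eq_intros)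
    then show ?thesis by simp
  qed
  have h': "(\<integral>\<^sup>+s. ennreal (2 * (1 + s)) * indicator {-1..0} s \<partial>lborel) = 1"
  proof -
    have "(\<integral>\<^sup>+s. ennreal (2 * (1 + s)) * indicator {-1..0} s \<partial>lborel) = (\<integral>\<^sup>+s. ennreal (2 * (1 - s)) * indicator {0..1} s \<partial>lborel)"
      by (subst nn_integral_real_affine[where c = "-1" and t = 0]) (auto intro!: nn_integral_cong simp: indicator_def)
    then show ?thesis unfolding h .
  qed
  have "(\<integral>\<^sup>+s. ennreal (2 * (1 - \<bar>s\<bar>)) \<partial>lborel)
      = (\<integral>\<^sup>+s. ennreal (2 * (1 - s)) * indicator {0..1} s + ennreal (2 * (1 + s)) * indicator {-1..0} s \<partial>lborel)"
    by (intro nn_integral_cong_AE AE_I[of _ _ "{0}"]) (auto simp: indicator_def ennreal_eq_0_iff split: if_splits)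
  also have "\<dots> = (\<integral>\<^sup>+s. ennreal (2 * (1 - s)) * indicator {0..1} s \<partial>lborel) + (\<integral>\<^sup>+s. ennreal (2 * (1 + s)) * indicator {-1..0} s \<partial>lborel)"
    by (intro nn_integral_add) measurable
  also have "\<dots> = 1 + 1" unfolding h h' ..
  finally show ?thesis by simp
qed

text \<open>
  Slice the ball by the lines \<open>g = s\<close>. On such a line \<open>wedge (f x) g\<close> is, up to sign, the slope of the
  norm, and the minimum of the norm on the line is at least \<open>\<bar>s\<bar>\<close>, with equality if \<open>g\<close> attains its norm. So the
  slice contributes at most \<open>2 * (1 - \<bar>s\<bar>)\<close>, and the integral of this over \<open>s\<close> is \<open>2\<close>.
\<close>

lemma slope_integral_ball:
  fixes \<phi> :: "real \<times> real \<Rightarrow> 'a::real_normed_vector" and f :: "real \<times> real \<Rightarrow> real \<times> real"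
  assumes \<phi>: "linear_param \<phi>" and f [measurable]: "f \<in> borel_measurable borel"
    and sup: "\<And>x y. f x \<bullet> y \<le> norm (\<phi> y)" "\<And>x. f x \<bullet> x = norm (\<phi> x)"
    and g: "\<And>y. g \<bullet> y \<le> norm (\<phi> y)"
  shows "(\<integral>\<^sup>+x. ennreal \<bar>wedge (f x) g\<bar> * indicator (param_ball \<phi>) x \<partial>lborel) \<le> 2"
    and "x0 \<noteq> 0 \<Longrightarrow> g \<bullet> x0 = norm (\<phi> x0) \<Longrightarrow> (\<integral>\<^sup>+x. ennreal \<bar>wedge (f x) g\<bar> * indicator (param_ball \<phi>) x \<partial>lborel) = 2"
proof -
  interpret linear_param \<phi> by fact
  let ?J = "\<integral>\<^sup>+x. ennreal \<bar>wedge (f x) g\<bar> * indicator (param_ball \<phi>) x \<partial>lborel"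
  define v where "v = (- snd g, fst g)"
  have wv: "\<bar>wedge h g\<bar> = \<bar>h \<bullet> v\<bar>" for h by (simp add: wedge_def v_def inner_real_prod abs_if algebra_simps)
  have nz: "\<phi> y \<noteq> 0" if "y \<noteq> 0" for y using that injD[OF inj, of y 0] by (auto simp: hom)
  have gabs: "\<bar>g \<bullet> y\<bar> \<le> norm (\<phi> y)" for y
    using g[of y] g[of "- y"] by (simp add: hom abs_le_iff)
  have main: "\<exists>\<mu>. (\<forall>s. \<bar>s\<bar> \<le> \<mu> s) \<and> (\<forall>s. \<mu> s \<le> norm (\<phi> (s *\<^sub>R x1))) \<and> ?J = (\<integral>\<^sup>+s. ennreal (2 * (1 - \<mu> s)) \<partial>lborel)"
    if x1: "g \<bullet> x1 = 1" for x1
  proof -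
    have "g \<noteq> 0" using x1 by auto
    then have v0: "v \<noteq> 0" by (auto simp: v_def prod_eq_iff)
    have gv: "g \<bullet> v = 0" by (simp add: v_def inner_real_prod)
    define q where "q s t = norm (\<phi> (s *\<^sub>R x1 + t *\<^sub>R v))" for s t
    define \<sigma> where "\<sigma> s t = f (s *\<^sub>R x1 + t *\<^sub>R v) \<bullet> v" for s t
    have qcont: "continuous_on UNIV (q s)" for s unfolding q_def
      by (intro continuous_intros continuous_on_compose2[OF cont[of UNIV]]) auto
    have lower: "\<bar>s\<bar> \<le> q s t" for s t
      using gabs[of "s *\<^sub>R x1 + t *\<^sub>R v"] by (simp add: q_def inner_add_right x1 gv)
    have nv: "norm (\<phi> v) > 0"
      by (simp add: nz[OF v0])
    have coer: "\<bar>t\<bar> * norm (\<phi> v) - norm (\<phi> (s *\<^sub>R x1)) \<le> q s t" for s t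
      using norm_triangle_ineq4[of "\<phi> (s *\<^sub>R x1 + t *\<^sub>R v)" "\<phi> (s *\<^sub>R x1)"] by (simp add: q_def hom)
    have "\<exists>c. (\<forall>t. q s c \<le> q s t) \<and> (\<integral>\<^sup>+t. ennreal \<bar>\<sigma> s t\<bar> * indicator {t. q s t < 1} t \<partial>lborel) = ennreal (2 * (1 - q s c))" for s
    proof -
      define R where "R = (norm (\<phi> (s *\<^sub>R x1)) + max 1 (q s 0)) / norm (\<phi> v)"
      have R0: "R \<ge> 0" using nv unfolding R_def by (intro divide_nonneg_pos add_nonneg_nonneg) auto
      have big: "max 1 (q s 0) \<le> q s t" if "R \<le> \<bar>t\<bar>" for t
      proof -
        have "R * norm (\<phi> v) \<le> \<bar>t\<bar> * norm (\<phi> v)" using that nv by (intro mult_right_mono) auto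
        moreover have "R * norm (\<phi> v) = norm (\<phi> (s *\<^sub>R x1)) + max 1 (q s 0)" using nv by (simp add: R_def)
        ultimately show ?thesis using coer[of t s] by linarith
      qed
      obtain c where c: "c \<in> {-R..R}" "\<And>t. t \<in> {-R..R} \<Longrightarrow> q s c \<le> q s t"
        using continuous_attains_inf[of "{-R..R}" "q s"] R0 continuous_on_subset[OF qcont[of s]] by auto
      have cmin: "q s c \<le> q s t" for t
      proof (cases "t \<in> {-R..R}")
        case False
        then have "q s 0 \<le> q s t" using big[of t] by auto
        moreover have "q s c \<le> q s 0" using R0 by (intro c) auto
        ultimately show ?thesis by simp
      qed (rule c(2))
      have "(\<integral>\<^sup>+t. ennreal \<bar>\<sigma> s t\<bar> * indicator {t. q s t < 1} t \<partial>lborel) = ennreal (2 * (1 - q s c))"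
      proof (rule slope_integral[where e = "\<bar>c\<bar> + R + 1" and e' = "- \<bar>c\<bar> - R - 1"])
        show "q s t + \<sigma> s t * (t' - t) \<le> q s t'" for t t'
        proof -
          have "s *\<^sub>R x1 + t' *\<^sub>R v = (s *\<^sub>R x1 + t *\<^sub>R v) + (t' - t) *\<^sub>R v" by (simp add: algebra_simps)
          then show ?thesis
            using sup(1)[of "s *\<^sub>R x1 + t *\<^sub>R v" "s *\<^sub>R x1 + t' *\<^sub>R v"] sup(2)[of "s *\<^sub>R x1 + t *\<^sub>R v"]
            by (simp add: q_def \<sigma>_def inner_add_right mult.commute)
        qed
        show "continuous_on UNIV (q s)" by (rule qcont)
        show "\<sigma> s \<in> borel_measurable borel" unfolding \<sigma>_def by measurable
        show "1 \<le> q s (\<bar>c\<bar> + R + 1)" "1 \<le> q s (- \<bar>c\<bar> - R - 1)"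
          using big[of "\<bar>c\<bar> + R + 1"] big[of "- \<bar>c\<bar> - R - 1"] R0 by auto
      qed (use cmin R0 in auto)
      then show ?thesis using cmin by blast
    qed
    then obtain c where c: "\<And>s t. q s (c s) \<le> q s t"
      "\<And>s. (\<integral>\<^sup>+t. ennreal \<bar>\<sigma> s t\<bar> * indicator {t. q s t < 1} t \<partial>lborel) = ennreal (2 * (1 - q s (c s)))"
      by metis
    have w1: "wedge x1 v = 1" using x1 by (simp add: wedge_def v_def inner_real_prod algebra_simps)
    have "?J = (\<integral>\<^sup>+s. (\<integral>\<^sup>+t. ennreal \<bar>wedge (f (s *\<^sub>R x1 + t *\<^sub>R v)) g\<bar> * indicator (param_ball \<phi>) (s *\<^sub>R x1 + t *\<^sub>R v) \<partial>lborel) \<partial>lborel)"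
      by (rule nn_integral_linear2[OF w1]) measurable
    also have "\<dots> = (\<integral>\<^sup>+s. (\<integral>\<^sup>+t. ennreal \<bar>\<sigma> s t\<bar> * indicator {t. q s t < 1} t \<partial>lborel) \<partial>lborel)"
      by (intro nn_integral_cong) (auto simp: wv \<sigma>_def q_def param_ball_def indicator_def)
    finally have "?J = (\<integral>\<^sup>+s. ennreal (2 * (1 - q s (c s))) \<partial>lborel)" unfolding c(2) .
    moreover have "q s (c s) \<le> norm (\<phi> (s *\<^sub>R x1))" for s using c(1)[of s 0] by (simp add: q_def)
    ultimately show ?thesis using lower by (intro exI[of _ "\<lambda>s. q s (c s)"]) auto
  qed
  show "?J \<le> 2"
  proof (cases "g = 0")
    case False
    then have "g \<bullet> ((1 / (g \<bullet> g)) *\<^sub>R g) = 1" by simp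
    from main[OF this] obtain \<mu> where \<mu>: "\<And>s. \<bar>s\<bar> \<le> \<mu> s" "?J = (\<integral>\<^sup>+s. ennreal (2 * (1 - \<mu> s)) \<partial>lborel)" by blast
    have "?J \<le> (\<integral>\<^sup>+s. ennreal (2 * (1 - \<bar>s\<bar>)) \<partial>lborel)"
      unfolding \<mu>(2) using \<mu>(1) by (intro nn_integral_mono ennreal_leI) auto
    then show ?thesis unfolding nn_integral_tent .
  qed (simp add: wedge_def)
  show "?J = 2" if x0: "x0 \<noteq> 0" "g \<bullet> x0 = norm (\<phi> x0)"
  proof -
    have n0: "norm (\<phi> x0) > 0" by (simp add: nz[OF x0(1)])
    define x1 where "x1 = (1 / norm (\<phi> x0)) *\<^sub>R x0"
    have x1: "g \<bullet> x1 = 1" "norm (\<phi> (s *\<^sub>R x1)) = \<bar>s\<bar>" for s using n0 x0 by (auto simp: x1_def hom)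
    from main[OF x1(1)] obtain \<mu> where \<mu>: "\<And>s. \<bar>s\<bar> \<le> \<mu> s" "\<And>s. \<mu> s \<le> norm (\<phi> (s *\<^sub>R x1))"
      "?J = (\<integral>\<^sup>+s. ennreal (2 * (1 - \<mu> s)) \<partial>lborel)" by blast
    have "\<mu> s = \<bar>s\<bar>" for s using \<mu>(1)[of s] \<mu>(2)[of s] x1(2)[of s] by simp
    then show ?thesis unfolding \<mu>(3) using nn_integral_tent by simp
  qed
qed

lemma dual_norm_bound:
  fixes \<phi> :: "'e::euclidean_space \<Rightarrow> 'a::real_normed_vector"
  assumes "linear \<phi>"
  obtains C where "\<And>g. (\<And>y. g \<bullet> y \<le> norm (\<phi> y)) \<Longrightarrow> norm g \<le> C"
proof -
  obtain B where B: "B > 0" "\<And>x. norm (\<phi> x) \<le> B * norm x" using linear_bounded_pos[OF assms] by blast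
  have "norm g \<le> B" if g: "\<And>y. g \<bullet> y \<le> norm (\<phi> y)" for g :: 'e
  proof (cases "g = 0")
    case False
    have "norm g * norm g \<le> B * norm g"
      using order_trans[OF g[of g] B(2)[of g]] by (simp add: power2_norm_eq_inner[symmetric] power2_eq_square)
    then show ?thesis using False by simp
  qed (use B in simp)
  then show thesis by (rule that)
qed

lemma integral_uniform_wedge:
  fixes \<phi> :: "real \<times> real \<Rightarrow> 'a::real_normed_vector" and f :: "real \<times> real \<Rightarrow> real \<times> real"
  assumes \<phi>: "linear_param \<phi>" and f [measurable]: "f \<in> borel_measurable borel"
    and sup: "\<And>x y. f x \<bullet> y \<le> norm (\<phi> y)" "\<And>x. f x \<bullet> x = norm (\<phi> x)"
    and g: "\<And>y. g \<bullet> y \<le> norm (\<phi> y)"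
  defines "N \<equiv> uniform_measure lborel (param_ball \<phi>)" and "\<kappa> \<equiv> measure lborel (param_ball \<phi>)"
  shows "(\<integral>y. \<bar>wedge g (f y)\<bar> \<partial>N) \<le> 2 / \<kappa>"
    and "x0 \<noteq> 0 \<Longrightarrow> g \<bullet> x0 = norm (\<phi> x0) \<Longrightarrow> (\<integral>y. \<bar>wedge g (f y)\<bar> \<partial>N) = 2 / \<kappa>"
proof -
  interpret linear_param \<phi> by fact
  let ?J = "\<integral>\<^sup>+x. ennreal \<bar>wedge (f x) g\<bar> * indicator (param_ball \<phi>) x \<partial>lborel"
  have k: "\<kappa> > 0" unfolding \<kappa>_def by (rule measure_param_ball_pos)
  have sw: "\<bar>wedge g h\<bar> = \<bar>wedge h g\<bar>" for h by (simp add: wedge_def abs_minus_commute mult.commute)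
  have eq: "(\<integral>y. \<bar>wedge g (f y)\<bar> \<partial>N) = enn2real (?J / ennreal \<kappa>)"
  proof -
    have "(\<integral>y. \<bar>wedge g (f y)\<bar> \<partial>N) = enn2real (\<integral>\<^sup>+y. ennreal \<bar>wedge (f y) g\<bar> \<partial>N)"
      unfolding sw by (intro integral_eq_nn_integral) (auto simp: N_def)
    also have "(\<integral>\<^sup>+y. ennreal \<bar>wedge (f y) g\<bar> \<partial>N) = ?J / emeasure lborel (param_ball \<phi>)"
      unfolding N_def by (intro nn_integral_uniform_measure) auto
    finally show ?thesis unfolding emeasure_param_ball \<kappa>_def .
  qed
  have two: "enn2real (2 / ennreal \<kappa>) = 2 / \<kappa>"
    using k by (metis divide_ennreal enn2real_ennreal ennreal_numeral divide_nonneg_pos zero_le_numeral)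
  have fin: "2 / ennreal \<kappa> < \<top>"
    using k by (metis divide_ennreal ennreal_less_top ennreal_numeral zero_le_numeral)
  have "?J / ennreal \<kappa> \<le> 2 / ennreal \<kappa>"
    by (intro divide_right_mono_ennreal slope_integral_ball(1)[OF \<phi> f sup g])
  then show "(\<integral>y. \<bar>wedge g (f y)\<bar> \<partial>N) \<le> 2 / \<kappa>"
    unfolding eq two[symmetric] using fin by (intro enn2real_mono) auto
  show "(\<integral>y. \<bar>wedge g (f y)\<bar> \<partial>N) = 2 / \<kappa>" if "x0 \<noteq> 0" "g \<bullet> x0 = norm (\<phi> x0)"
    unfolding eq slope_integral_ball(2)[OF \<phi> f sup g that] by (rule two)
qed

lemma prob_space_uniform_param_ball:
  "linear_param \<phi> \<Longrightarrow> prob_space (uniform_measure lborel (param_ball \<phi>))"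
  using linear_param.emeasure_param_ball[of \<phi>] linear_param.measure_param_ball_pos[of \<phi>]
  by (intro prob_space_uniform_measure) auto

text \<open>
  Each supporting functional attains its norm, so that for almost every \<open>x\<close> the inner integral has
  its extremal value.
\<close>

lemma wedge_energy_support_eq:
  fixes \<phi> :: "real \<times> real \<Rightarrow> 'a::real_normed_vector" and f :: "real \<times> real \<Rightarrow> real \<times> real"
  assumes \<phi>: "linear_param \<phi>" and f [measurable]: "f \<in> borel_measurable borel"
    and sup: "\<And>x y. f x \<bullet> y \<le> norm (\<phi> y)" "\<And>x. f x \<bullet> x = norm (\<phi> x)"
  defines "N \<equiv> uniform_measure lborel (param_ball \<phi>)"
  shows "(\<integral>x. (\<integral>y. \<bar>wedge (f x) (f y)\<bar> \<partial>N) \<partial>N) = 2 / measure lborel (param_ball \<phi>)"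
proof -
  interpret linear_param \<phi> by fact
  interpret N: prob_space N unfolding N_def by (rule prob_space_uniform_param_ball[OF \<phi>])
  interpret P: pair_sigma_finite N N ..
  have [measurable_cong]: "sets N = sets borel" by (simp add: N_def)
  have "AE x in lborel. x \<in> param_ball \<phi> \<longrightarrow> x \<noteq> 0"
    by (rule AE_I[of _ _ "{0}"]) auto
  then have "AE x in N. x \<noteq> 0" unfolding N_def by (intro AE_uniform_measureI) auto
  then have "AE x in N. (\<integral>y. \<bar>wedge (f x) (f y)\<bar> \<partial>N) = 2 / measure lborel (param_ball \<phi>)"
  proof eventually_elim
    case (elim x)
    show ?case unfolding N_def
      by (rule integral_uniform_wedge(2)[OF \<phi> f sup sup(1) elim sup(2)])
  qed
  then have "(\<integral>x. (\<integral>y. \<bar>wedge (f x) (f y)\<bar> \<partial>N) \<partial>N) = (\<integral>x. 2 / measure lborel (param_ball \<phi>) \<partial>N)"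
    by (intro integral_cong_AE) auto
  then show ?thesis by (simp add: N.prob_space)
qed

text \<open>
  Compare the law of \<open>X\<close> with the law of supporting functionals at random points of the unit ball.
  With \<open>k\<close> the bound to be proved, the mixed energy is at most \<open>k\<close> and the energy of the second law
  is \<open>k\<close>, so the reversed Cauchy-Schwarz inequality bounds the energy of \<open>X\<close> by
  \<open>(2 * t - t\<^sup>2) * k\<close>.
\<close>

lemma wedge_energy_le:
  fixes \<phi> :: "real \<times> real \<Rightarrow> 'a::real_normed_vector" and X :: "'w \<Rightarrow> real \<times> real"
  assumes \<phi>: "linear_param \<phi>" and M: "prob_space M" and X [measurable]: "X \<in> borel_measurable M"
    and adm: "\<And>w y. X w \<bullet> y \<le> norm (\<phi> y)"
  shows "(\<integral>x. (\<integral>y. \<bar>wedge (X x) (X y)\<bar> \<partial>M) \<partial>M) \<le> 2 / measure lborel (param_ball \<phi>)"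
proof -
  interpret linear_param \<phi> by fact
  interpret M: prob_space M by fact
  define q where "q y = norm (\<phi> y)" for y
  have q: "sublinear q" unfolding sublinear_def q_def by (auto simp: hom norm_triangle_ineq)
  obtain ys :: "(real \<times> real) list" where ys: "set ys = Basis" using finite_list[OF finite_Basis] by blast
  define F where "F = support_functional q ys"
  have Fl: "linear (F x)" for x unfolding F_def by (rule linear_support_functional[OF q]) (simp add: ys)
  have qc: "(\<lambda>c. q (t *\<^sub>R c + y)) \<in> borel_measurable borel" for t y
    unfolding q_def by (intro borel_measurable_continuous_onI continuous_intros continuous_on_compose2[OF cont[of UNIV]]) auto
  have Fm: "(\<lambda>x. F x y) \<in> borel_measurable borel" for y
    unfolding F_def by (rule measurable_support_functional[OF q, where g = "\<lambda>c. c"]) (rule qc)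
  define Y where "Y x = (F x (1, 0), F x (0, 1))" for x
  have Yi: "Y x \<bullet> y = F x y" for x y
  proof -
    have "F x y = F x (fst y *\<^sub>R (1, 0) + snd y *\<^sub>R (0, 1))" by simp
    also have "\<dots> = fst y * F x (1, 0) + snd y * F x (0, 1)"
      unfolding linear_add[OF Fl] linear_scale[OF Fl] by simp
    finally show ?thesis by (simp add: Y_def inner_real_prod mult.commute)
  qed
  have Ym [measurable]: "Y \<in> borel_measurable borel" unfolding Y_def using Fm by measurable
  have sup: "Y x \<bullet> y \<le> norm (\<phi> y)" "Y x \<bullet> x = norm (\<phi> x)" for x y
    unfolding Yi F_def using support_functional_le[OF q] support_functional_self[OF q] by (auto simp: q_def)
  define N where "N = uniform_measure lborel (param_ball \<phi>)"
  interpret N: prob_space N unfolding N_def by (rule prob_space_uniform_param_ball[OF \<phi>])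
  have [measurable_cong]: "sets N = sets borel" by (simp add: N_def)
  obtain C where C: "\<And>g. (\<And>y. g \<bullet> y \<le> norm (\<phi> y)) \<Longrightarrow> norm g \<le> C" using dual_norm_bound[OF lin] by blast
  have XC: "norm (X x) \<le> C" and YC: "norm (Y y) \<le> C" for x y using C adm sup by auto
  define k where "k = 2 / measure lborel (param_ball \<phi>)"
  have k: "k > 0" unfolding k_def using measure_param_ball_pos by simp
  define a where "a = (\<integral>x. norm (X x) \<partial>M)"
  define b where "b = (\<integral>y. norm (Y y) \<partial>N)"
  have EN: "(\<integral>x. (\<integral>y. \<bar>wedge (Y x) (Y y)\<bar> \<partial>N) \<partial>N) = k"
    unfolding N_def k_def by (rule wedge_energy_support_eq[OF \<phi> Ym sup])
  have iY: "integrable N (\<lambda>y. norm (Y y))"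
    by (rule N.integrable_const_bound[of _ C]) (use YC in auto)
  \<comment> \<open>The energy of \<open>Y\<close> is positive and at most \<open>b * b\<close>.\<close>
  have b0: "b > 0"
  proof -
    have "k \<le> (\<integral>x. norm (Y x) * b \<partial>N)"
      unfolding EN[symmetric]
    proof (rule integral_mono')
      show "integrable N (\<lambda>x. norm (Y x) * b)" using iY by simp
      fix x
      have "(\<integral>y. \<bar>wedge (Y x) (Y y)\<bar> \<partial>N) \<le> (\<integral>y. norm (Y x) * norm (Y y) \<partial>N)"
        using iY abs_wedge_le by (intro integral_mono') auto
      then show "(\<integral>y. \<bar>wedge (Y x) (Y y)\<bar> \<partial>N) \<le> norm (Y x) * b" by (simp add: b_def)
      show "0 \<le> norm (Y x) * b" by (simp add: b_def integral_nonneg_AE)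
    qed
    also have "\<dots> = b * b" by (simp add: b_def)
    finally have "b \<noteq> 0" using k by auto
    moreover have "0 \<le> b" by (simp add: b_def integral_nonneg_AE)
    ultimately show ?thesis by simp
  qed
  define t where "t = a / b"
  have t: "t \<ge> 0" "a = t * b" using b0 by (auto simp: t_def a_def integral_nonneg_AE)
  have MN: "(\<integral>x. (\<integral>y. \<bar>wedge (X x) (Y y)\<bar> \<partial>N) \<partial>M) \<le> k"
  proof -
    have "(\<integral>x. (\<integral>y. \<bar>wedge (X x) (Y y)\<bar> \<partial>N) \<partial>M) \<le> (\<integral>x. k \<partial>M)"
      using integral_uniform_wedge(1)[OF \<phi> Ym sup adm] k
      by (intro integral_mono') (auto simp: N_def k_def)
    then show ?thesis by (simp add: M.prob_space)
  qed
  have "(\<integral>x. (\<integral>y. \<bar>wedge (X x) (X y)\<bar> \<partial>M) \<partial>M) - 2 * t * (\<integral>x. (\<integral>y. \<bar>wedge (X x) (Y y)\<bar> \<partial>N) \<partial>M) + t\<^sup>2 * k \<le> 0"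
    unfolding EN[symmetric]
  proof (rule wedge_energy_reverse[OF M N.prob_space_axioms X _ XC YC])
    show "Y \<in> borel_measurable N" by measurable
    show "(\<integral>x. norm (X x) \<partial>M) = t * (\<integral>y. norm (Y y) \<partial>N)" using t(2) by (simp add: a_def b_def)
  qed
  moreover have "2 * t * (\<integral>x. (\<integral>y. \<bar>wedge (X x) (Y y)\<bar> \<partial>N) \<partial>M) \<le> 2 * t * k" using MN t by (intro mult_left_mono) auto
  moreover have "2 * t * k - t\<^sup>2 * k \<le> k"
  proof -
    have "0 \<le> (1 - t)\<^sup>2 * k" using k by simp
    then show ?thesis by (simp add: power2_eq_square algebra_simps)
  qed
  ultimately show ?thesis unfolding k_def[symmetric] by linarith
qed

section \<open>Density contractors\<close>

lemma linear_injective_dim_image: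
  fixes \<psi> :: "'e::euclidean_space \<Rightarrow> 'a::real_normed_vector"
  assumes "linear_param \<psi>"
  shows "\<exists>B. independent B \<and> card B = DIM('e) \<and> finite B \<and> span B = range \<psi>"
proof -
  interpret linear_param \<psi> by fact
  have "independent (\<psi> ` Basis)"
    using independent_Basis inj lin by (intro linear_independent_injective_image) (auto intro: inj_on_subset)
  moreover have "card (\<psi> ` Basis) = DIM('e)" by (intro card_image inj_on_subset[OF inj]) auto
  moreover have "span (\<psi> ` Basis) = range \<psi>" using linear_span_image[OF lin, of Basis] by simp
  ultimately show ?thesis by (intro exI[of _ "\<psi> ` Basis"]) simp
qed

lemma range_param_UNIV:
  fixes \<psi> :: "'e::euclidean_space \<Rightarrow> 'a::real_normed_vector"
  assumes \<psi>: "linear_param \<psi>" and dim: "DIM('e) = dim (UNIV :: 'a set)"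
  shows "range \<psi> = UNIV"
proof (rule ccontr)
  assume "range \<psi> \<noteq> UNIV"
  obtain B where B: "independent B" "card B = DIM('e)" "finite B" "span B = range \<psi>"
    using linear_injective_dim_image[OF \<psi>] by blast
  then obtain x where x: "x \<notin> span B" using \<open>range \<psi> \<noteq> UNIV\<close> by auto
  have "x \<notin> B" using x span_base by blast
  have ind: "independent (insert x B)" using B(1) x by (simp add: independent_insert)
  obtain T :: "'a set" where T: "T \<subseteq> UNIV" "independent T" "UNIV \<subseteq> span T" "card T = dim (UNIV :: 'a set)"
    by (rule basis_exists[of "UNIV :: 'a set"])
  have "card T = DIM('e)" using T(4) dim by simp
  then have "finite T" by (intro card_ge_0_finite) simp
  then have "card (insert x B) \<le> card T"
    using independent_span_bound[OF _ ind, of T] T(3) by (simp add: subset_eq)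
  then show False using B T(4) dim \<open>x \<notin> B\<close> by simp
qed

lemma bounded_linear_on_param:
  fixes \<psi> :: "'e::euclidean_space \<Rightarrow> 'a::real_normed_vector" and f :: "'a \<Rightarrow> 'b::real_normed_vector"
  assumes \<psi>: "linear_param \<psi>" "range \<psi> = UNIV" and f: "linear f"
  shows "bounded_linear f"
proof -
  interpret linear_param \<psi> by fact
  obtain b where b: "b > 0" "\<And>x. b * norm x \<le> norm (\<psi> x)"
    using linear_inj_bounded_below[OF lin inj] by blast
  have "linear (f \<circ> \<psi>)" by (rule linear_compose[OF lin f])
  then obtain C where C: "C > 0" "\<And>x. norm ((f \<circ> \<psi>) x) \<le> C * norm x" using linear_bounded_pos by blast
  have "norm (f x) \<le> norm x * (C / b)" for x
  proof -
    obtain p where p: "x = \<psi> p" using \<psi>(2) by (metis rangeE UNIV_I)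
    have "norm (f x) \<le> C * norm p" using C(2)[of p] p by simp
    also have "\<dots> \<le> C * (norm x / b)"
      using b(1) b(2)[of p] C(1) p by (intro mult_left_mono) (auto simp: field_simps)
    finally show ?thesis by (simp add: mult.commute)
  qed
  then show ?thesis using f by (intro bounded_linear_intro[of f "C / b"]) (auto simp: linear_add linear_scale)
qed

lemma obtain_coordinate_map:
  fixes \<psi> :: "'e::euclidean_space \<Rightarrow> 'a::real_normed_vector"
  assumes \<psi>: "linear_param \<psi>" "range \<psi> = UNIV"
  obtains J where "linear J" "\<And>p. J (\<psi> p) = p" "\<And>x. \<psi> (J x) = x"
proof -
  interpret linear_param \<psi> by fact
  define J where "J = inv \<psi>"
  have J: "J (\<psi> p) = p" "\<psi> (J x) = x" for p x
    using inj \<psi>(2) by (auto simp: J_def inv_f_f surj_f_inv_f)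
  have "linear J"
  proof (rule linearI)
    show "J (x + y) = J x + J y" for x y using J(1)[of "J x + J y"] by (simp add: hom J(2))
    show "J (c *\<^sub>R x) = c *\<^sub>R J x" for c x using J(1)[of "c *\<^sub>R J x"] by (simp add: hom J(2))
  qed
  with J show thesis using that by blast
qed

context linear_param
begin

text \<open>
  The image lies in a proper subspace, which is a null set in coordinates.
\<close>

lemma hausdorff_image_degenerate:
  assumes T: "linear T" "\<not> inj (T :: 'e \<Rightarrow> 'e)"
  shows "hausdorff_measure DIM('e) (\<phi> ` T ` A) = 0"
proof -
  have sub: "subspace (range T)" using T(1) by (simp add: linear_subspace_image)
  have "range T \<noteq> UNIV" using linear_surjective_imp_injective[OF T(1)] T(2) by blast
  then have "dim (range T) < DIM('e)"
    using dim_eq_full[of "range T"] sub dim_subset_UNIV[of "range T"] by (simp add: span_eq_iff[THEN iffD2])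
  then have "negligible (range T)" by (rule negligible_lowdim)
  then have "emeasure lebesgue (range T) = 0" by (simp add: negligible_iff_null_sets null_setsD1)
  moreover have cl: "range T \<in> sets lborel" using closed_subspace[OF sub] by auto
  ultimately have "emeasure lborel (range T) = 0" by simp
  then have "hausdorff_measure DIM('e) (\<phi> ` range T) = 0"
    using cl by (subst hausdorff_measure_image) auto
  moreover have "hausdorff_measure DIM('e) (\<phi> ` T ` A) \<le> hausdorff_measure DIM('e) (\<phi> ` range T)"
    by (intro hausdorff_measure_mono) auto
  ultimately show ?thesis by simp
qed

end

lemma Hom_into_subset_Hom_rank:
  assumes W: "W \<in> grassmannian m" and m: "0 < m"
  shows "Hom_into W \<subseteq> Hom_rank m"
proof
  fix \<pi> assume "\<pi> \<in> Hom_into W"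
  then have \<pi>: "range (blinfun_apply \<pi>) \<subseteq> W" by (simp add: Hom_into_def)
  obtain B where "B \<subseteq> W" "independent B" "W \<subseteq> span B" "card B = dim W" by (rule basis_exists[of W])
  then have B: "W \<subseteq> span B" "card B = m" using W by (auto simp: grassmannian_def)
  then have "finite B" using m by (intro card_ge_0_finite) simp
  then have "dim (range (blinfun_apply \<pi>)) \<le> m" using dim_le_card[of "range (blinfun_apply \<pi>)" B] B \<pi> by auto
  then show "\<pi> \<in> Hom_rank m" by (simp add: Hom_rank_def)
qed

lemma density_contractor_dirac:
  fixes P :: "'a::real_normed_vector \<Rightarrow> 'a"
  assumes m: "0 < m" and W: "W \<in> grassmannian m" and P: "bounded_linear P" "range P \<subseteq> W" "\<And>x. x \<in> W \<Longrightarrow> P x = x"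
    and contr: "\<And>V A. V \<in> grassmannian m \<Longrightarrow> A \<in> sets borel \<Longrightarrow> A \<subseteq> V \<Longrightarrow>
       hausdorff_measure m (P ` A) \<le> hausdorff_measure m A"
  shows "\<exists>\<mu>. density_contractor m W \<mu>"
proof -
  define \<pi> where "\<pi> = Blinfun P"
  have \<pi>: "blinfun_apply \<pi> = P" unfolding \<pi>_def by (rule bounded_linear_Blinfun_apply[OF P(1)])
  have \<pi>W: "\<pi> \<in> Hom_into W" using P(2) by (simp add: Hom_into_def \<pi>)
  then have \<pi>R: "\<pi> \<in> Hom_rank m" using Hom_into_subset_Hom_rank[OF W m] by blast
  let ?R = "restrict_space borel (Hom_rank m) :: ('a \<Rightarrow>\<^sub>L 'a) measure"
  have sp: "space ?R = Hom_rank m" by (simp add: space_restrict_space)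
  define \<mu> where "\<mu> = return ?R \<pi>"
  interpret prob_space \<mu> unfolding \<mu>_def using \<pi>R by (intro prob_space_return) (simp add: sp)
  have null: "emeasure \<mu> (Hom_rank m - Hom_into W) = 0"
  proof (cases "Hom_rank m - Hom_into W \<in> sets ?R")
    case True
    then show ?thesis using \<pi>W by (simp add: \<mu>_def)
  next
    case False
    then show ?thesis by (intro emeasure_notin_sets) (simp add: \<mu>_def)
  qed
  have int: "(\<integral>\<^sup>+\<rho>. h \<rho> \<partial>\<mu>) = h \<pi>" for h :: "_ \<Rightarrow> ennreal"
  proof -
    have "{\<pi>} \<in> sets ?R" using \<pi>R by (auto simp: sets_restrict_space image_iff intro!: bexI[of _ "{\<pi>}"])
    then have "space ?R - {\<pi>} \<in> sets ?R" by (rule sets.compl_sets)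
    then have "AE \<rho> in \<mu>. \<rho> \<in> {\<pi>}"
      by (intro AE_I'[of "space ?R - {\<pi>}"]) (auto simp: \<mu>_def null_sets_def)
    then have "AE \<rho> in \<mu>. h \<rho> = h \<pi>" by (rule AE_mp) auto
    then have "(\<integral>\<^sup>+\<rho>. h \<rho> \<partial>\<mu>) = (\<integral>\<^sup>+\<rho>. h \<pi> \<partial>\<mu>)" by (rule nn_integral_cong_AE)
    then show ?thesis by (simp add: emeasure_space_1)
  qed
  have "density_contractor m W \<mu>" unfolding density_contractor_def
  proof (intro conjI ballI impI)
    show "prob_space \<mu>" by (rule prob_space_axioms)
    show "space \<mu> = Hom_rank m" "sets \<mu> = sets ?R" by (auto simp: \<mu>_def sp)
    show "emeasure \<mu> (Hom_rank m - Hom_into W) = 0" by (rule null)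
    fix V :: "'a set" and A :: "'a set" assume V: "V \<in> grassmannian m" and A: "A \<in> sets borel" "A \<subseteq> V"
    show "(\<integral>\<^sup>+\<rho>. hausdorff_measure m (blinfun_apply \<rho> ` A) \<partial>\<mu>) \<le> hausdorff_measure m A"
      unfolding int \<pi> by (rule contr[OF V A])
    assume "V = W"
    then have "P ` A = A" using A P(3) by (auto simp: image_iff subset_eq)
    then show "(\<integral>\<^sup>+\<rho>. hausdorff_measure m (blinfun_apply \<rho> ` A) \<partial>\<mu>) = hausdorff_measure m A"
      unfolding int \<pi> by simp
  qed
  then show ?thesis by blast
qed

lemma sublinear_norm: "sublinear (norm :: 'a::real_normed_vector \<Rightarrow> real)"
  by (auto simp: sublinear_def norm_triangle_ineq)

lemma support_functional_norm_abs:
  fixes x y :: "'a::real_normed_vector"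
  assumes "span (set ys) = UNIV"
  shows "\<bar>support_functional norm ys x y\<bar> \<le> norm y"
proof -
  have "- support_functional norm ys x y = support_functional norm ys x (- y)"
    using linear_neg[OF linear_support_functional[OF sublinear_norm assms]] by simp
  then show ?thesis
    using support_functional_le[OF sublinear_norm, of ys x y] support_functional_le[OF sublinear_norm, of ys x "- y"]
    by (simp add: abs_le_iff)
qed

text \<open>
  A functional of norm one that attains its norm on the line defines a projection of norm one.
\<close>

lemma density_contractor_line:
  fixes W :: "'a::real_normed_vector set"
  assumes fin: "finite (B :: 'a set)" "span B = UNIV" and W: "W \<in> grassmannian 1"
  shows "\<exists>\<mu>. density_contractor 1 W \<mu>"
proof -
  obtain \<phi> :: "real \<Rightarrow> 'a" where \<phi>: "linear_param \<phi>" "range \<phi> = W"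
    using obtain_linear_param[where 'e = real, of W] W by (auto simp: grassmannian_def)
  interpret linear_param \<phi> by (rule \<phi>(1))
  define w where "w = \<phi> 1"
  have \<phi>w: "\<phi> t = t *\<^sub>R w" for t using hom(3)[of t 1] by (simp add: w_def)
  have w0: "w \<noteq> 0" using injD[OF inj, of 1 0] by (auto simp: w_def hom)
  obtain ys where ys: "set ys = B" using finite_list[OF fin(1)] by blast
  define F where "F = support_functional norm ys w"
  have F: "linear F" "\<And>y. \<bar>F y\<bar> \<le> norm y" "F w = norm w"
    using linear_support_functional[OF sublinear_norm, of ys w] support_functional_norm_abs[of ys w]
      support_functional_self[OF sublinear_norm, of ys w] fin ys by (auto simp: F_def)
  define P where "P y = (F y / norm w) *\<^sub>R w" for y
  have lP: "linear P" by (intro linearI) (auto simp: P_def linear_add[OF F(1)] linear_scale[OF F(1)] algebra_simps add_divide_distrib)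
  have nP: "norm (P y) \<le> norm y" for y using w0 F(2)[of y] by (simp add: P_def)
  show ?thesis
  proof (rule density_contractor_dirac[OF _ W])
    show "bounded_linear P" using lP nP by (intro bounded_linear_intro[of P 1]) (auto simp: linear_add linear_scale)
    show "range P \<subseteq> W" unfolding \<phi>(2)[symmetric] by (auto simp: P_def \<phi>w)
    show "P x = x" if "x \<in> W" for x
      using that w0 unfolding \<phi>(2)[symmetric] by (auto simp: \<phi>w P_def linear_scale[OF F(1)] F(3))
    show "hausdorff_measure 1 (P ` A) \<le> hausdorff_measure 1 A" for A
      using hausdorff_measure_lipschitz[of 1 A P 1] nP by (simp add: dist_norm linear_diff[OF lP, symmetric])
  qed simp
qed

text \<open>
  A finite type with \<open>dim UNIV - 2\<close> elements if the dimension is at least three: it makes Euclidean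
  spaces of the dimensions of the space, of its hyperplanes and of their intersections available
  as types \<open>real ^ 'a codim2_index\<close>, possibly with one or two factors \<open>real\<close>.
\<close>

typedef (overloaded) ('a::real_vector) codim2_index = "{..<max 1 (dim (UNIV :: 'a set) - 2)}"
  by (rule exI[of _ 0]) auto

instance codim2_index :: (real_vector) finite
proof
  have "(UNIV :: 'a codim2_index set) = Abs_codim2_index ` {..<max 1 (dim (UNIV :: 'a set) - 2)}"
    using type_definition.Abs_image[OF type_definition_codim2_index] by metis
  then show "finite (UNIV :: 'a codim2_index set)" by (metis finite_imageI finite_lessThan)
qed

lemma card_codim2_index: "CARD('a::real_vector codim2_index) = max 1 (dim (UNIV :: 'a set) - 2)"
  using type_definition.card[OF type_definition_codim2_index] by simp

text \<open>
  The projection \<open>P\<close> onto \<open>W\<close> has the kernel spanned by \<open>u + \<phi> z\<close>. A hyperplane \<open>V\<close> on which it is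
  injective is a graph over \<open>W\<close> in this direction, and parametrised by \<open>W\<close> accordingly, \<open>P\<close> becomes the
  identity in coordinates; then only the volumes of the two unit balls have to be compared.
  On all other hyperplanes the image is a null set.
\<close>

lemma density_contractor_hyperplane:
  fixes W :: "'a::real_normed_vector set"
  assumes n: "3 \<le> dim (UNIV :: 'a set)" and W: "W \<in> grassmannian (dim (UNIV :: 'a set) - 1)"
  shows "\<exists>\<mu>. density_contractor (dim (UNIV :: 'a set) - 1) W \<mu>"
proof -
  let ?m = "dim (UNIV :: 'a set) - 1"
  have D: "DIM(real \<times> (real ^ 'a codim2_index)) = ?m" using n by (simp add: card_codim2_index)
  obtain \<phi> :: "real \<times> (real ^ 'a codim2_index) \<Rightarrow> 'a" where \<phi>: "linear_param \<phi>" "range \<phi> = W"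
    using obtain_linear_param[where 'e = "real \<times> (real ^ 'a codim2_index)", of W] W D by (auto simp: grassmannian_def)
  interpret \<phi>: linear_param \<phi> by (rule \<phi>(1))
  have "W \<noteq> UNIV" using W n by (auto simp: grassmannian_def)
  then obtain u where u: "u \<notin> range \<phi>" unfolding \<phi>(2) by blast
  obtain z where z: "\<And>l. measure lborel (param_ball (tilt \<phi> (\<lambda>c. l \<bullet> c) (u + \<phi> z))) \<le> measure lborel (param_ball \<phi>)"
    using busemann_projection[OF \<phi>(1) u] by blast
  define \<Psi> where "\<Psi> p = \<phi> (fst p) + snd p *\<^sub>R u" for p :: "(real \<times> (real ^ 'a codim2_index)) \<times> real"
  have l\<Psi>: "linear \<Psi>" by (intro linearI) (auto simp: \<Psi>_def \<phi>.hom algebra_simps)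
  have "p = 0" if "\<Psi> p = 0" for p
  proof -
    have eq: "snd p *\<^sub>R u = \<phi> (- fst p)" using that by (simp add: \<Psi>_def \<phi>.hom eq_neg_iff_add_eq_0 add.commute)
    then have "snd p = 0" by (intro \<phi>.scaleR_mem_rangeD[OF u]) simp
    moreover from this eq have "\<phi> (fst p) = \<phi> 0" by (simp add: \<phi>.hom)
    then have "fst p = 0" by (rule injD[OF \<phi>.inj])
    ultimately show ?thesis by (simp add: prod_eq_iff)
  qed
  then have i\<Psi>: "inj \<Psi>" using linear_injective_0[OF l\<Psi>] by blast
  have p\<Psi>: "linear_param \<Psi>" using l\<Psi> i\<Psi> by (rule linear_param.intro)
  have "DIM((real \<times> (real ^ 'a codim2_index)) \<times> real) = dim (UNIV :: 'a set)" using n by (simp add: card_codim2_index)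
  then have s\<Psi>: "range \<Psi> = UNIV" by (rule range_param_UNIV[OF p\<Psi>])
  obtain J where lJ: "linear J" and J: "\<And>p. J (\<Psi> p) = p" "\<And>x. \<Psi> (J x) = x"
    using obtain_coordinate_map[OF p\<Psi> s\<Psi>] by blast
  define P where "P x = \<phi> (fst (J x) - snd (J x) *\<^sub>R z)" for x
  have lP: "linear P"
    by (intro linearI) (auto simp: P_def linear_add[OF lJ] linear_scale[OF lJ] \<phi>.hom algebra_simps)
  have P\<phi>: "P (\<phi> c) = \<phi> c" for c using J(1)[of "(c, 0)"] by (simp add: P_def \<Psi>_def)
  show ?thesis
  proof (rule density_contractor_dirac[OF _ W])
    show "0 < ?m" using n by simp
    show "bounded_linear P" by (rule bounded_linear_on_param[OF p\<Psi> s\<Psi> lP])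
    show "range P \<subseteq> W" unfolding \<phi>(2)[symmetric] by (auto simp: P_def)
    show "P x = x" if "x \<in> W" for x using that P\<phi> unfolding \<phi>(2)[symmetric] by auto
    fix V :: "'a set" and A :: "'a set" assume V: "V \<in> grassmannian ?m" and A: "A \<in> sets borel" "A \<subseteq> V"
    obtain \<psi> :: "real \<times> (real ^ 'a codim2_index) \<Rightarrow> 'a" where \<psi>: "linear_param \<psi>" "range \<psi> = V"
      using obtain_linear_param[where 'e = "real \<times> (real ^ 'a codim2_index)", of V] V D by (auto simp: grassmannian_def)
    interpret \<psi>: linear_param \<psi> by (rule \<psi>(1))
    define T where "T c = fst (J (\<psi> c)) - snd (J (\<psi> c)) *\<^sub>R z" for c
    have lT: "linear T"
      by (intro linearI) (auto simp: T_def linear_add[OF lJ] linear_scale[OF lJ] \<psi>.hom algebra_simps)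
    have PT: "P (\<psi> c) = \<phi> (T c)" for c by (simp add: P_def T_def)
    have A\<psi>: "A = \<psi> ` (\<psi> -` A)" using A \<psi>(2) by auto
    show "hausdorff_measure ?m (P ` A) \<le> hausdorff_measure ?m A"
    proof (cases "inj T")
      case False
      have "P ` A = P ` \<psi> ` (\<psi> -` A)" by (rule arg_cong[OF A\<psi>])
      also have "\<dots> = \<phi> ` T ` (\<psi> -` A)" by (simp only: image_image PT)
      finally have "P ` A = \<phi> ` T ` (\<psi> -` A)" .
      then show ?thesis using \<phi>.hausdorff_image_degenerate[OF lT False] D by simp
    next
      case True
      obtain S where S: "linear S" "\<And>c. S (T c) = c" "\<And>c. T (S c) = c"
        using linear_injective_isomorphism[OF lT True] by blast
      define \<xi> where "\<xi> c = \<psi> (S c)" for c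
      have l\<xi>: "linear \<xi>" unfolding \<xi>_def using linear_compose[OF S(1) \<psi>.lin] by (simp add: comp_def)
      have P\<xi>: "P (\<xi> c) = \<phi> c" for c by (simp add: \<xi>_def PT S)
      define \<tau> where "\<tau> c = snd (J (\<xi> c))" for c
      have linear_\<tau>: "linear \<tau>" by (intro linearI) (auto simp: \<tau>_def linear_add[OF l\<xi>] linear_scale[OF l\<xi>] linear_add[OF lJ] linear_scale[OF lJ])
      obtain l where l: "\<And>c. l \<bullet> c = \<tau> c" using linear_functional_inner[OF linear_\<tau>] by blast
      have \<xi>: "\<xi> = tilt \<phi> (\<lambda>c. l \<bullet> c) (u + \<phi> z)"
      proof
        fix c
        have "fst (J (\<xi> c)) - snd (J (\<xi> c)) *\<^sub>R z = c" using P\<xi>[of c] unfolding P_def by (rule injD[OF \<phi>.inj])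
        then have f: "fst (J (\<xi> c)) = c + \<tau> c *\<^sub>R z" by (simp add: \<tau>_def algebra_simps)
        have "\<xi> c = \<Psi> (J (\<xi> c))" by (simp add: J)
        also have "\<dots> = \<phi> (c + \<tau> c *\<^sub>R z) + \<tau> c *\<^sub>R u" unfolding \<Psi>_def f by (simp add: \<tau>_def)
        finally show "\<xi> c = tilt \<phi> (\<lambda>c. l \<bullet> c) (u + \<phi> z) c" by (simp add: tilt_def l \<phi>.hom algebra_simps)
      qed
      have i\<xi>: "inj \<xi>" using P\<xi> \<phi>.inj by (metis injD injI)
      interpret \<xi>: linear_param \<xi> using l\<xi> i\<xi> by (rule linear_param.intro)
      define A' where "A' = \<xi> -` A"
      have A'b: "A' \<in> sets borel" unfolding A'_def by (rule linear_vimage_borel[OF l\<xi> A(1)])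
      have "x \<in> range \<xi>" if "x \<in> A" for x
      proof -
        have "x \<in> range \<psi>" using that A(2) \<psi>(2) by blast
        then obtain c where "x = \<psi> c" by (rule rangeE)
        then have "x = \<xi> (T c)" by (simp add: \<xi>_def S)
        then show ?thesis by blast
      qed
      then have A\<xi>: "A = \<xi> ` A'" unfolding A'_def by auto
      have PA: "P ` A = \<phi> ` A'" unfolding A\<xi> by (simp add: image_image P\<xi>)
      have "measure lborel (param_ball \<xi>) \<le> measure lborel (param_ball \<phi>)" unfolding \<xi> by (rule z)
      then have "unit_ball_vol (real ?m) / \<phi>.\<kappa> \<le> unit_ball_vol (real ?m) / \<xi>.\<kappa>"
        using \<xi>.measure_param_ball_pos by (intro divide_left_mono) (auto simp: \<phi>.measure_param_ball_pos)
      then have "ennreal (unit_ball_vol (real ?m) / \<phi>.\<kappa>) * emeasure lborel A' \<le> ennreal (unit_ball_vol (real ?m) / \<xi>.\<kappa>) * emeasure lborel A'"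
        by (intro mult_right_mono ennreal_leI) auto
      then show ?thesis
        using \<phi>.hausdorff_measure_image[OF A'b] \<xi>.hausdorff_measure_image[OF A'b] unfolding PA D by (simp flip: A\<xi>)
    qed
  qed
qed

lemma hausdorff_image_linear2:
  fixes \<phi> :: "real \<times> real \<Rightarrow> 'a::real_normed_vector" and T :: "real \<times> real \<Rightarrow> real \<times> real"
  assumes \<phi>: "linear_param \<phi>" and T: "linear T" and A: "A \<in> sets borel"
  shows "hausdorff_measure 2 (\<phi> ` T ` A)
    = ennreal (unit_ball_vol 2 / measure lborel (param_ball \<phi>) * \<bar>wedge (T (1, 0)) (T (0, 1))\<bar>) * emeasure lborel A"
proof -
  interpret linear_param \<phi> by fact
  have D2: "DIM(real \<times> real) = 2" by simp
  define a b where "a = T (1, 0)" and "b = T (0, 1)"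
  have Tab: "T p = fst p *\<^sub>R a + snd p *\<^sub>R b" for p
  proof -
    have "T p = T (fst p *\<^sub>R (1, 0) + snd p *\<^sub>R (0, 1))" by simp
    then show ?thesis unfolding linear_add[OF T] linear_scale[OF T] a_def b_def .
  qed
  show ?thesis
  proof (cases "wedge a b = 0")
    case True
    have "\<not> inj T"
    proof
      assume "inj T"
      have eqs: "T (snd b, - snd a) = 0" "T (fst b, - fst a) = 0"
        using True by (auto simp: Tab prod_eq_iff wedge_def algebra_simps)
      then have "(snd b, - snd a) = 0" "(fst b, - fst a) = 0"
        using linear_injective_0[OF T] \<open>inj T\<close> by blast+
      then have "T (1, 0) = 0" by (simp add: Tab prod_eq_iff)
      then show False using linear_injective_0[OF T] \<open>inj T\<close> by (metis one_neq_zero prod.sel(1) fst_zero)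
    qed
    then show ?thesis using hausdorff_image_degenerate[OF T, unfolded D2] True by (simp add: a_def b_def)
  next
    case False
    have "p = 0" if "T p = 0" for p
    proof -
      have "fst p * fst a + snd p * fst b = 0" "fst p * snd a + snd p * snd b = 0"
        using that by (auto simp: Tab prod_eq_iff)
      then have "fst p * wedge a b = 0" "snd p * wedge a b = 0" unfolding wedge_def by algebra+
      then show ?thesis using False by (simp add: prod_eq_iff)
    qed
    then have iT: "inj T" using linear_injective_0[OF T] by blast
    obtain S where S: "linear S" "\<And>p. S (T p) = p" "\<And>p. T (S p) = p"
      using linear_injective_isomorphism[OF T iT] by blast
    have "T ` A = S -` A"
    proof (intro equalityI subsetI)
      fix x assume "x \<in> S -` A"
      then show "x \<in> T ` A" using S(3)[of x] by (intro image_eqI[of _ _ "S x"]) auto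
    qed (use S(2) in auto)
    then have TA: "T ` A \<in> sets borel" using linear_vimage_borel[OF S(1) A] by simp
    have "emeasure lborel A = ennreal (1 / \<bar>wedge a b\<bar>) * emeasure lborel (T ` A)"
      using emeasure_linear2_vimage[OF False TA] inj_vimage_image_eq[OF iT, of A] by (simp add: Tab[abs_def, symmetric])
    then have "ennreal \<bar>wedge a b\<bar> * emeasure lborel A = (ennreal \<bar>wedge a b\<bar> * ennreal (1 / \<bar>wedge a b\<bar>)) * emeasure lborel (T ` A)"
      by (simp add: mult.assoc)
    also have "ennreal \<bar>wedge a b\<bar> * ennreal (1 / \<bar>wedge a b\<bar>) = 1" using False by (simp flip: ennreal_mult)
    finally have "emeasure lborel (T ` A) = ennreal \<bar>wedge a b\<bar> * emeasure lborel A" by simp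
    moreover have "ennreal (unit_ball_vol 2 / \<kappa> * \<bar>wedge a b\<bar>) = ennreal (unit_ball_vol 2 / \<kappa>) * ennreal \<bar>wedge a b\<bar>"
      using measure_param_ball_pos by (intro ennreal_mult) auto
    ultimately show ?thesis
      using hausdorff_measure_image[OF TA, unfolded D2] by (simp add: a_def[symmetric] b_def[symmetric] mult.assoc)
  qed
qed

text \<open>
  The mean area of the image of a set \<open>A\<close> in a plane \<open>V\<close> is a multiple of the energy of the
  restrictions of \<open>F x\<close> to \<open>V\<close>. These are functionals of norm at most one on \<open>V\<close>, which gives the
  inequality, and for \<open>V = W\<close> they support the unit ball at \<open>x\<close>, which gives equality. The scalar
  \<open>c0\<close> is chosen so that the maps preserve area on \<open>W\<close> on average.
\<close>

lemma density_contractor_plane: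
  fixes W :: "'a::real_normed_vector set"
  assumes n: "3 \<le> dim (UNIV :: 'a set)" and W: "W \<in> grassmannian 2"
  shows "\<exists>\<mu>. density_contractor 2 W \<mu>"
proof -
  have D2: "DIM(real \<times> real) = 2" by simp
  obtain \<phi> :: "real \<times> real \<Rightarrow> 'a" where \<phi>: "linear_param \<phi>" "range \<phi> = W"
    using obtain_linear_param[where 'e = "real \<times> real", of W] W by (auto simp: grassmannian_def)
  interpret \<phi>: linear_param \<phi> by (rule \<phi>(1))
  define e1 e2 :: "real \<times> real" where "e1 = (1, 0)" and "e2 = (0, 1)"
  have dimX: "DIM(real \<times> real \<times> (real ^ 'a codim2_index)) = dim (UNIV :: 'a set)" using n by (simp add: card_codim2_index)
  obtain \<Psi> :: "real \<times> real \<times> (real ^ 'a codim2_index) \<Rightarrow> 'a" where \<Psi>: "linear_param \<Psi>" "range \<Psi> = UNIV"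
    using obtain_linear_param[where 'e = "real \<times> real \<times> (real ^ 'a codim2_index)", of "UNIV :: 'a set"] dimX by auto
  interpret \<Psi>: linear_param \<Psi> by (rule \<Psi>(1))
  obtain J where lJ: "linear J" and J: "\<And>p. J (\<Psi> p) = p" "\<And>x. \<Psi> (J x) = x"
    using obtain_coordinate_map[OF \<Psi>] by blast
  note bounded = bounded_linear_on_param[OF \<Psi>]
  obtain ys where ys: "set ys = \<Psi> ` Basis" using finite_list[of "\<Psi> ` Basis"] by auto
  have span_ys: "span (set ys) = UNIV" unfolding ys using linear_span_image[OF \<Psi>.lin, of Basis] \<Psi>(2) by simp
  define F where "F x = support_functional norm ys (\<phi> x)" for x
  have F: "linear (F x)" "\<And>y. F x y \<le> norm y" "F x (\<phi> x) = norm (\<phi> x)" for x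
    unfolding F_def using linear_support_functional[OF sublinear_norm span_ys] support_functional_le[OF sublinear_norm]
      support_functional_self[OF sublinear_norm] by auto
  have nc: "(\<lambda>c. norm (t *\<^sub>R \<phi> c + y)) \<in> borel_measurable borel" for t y
    by (intro borel_measurable_continuous_onI continuous_intros \<phi>.cont)
  have Fm [measurable]: "(\<lambda>x. F x y) \<in> borel_measurable borel" for y
    unfolding F_def by (rule measurable_support_functional[OF sublinear_norm]) (rule nc)
  define p where "p x = (\<Sum>b\<in>Basis. F x (\<Psi> b) *\<^sub>R b)" for x
  have pm [measurable]: "p \<in> borel_measurable borel" unfolding p_def by measurable
  have pF: "p x \<bullet> J y = F x y" for x y
  proof -
    have "F x y = F x (\<Psi> (\<Sum>b\<in>Basis. (J y \<bullet> b) *\<^sub>R b))" by (simp add: euclidean_representation J)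
    also have "\<dots> = (\<Sum>b\<in>Basis. (J y \<bullet> b) * F x (\<Psi> b))"
      by (simp add: linear_sum[OF \<Psi>.lin] \<Psi>.hom linear_sum[OF F(1)] linear_scale[OF F(1)])
    finally show ?thesis unfolding p_def inner_sum_left by (simp add: inner_commute[of "J y"] mult.commute)
  qed
  define \<kappa> where "\<kappa> = measure lborel (param_ball \<phi>)"
  have \<kappa>: "\<kappa> > 0" unfolding \<kappa>_def by (rule \<phi>.measure_param_ball_pos)
  define c0 where "c0 = sqrt (\<kappa> / 2)"
  have c0: "c0 * c0 = \<kappa> / 2" using \<kappa> by (simp add: c0_def)
  define L where "L r x = \<phi> (c0 * (fst r \<bullet> J x), c0 * (snd r \<bullet> J x))" for r x
  have lL: "linear (L r)" for r
  proof (rule linearI)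
    fix x y :: 'a and c :: real
    have "(c0 * (fst r \<bullet> J (x + y)), c0 * (snd r \<bullet> J (x + y)))
        = (c0 * (fst r \<bullet> J x), c0 * (snd r \<bullet> J x)) + (c0 * (fst r \<bullet> J y), c0 * (snd r \<bullet> J y))"
      by (simp add: linear_add[OF lJ] inner_add_right algebra_simps)
    then show "L r (x + y) = L r x + L r y" unfolding L_def by (simp only: \<phi>.hom)
    have "(c0 * (fst r \<bullet> J (c *\<^sub>R x)), c0 * (snd r \<bullet> J (c *\<^sub>R x))) = c *\<^sub>R (c0 * (fst r \<bullet> J x), c0 * (snd r \<bullet> J x))"
      by (simp add: linear_scale[OF lJ] algebra_simps)
    then show "L r (c *\<^sub>R x) = c *\<^sub>R L r x" unfolding L_def by (simp only: \<phi>.hom)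
  qed
  define \<Phi> where "\<Phi> r = Blinfun (L r)" for r
  have \<Phi>: "blinfun_apply (\<Phi> r) = L r" for r unfolding \<Phi>_def by (rule bounded_linear_Blinfun_apply[OF bounded[OF lL]])
  have l\<Phi>: "linear \<Phi>"
  proof (rule linearI)
    fix r s and c :: real
    show "\<Phi> (r + s) = \<Phi> r + \<Phi> s"
    proof (rule blinfun_eqI)
      fix x
      have "(c0 * (fst (r + s) \<bullet> J x), c0 * (snd (r + s) \<bullet> J x))
        = (c0 * (fst r \<bullet> J x), c0 * (snd r \<bullet> J x)) + (c0 * (fst s \<bullet> J x), c0 * (snd s \<bullet> J x))"
        by (simp add: inner_add_left algebra_simps)
      then show "blinfun_apply (\<Phi> (r + s)) x = blinfun_apply (\<Phi> r + \<Phi> s) x"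
        unfolding blinfun.add_left \<Phi> L_def by (simp only: \<phi>.hom)
    qed
    show "\<Phi> (c *\<^sub>R r) = c *\<^sub>R \<Phi> r"
    proof (rule blinfun_eqI)
      fix x
      have "(c0 * (fst (c *\<^sub>R r) \<bullet> J x), c0 * (snd (c *\<^sub>R r) \<bullet> J x)) = c *\<^sub>R (c0 * (fst r \<bullet> J x), c0 * (snd r \<bullet> J x))"
        by (simp add: algebra_simps)
      then show "blinfun_apply (\<Phi> (c *\<^sub>R r)) x = blinfun_apply (c *\<^sub>R \<Phi> r) x"
        unfolding blinfun.scaleR_left \<Phi> L_def by (simp only: \<phi>.hom)
    qed
  qed
  have \<Phi>m: "\<Phi> \<in> borel_measurable borel"
    using linear_continuous_on[of \<Phi> UNIV] l\<Phi> by (intro borel_measurable_continuous_onI) (simp add: linear_conv_bounded_linear)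
  have \<Phi>W: "\<Phi> r \<in> Hom_into W" for r by (auto simp: Hom_into_def \<Phi> L_def \<phi>(2)[symmetric])
  then have \<Phi>R: "\<Phi> r \<in> Hom_rank 2" for r
    by (intro subsetD[OF Hom_into_subset_Hom_rank[OF W]]) auto
  define N where "N = uniform_measure lborel (param_ball \<phi>)"
  interpret N: prob_space N unfolding N_def by (rule prob_space_uniform_param_ball[OF \<phi>(1)])
  interpret NN: pair_prob_space N N ..
  have sN [measurable_cong]: "sets N = sets borel" by (simp add: N_def)
  let ?R = "restrict_space borel (Hom_rank 2) :: ('a \<Rightarrow>\<^sub>L 'a) measure"
  define G where "G w = \<Phi> (p (fst w), p (snd w))" for w
  have Gm: "G \<in> (N \<Otimes>\<^sub>M N) \<rightarrow>\<^sub>M ?R"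
  proof (rule measurable_restrict_space2)
    show "G \<in> (N \<Otimes>\<^sub>M N) \<rightarrow>\<^sub>M borel" unfolding G_def by (rule measurable_compose[OF _ \<Phi>m]) measurable
    show "G \<in> space (N \<Otimes>\<^sub>M N) \<rightarrow> Hom_rank 2" using \<Phi>R by (auto simp: G_def)
  qed
  define \<mu> where "\<mu> = distr (N \<Otimes>\<^sub>M N) ?R G"
  have sp: "space ?R = Hom_rank 2" by (simp add: space_restrict_space)
  have prob: "prob_space \<mu>" unfolding \<mu>_def by (rule NN.prob_space_distr[OF Gm])
  have null: "emeasure \<mu> (Hom_rank 2 - Hom_into W) = 0"
  proof (cases "Hom_rank 2 - Hom_into W \<in> sets ?R")
    case True
    have "G w \<in> Hom_into W" for w unfolding G_def by (rule \<Phi>W)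
    then have "G -` (Hom_rank 2 - Hom_into W) \<inter> space (N \<Otimes>\<^sub>M N) = {}" by blast
    then show ?thesis using True by (simp add: \<mu>_def emeasure_distr[OF Gm])
  next
    case False
    then show ?thesis by (intro emeasure_notin_sets) (simp add: \<mu>_def)
  qed
  define f where "f \<psi> x = (F x (\<psi> e1), F x (\<psi> e2))" for \<psi> :: "real \<times> real \<Rightarrow> 'a" and x
  have fm [measurable]: "f \<psi> \<in> borel_measurable borel" for \<psi> unfolding f_def by measurable
  have vec: "f \<psi> x \<bullet> y = F x (\<psi> y)" if "linear_param \<psi>" for \<psi> :: "real \<times> real \<Rightarrow> 'a" and x y
  proof -
    interpret \<psi>: linear_param \<psi> by (rule that)
    have "F x (\<psi> y) = F x (\<psi> (fst y *\<^sub>R e1 + snd y *\<^sub>R e2))" by (simp add: e1_def e2_def)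
    also have "\<dots> = f \<psi> x \<bullet> y"
      unfolding \<psi>.hom linear_add[OF F(1)] linear_scale[OF F(1)] by (simp add: f_def inner_real_prod mult.commute)
    finally show ?thesis ..
  qed
  have mean: "(\<integral>\<^sup>+\<pi>. hausdorff_measure 2 (blinfun_apply \<pi> ` (\<psi> ` A)) \<partial>\<mu>)
      = ennreal (unit_ball_vol 2 / 2 * (\<integral>x. (\<integral>y. \<bar>wedge (f \<psi> x) (f \<psi> y)\<bar> \<partial>N) \<partial>N)) * emeasure lborel A"
    if \<psi>: "linear_param \<psi>" and A: "A \<in> sets borel" for \<psi> :: "real \<times> real \<Rightarrow> 'a" and A
  proof -
    interpret \<psi>: linear_param \<psi> by (rule \<psi>)
    obtain g where g: "linear g" "\<And>c. g (\<phi> c) = c"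
      using linear_injective_left_inverse[OF \<phi>.lin \<phi>.inj] by (metis comp_apply id_apply)
    have bg: "bounded_linear g" by (rule bounded[OF g(1)])
    have ca: "continuous_on UNIV (\<lambda>\<pi> :: 'a \<Rightarrow>\<^sub>L 'a. blinfun_apply \<pi> x)" for x by (intro continuous_intros)
    have cg: "continuous_on UNIV (\<lambda>\<pi> :: 'a \<Rightarrow>\<^sub>L 'a. g (blinfun_apply \<pi> x))" for x
      by (intro continuous_on_compose2[OF linear_continuous_on[OF bg, of UNIV] ca]) auto
    define \<Delta> where "\<Delta> \<pi> = wedge (g (blinfun_apply \<pi> (\<psi> e1))) (g (blinfun_apply \<pi> (\<psi> e2)))" for \<pi> :: "'a \<Rightarrow>\<^sub>L 'a"
    have \<Delta>m: "\<Delta> \<in> borel_measurable ?R"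
    proof -
      have "\<Delta> \<in> borel_measurable borel" unfolding \<Delta>_def
        by (intro measurable_wedge borel_measurable_continuous_onI cg)
      then show ?thesis by (rule measurable_restrict_space1)
    qed
    define h where "h \<pi> = ennreal (unit_ball_vol 2 / \<kappa> * \<bar>\<Delta> \<pi>\<bar>) * emeasure lborel A" for \<pi>
    have hm: "h \<in> borel_measurable ?R" unfolding h_def using \<Delta>m by measurable
    have area: "hausdorff_measure 2 (blinfun_apply \<pi> ` (\<psi> ` A)) = h \<pi>"
      if \<pi>: "\<And>x. blinfun_apply \<pi> x = \<phi> (g (blinfun_apply \<pi> x))" for \<pi> :: "'a \<Rightarrow>\<^sub>L 'a"
    proof -
      let ?T = "\<lambda>c. g (blinfun_apply \<pi> (\<psi> c))"
      have lT: "linear ?T" by (intro linearI) (auto simp: \<psi>.hom blinfun.add_right blinfun.scaleR_right linear_add[OF g(1)] linear_scale[OF g(1)])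
      have "blinfun_apply \<pi> ` (\<psi> ` A) = \<phi> ` ?T ` A" unfolding image_image using \<pi> by (intro image_cong) auto
      then show ?thesis using hausdorff_image_linear2[OF \<phi>(1) lT A]
        by (simp add: h_def \<Delta>_def e1_def e2_def \<kappa>_def)
    qed
    \<comment> \<open>A closed set of maps with range in \<open>W\<close>, on which the area is given by the Borel function \<open>h\<close>.\<close>
    let ?N = "{\<pi> :: 'a \<Rightarrow>\<^sub>L 'a. \<forall>b\<in>Basis. blinfun_apply \<pi> (\<Psi> b) = \<phi> (g (blinfun_apply \<pi> (\<Psi> b)))}"
    have cl: "closed ?N"
    proof -
      have "closed {\<pi> :: 'a \<Rightarrow>\<^sub>L 'a. blinfun_apply \<pi> x = \<phi> (g (blinfun_apply \<pi> x))}" for x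
        by (intro closed_Collect_eq ca continuous_on_compose2[OF \<phi>.cont cg]) auto
      then have "closed (\<Inter>b\<in>Basis. {\<pi> :: 'a \<Rightarrow>\<^sub>L 'a. blinfun_apply \<pi> (\<Psi> b) = \<phi> (g (blinfun_apply \<pi> (\<Psi> b)))})"
        by (intro closed_INT) auto
      then show ?thesis by (simp add: INT_iff Collect_ball_eq)
    qed
    have N_all: "blinfun_apply \<pi> x = \<phi> (g (blinfun_apply \<pi> x))" if "\<pi> \<in> ?N" for \<pi> :: "'a \<Rightarrow>\<^sub>L 'a" and x
    proof -
      have x: "x = (\<Sum>b\<in>Basis. (J x \<bullet> b) *\<^sub>R \<Psi> b)"
      proof -
        have "x = \<Psi> (\<Sum>b\<in>Basis. (J x \<bullet> b) *\<^sub>R b)" by (simp add: euclidean_representation J)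
        then show ?thesis by (simp add: linear_sum[OF \<Psi>.lin] \<Psi>.hom)
      qed
      have "blinfun_apply \<pi> x = (\<Sum>b\<in>Basis. (J x \<bullet> b) *\<^sub>R blinfun_apply \<pi> (\<Psi> b))"
        by (subst x) (simp add: blinfun.sum_right blinfun.scaleR_right)
      also have "\<dots> = (\<Sum>b\<in>Basis. (J x \<bullet> b) *\<^sub>R \<phi> (g (blinfun_apply \<pi> (\<Psi> b))))"
        using that by (intro sum.cong) auto
      also have "\<dots> = \<phi> (g (\<Sum>b\<in>Basis. (J x \<bullet> b) *\<^sub>R blinfun_apply \<pi> (\<Psi> b)))"
        by (simp add: linear_sum[OF g(1)] linear_scale[OF g(1)] linear_sum[OF \<phi>.lin] \<phi>.hom)
      also have "(\<Sum>b\<in>Basis. (J x \<bullet> b) *\<^sub>R blinfun_apply \<pi> (\<Psi> b)) = blinfun_apply \<pi> x"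
        by (subst (2) x) (simp add: blinfun.sum_right blinfun.scaleR_right)
      finally show ?thesis .
    qed
    have "AE \<pi> in \<mu>. \<pi> \<in> ?N"
    proof -
      have "{\<pi> \<in> space ?R. \<pi> \<in> ?N} \<in> sets ?R"
        using cl by (auto simp: sp sets_restrict_space image_iff Int_def conj_commute intro!: bexI[of _ ?N])
      then have "(AE \<pi> in \<mu>. \<pi> \<in> ?N) \<longleftrightarrow> (AE w in N \<Otimes>\<^sub>M N. G w \<in> ?N)"
        unfolding \<mu>_def by (rule AE_distr_iff[OF Gm])
      then show ?thesis by (simp add: G_def \<Phi> L_def g(2))
    qed
    then have "(\<integral>\<^sup>+\<pi>. hausdorff_measure 2 (blinfun_apply \<pi> ` (\<psi> ` A)) \<partial>\<mu>) = (\<integral>\<^sup>+\<pi>. h \<pi> \<partial>\<mu>)"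
      using area N_all by (intro nn_integral_cong_AE) (erule AE_mp, intro AE_I2 impI, blast)
    also have "\<dots> = (\<integral>\<^sup>+w. h (G w) \<partial>(N \<Otimes>\<^sub>M N))"
      unfolding \<mu>_def using hm by (intro nn_integral_distr[OF Gm]) simp
    also have "\<dots> = (\<integral>\<^sup>+x. (\<integral>\<^sup>+y. h (G (x, y)) \<partial>N) \<partial>N)"
      by (rule N.nn_integral_fst[symmetric]) (rule measurable_compose[OF Gm hm])
    also have "\<dots> = (\<integral>\<^sup>+x. (\<integral>\<^sup>+y. (ennreal (unit_ball_vol 2 / 2) * emeasure lborel A) *
        ennreal \<bar>wedge (f \<psi> x) (f \<psi> y)\<bar> \<partial>N) \<partial>N)"
    proof (intro nn_integral_cong)
      fix x y
      have \<Delta>G: "\<Delta> (G (x, y)) = (c0 * c0) * wedge (f \<psi> x) (f \<psi> y)"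
        by (simp add: \<Delta>_def G_def \<Phi> L_def g(2) pF f_def wedge_def algebra_simps)
      then have "\<bar>\<Delta> (G (x, y))\<bar> = (\<kappa> / 2) * \<bar>wedge (f \<psi> x) (f \<psi> y)\<bar>"
      proof -
        have "\<bar>\<kappa> / 2\<bar> = \<kappa> / 2" using \<kappa> by simp
        then show ?thesis using \<Delta>G unfolding c0 by (simp only: abs_mult)
      qed
      then have "unit_ball_vol 2 / \<kappa> * \<bar>\<Delta> (G (x, y))\<bar> = unit_ball_vol 2 / 2 * \<bar>wedge (f \<psi> x) (f \<psi> y)\<bar>"
        using \<kappa> by (simp only:) simp
      then have "h (G (x, y)) = ennreal (unit_ball_vol 2 / 2 * \<bar>wedge (f \<psi> x) (f \<psi> y)\<bar>) * emeasure lborel A"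
        unfolding h_def by (simp only:)
      also have "ennreal (unit_ball_vol 2 / 2 * \<bar>wedge (f \<psi> x) (f \<psi> y)\<bar>)
          = ennreal (unit_ball_vol 2 / 2) * ennreal \<bar>wedge (f \<psi> x) (f \<psi> y)\<bar>"
        by (intro ennreal_mult) auto
      also have "\<dots> * emeasure lborel A = (ennreal (unit_ball_vol 2 / 2) * emeasure lborel A) *
        ennreal \<bar>wedge (f \<psi> x) (f \<psi> y)\<bar>" by (simp only: ac_simps)
      finally show "h (G (x, y)) = (ennreal (unit_ball_vol 2 / 2) * emeasure lborel A) *
        ennreal \<bar>wedge (f \<psi> x) (f \<psi> y)\<bar>" .
    qed
    also have "\<dots> = (ennreal (unit_ball_vol 2 / 2) * emeasure lborel A) *
        (\<integral>\<^sup>+x. (\<integral>\<^sup>+y. ennreal \<bar>wedge (f \<psi> x) (f \<psi> y)\<bar> \<partial>N) \<partial>N)"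
      by (simp add: nn_integral_cmult)
    also have "(\<integral>\<^sup>+x. (\<integral>\<^sup>+y. ennreal \<bar>wedge (f \<psi> x) (f \<psi> y)\<bar> \<partial>N) \<partial>N)
        = ennreal (\<integral>x. (\<integral>y. \<bar>wedge (f \<psi> x) (f \<psi> y)\<bar> \<partial>N) \<partial>N)"
    proof -
      have adm: "f \<psi> x \<bullet> y \<le> norm (\<psi> y)" for x y unfolding vec[OF \<psi>] by (rule F(2))
      obtain C where "\<And>g. (\<And>y. g \<bullet> y \<le> norm (\<psi> y)) \<Longrightarrow> norm g \<le> C" using dual_norm_bound[OF \<psi>.lin] by blast
      then have fC: "norm (f \<psi> x) \<le> C" for x using adm by blast
      have b: "\<bar>wedge (f \<psi> x) (f \<psi> y)\<bar> \<le> C * C" for x y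
        using fC[of x] fC[of y] order_trans[OF norm_ge_zero fC] by (intro order_trans[OF abs_wedge_le] mult_mono) auto
      have i: "integrable N (\<lambda>y. \<bar>wedge (f \<psi> x) (f \<psi> y)\<bar>)" for x
        by (rule N.integrable_const_bound[of _ "C * C"]) (use b in auto)
      have ib: "\<bar>\<integral>y. \<bar>wedge (f \<psi> x) (f \<psi> y)\<bar> \<partial>N\<bar> \<le> C * C" for x
      proof -
        have "\<bar>\<integral>y. \<bar>wedge (f \<psi> x) (f \<psi> y)\<bar> \<partial>N\<bar> \<le> (\<integral>y. C * C \<partial>N)"
          using b by (intro order_trans[OF integral_abs_bound] integral_mono') auto
        then show ?thesis by (simp add: N.prob_space)
      qed
      have "(\<integral>\<^sup>+x. (\<integral>\<^sup>+y. ennreal \<bar>wedge (f \<psi> x) (f \<psi> y)\<bar> \<partial>N) \<partial>N) = (\<integral>\<^sup>+x. ennreal (\<integral>y. \<bar>wedge (f \<psi> x) (f \<psi> y)\<bar> \<partial>N) \<partial>N)"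
        using i by (intro nn_integral_cong nn_integral_eq_integral) auto
      also have "\<dots> = ennreal (\<integral>x. (\<integral>y. \<bar>wedge (f \<psi> x) (f \<psi> y)\<bar> \<partial>N) \<partial>N)"
      proof (rule nn_integral_eq_integral)
        show "integrable N (\<lambda>x. \<integral>y. \<bar>wedge (f \<psi> x) (f \<psi> y)\<bar> \<partial>N)"
          by (rule N.integrable_const_bound[of _ "C * C"]) (use ib in auto)
      qed (auto simp: integral_nonneg_AE)
      finally show ?thesis .
    qed
    finally have total: "(\<integral>\<^sup>+\<pi>. hausdorff_measure 2 (blinfun_apply \<pi> ` (\<psi> ` A)) \<partial>\<mu>)
      = (ennreal (unit_ball_vol 2 / 2) * emeasure lborel A) *
        ennreal (\<integral>x. (\<integral>y. \<bar>wedge (f \<psi> x) (f \<psi> y)\<bar> \<partial>N) \<partial>N)" .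
    have mult: "ennreal (unit_ball_vol 2 / 2 * e) = ennreal (unit_ball_vol 2 / 2) * ennreal e" if "0 \<le> e" for e
      using that by (intro ennreal_mult) auto
    show ?thesis unfolding total by (subst mult) (auto simp: integral_nonneg_AE mult.assoc mult.commute mult.left_commute)
  qed
  have "density_contractor 2 W \<mu>" unfolding density_contractor_def
  proof (intro conjI ballI impI)
    show "prob_space \<mu>" by (rule prob)
    show "space \<mu> = Hom_rank 2" "sets \<mu> = sets ?R" by (auto simp: \<mu>_def sp)
    show "emeasure \<mu> (Hom_rank 2 - Hom_into W) = 0" by (rule null)
    fix V :: "'a set" and A :: "'a set" assume V: "V \<in> grassmannian 2" and A: "A \<in> sets borel" "A \<subseteq> V"
    have area: "hausdorff_measure 2 A = ennreal (unit_ball_vol 2 / measure lborel (param_ball \<psi>)) * emeasure lborel (\<psi> -` A)"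
      and A\<psi>: "A = \<psi> ` (\<psi> -` A)" and A': "\<psi> -` A \<in> sets borel"
      if \<psi>: "linear_param \<psi>" "A \<subseteq> range \<psi>" for \<psi> :: "real \<times> real \<Rightarrow> 'a"
    proof -
      interpret \<psi>: linear_param \<psi> by (rule \<psi>(1))
      show A\<psi>: "A = \<psi> ` (\<psi> -` A)" using \<psi>(2) by auto
      show A': "\<psi> -` A \<in> sets borel" by (rule linear_vimage_borel[OF \<psi>.lin A(1)])
      show "hausdorff_measure 2 A = ennreal (unit_ball_vol 2 / measure lborel (param_ball \<psi>)) * emeasure lborel (\<psi> -` A)"
        using \<psi>.hausdorff_measure_image[OF A', unfolded D2] A\<psi> by simp
    qed
    show "(\<integral>\<^sup>+\<pi>. hausdorff_measure 2 (blinfun_apply \<pi> ` A) \<partial>\<mu>) \<le> hausdorff_measure 2 A"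
    proof -
      obtain \<psi> :: "real \<times> real \<Rightarrow> 'a" where \<psi>: "linear_param \<psi>" "range \<psi> = V"
        using obtain_linear_param[where 'e = "real \<times> real", of V] V by (auto simp: grassmannian_def)
      have AV: "A \<subseteq> range \<psi>" using A \<psi>(2) by simp
      let ?E = "\<integral>x. (\<integral>y. \<bar>wedge (f \<psi> x) (f \<psi> y)\<bar> \<partial>N) \<partial>N"
      have "?E \<le> 2 / measure lborel (param_ball \<psi>)"
      proof (rule wedge_energy_le[OF \<psi>(1) N.prob_space_axioms])
        show "f \<psi> \<in> borel_measurable N" by measurable
      qed (simp only: vec[OF \<psi>(1)] F(2))
      then have "unit_ball_vol 2 / 2 * ?E \<le> unit_ball_vol 2 / 2 * (2 / measure lborel (param_ball \<psi>))"
        by (intro mult_left_mono) auto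
      also have "\<dots> = unit_ball_vol 2 / measure lborel (param_ball \<psi>)" by simp
      finally show ?thesis
        unfolding area[OF \<psi>(1) AV] by (subst A\<psi>[OF \<psi>(1) AV]) (simp only: mean[OF \<psi>(1) A'[OF \<psi>(1) AV]] mult_right_mono ennreal_leI zero_le)
    qed
    assume "V = W"
    then have AW: "A \<subseteq> range \<phi>" using A \<phi>(2) by simp
    have "(\<integral>x. (\<integral>y. \<bar>wedge (f \<phi> x) (f \<phi> y)\<bar> \<partial>N) \<partial>N) = 2 / \<kappa>"
      unfolding N_def \<kappa>_def
      by (rule wedge_energy_support_eq[OF \<phi>(1)]) (measurable, simp_all only: vec[OF \<phi>(1)] F(2,3))
    then have "unit_ball_vol 2 / 2 * (\<integral>x. (\<integral>y. \<bar>wedge (f \<phi> x) (f \<phi> y)\<bar> \<partial>N) \<partial>N)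
       = unit_ball_vol 2 / measure lborel (param_ball \<phi>)" by (simp add: \<kappa>_def)
    then show "(\<integral>\<^sup>+\<pi>. hausdorff_measure 2 (blinfun_apply \<pi> ` A) \<partial>\<mu>) = hausdorff_measure 2 A"
      unfolding area[OF \<phi>(1) AW] by (subst A\<psi>[OF \<phi>(1) AW]) (simp only: mean[OF \<phi>(1) A'[OF \<phi>(1) AW]])
  qed
  then show ?thesis by blast
qed

theorem theorem5p11:
  fixes m :: nat and W :: "'a::real_normed_vector set"
  assumes finite_dim: "\<exists>B :: 'a set. finite B \<and> span B = UNIV"
    and m: "m \<in> {1..dim (UNIV :: 'a set) - 1}"
    and cases: "m = 1 \<or> m = 2 \<or> m = dim (UNIV :: 'a set) - 1"
    and W: "W \<in> grassmannian m"
  shows "\<exists>\<mu>. density_contractor m W \<mu>"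
proof -
  obtain B :: "'a set" where B: "finite B" "span B = UNIV" using finite_dim by blast
  consider "m = 1" | "m = 2" | "m \<noteq> 1" "m = dim (UNIV :: 'a set) - 1" using cases by blast
  then show ?thesis
  proof cases
    case 1
    then show ?thesis using density_contractor_line[OF B] W by simp
  next
    case 2
    then have "3 \<le> dim (UNIV :: 'a set)" using m by auto
    then show ?thesis using density_contractor_plane W 2 by blast
  next
    case 3
    then have "3 \<le> dim (UNIV :: 'a set)" using m by auto
    then show ?thesis using density_contractor_hyperplane W 3 by blast
  qed
qed

end
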